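(* Let $c_i:\mathbb{R}^l\to\mathbb{R}$, $i=1,\dots,N$, be local cost functions and $c=\sum_{i=1}^Nc_i$. Let $\{x_{i,k}\}$ be produced by the algorithm DSAAWET (defined in the context), with arbitrary initial values $x_{i,0}$, and with the observations $$O_{i,k+1}=-\frac{c_i(x_{i,k}+\alpha_k\Delta_{i,k})+\xi^+_{i,k+1}-c_i(x_{i,k}-\alpha_k\Delta_{i,k})-\xi^-_{i,k+1}}{2\alpha_k}\,\Delta_{i,k}.$$ Assume that the communication condition A4 of the context holds and, in addition: C1) (i) $\gamma_k>0$, $\sum_{k=1}^\infty\gamma_k=\infty$, and $\sum_{k=1}^\infty\gamma_k^p<\infty$ for some $p\in(1,2]$; (ii) $\alpha_k>0$ and $\alpha_k\to0$ as $k\to\infty$; (iii) $\sum_{k=1}^\infty\gamma_k^2/\alpha_k^2<\infty$. C2) (i) $c_i$, $i=1,\dots,N$, are continuously differentiable, and $\nabla c$ is locally Lipschitz continuous; (ii) $c$ is convex with a unique global minimum $x_{min}$; (iii) $c(x^* )<\inf_{\|x\|=c_0}c(x)$ and $\|x^*\|<c_0$ for some positive constant $c_0$. C3) For any $i=1,\dots,N$: $\xi_{i,k+1}=\xi^+_{i,k+1}-\xi^-_{i,k+1}$ is independent of $\{\Delta_{i,s},s=1,2,\dots,k\}$ for any $k\ge0$, and $\xi_{i,k+1}$ satisfies one of the following two conditions: (i) $\sup_k|\xi_{i,k}|\le\xi_i$ a.s., where $\xi_i$ may be random; (ii) $\sup_k\mathbb E[\xi_{i,k+1}^2]<\infty$.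 Then for any $i=1,2,\dots,N$, $$x_{i,k}\to x_{min}\quad\text{almost surely as }k\to\infty .$$
   Context: Random directions and noise. For each agent $i$, $\{\Delta_{i,k}\}$ is a sequence of mutually independent random vectors in $\mathbb{R}^l$ whose components independently take values $\pm1$ with probability $\frac12$. $\xi^+_{i,k+1}$ and $\xi^-_{i,k+1}$ are the (real-valued) observation noises of $c_i$ at the points $x_{i,k}+\alpha_k\Delta_{i,k}$ and $x_{i,k}-\alpha_k\Delta_{i,k}$, respectively. Network. $\mathcal V=\{1,\dots,N\}$. At each time $k=0,1,2,\dots$ communication is described by a digraph $\mathcal G(k)=\{\mathcal V,\mathcal E(k)\}$ with nonnegative adjacency matrix $W(k)=[\omega_{ij}(k)]_{i,j=1}^N$, where $\omega_{ij}(k)>0$ if and only if $(j,i)\in\mathcal E(k)$; $N_i(k)=\{j\in\mathcal V:(j,i)\in\mathcal E(k)\}$, and $i\in N_i(k)$ for all $i,k$. A4: (a) $W(k)$ is doubly stochastic for every $k\ge0$; (b) there is a constant $0<\eta<1$ with $\omega_{ij}(k)\ge\eta$ for all $j\in N_i(k)$, $i\in\mathcal V$, $k\ge0$; (c) the digraph $\mathcal G_\infty=\{\mathcal V,\mathcal E_\infty\}$ is strongly connected, where $\mathcal E_\infty=\{(j,i):(j,i)\in\mathcal E(k)\text{ for infinitely many }k\}$; (d) there is a positive integer $B$ such that $(j,i)\in\mathcal E(k)\cup\dots\cup\mathcal E(k+B-1)$ for all $(j,i)\in\mathcal E_\infty$ and all $k\ge0$. Algorithm DSAAWET. $I_{[\cdot]}$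 is the indicator (1 if the condition holds, 0 otherwise), $\|\cdot\|$ the Euclidean norm. Let $\{\gamma_k\}$ be step sizes, $x^*\in\mathbb{R}^l$ a fixed vector known to all agents, and $\{M_k\}_{k\ge0}$ a sequence of positive numbers increasingly diverging to infinity with $M_0\ge\|x^*\|$. With $\sigma_{i,0}=0$ for all $i$, define for $k\ge0$, $i\in\mathcal V$: $$\hat\sigma_{i,k}=\max_{j\in N_i(k)}\sigma_{j,k},$$ $$x'_{i,k+1}=\Big(\sum_{j\in N_i(k)}\omega_{ij}(k)\big(x_{j,k}I_{[\sigma_{j,k}=\hat\sigma_{i,k}]}+x^*I_{[\sigma_{j,k}<\hat\sigma_{i,k}]}\big)+\gamma_kO_{i,k+1}\Big)I_{[\sigma_{i,k}=\hat\sigma_{i,k}]}+x^*I_{[\sigma_{i,k}<\hat\sigma_{i,k}]},$$ $$x_{i,k+1}=x^*I_{[\|x'_{i,k+1}\|>M_{\hat\sigma_{i,k}}]}+x'_{i,k+1}I_{[\|x'_{i,k+1}\|\le M_{\hat\sigma_{i,k}}]},\qquad \sigma_{i,k+1}=\hat\sigma_{i,k}+I_{[\|x'_{i,k+1}\|>M_{\hat\sigma_{i,k}}]}.$$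
   Formalization: In C3 the independence is required jointly in time: for every k the noises ξ_{i,1},…,ξ_{i,k+1} together are independent of Δ_{i,1},…,Δ_{i,k}; with ξ_{i,k+1} alone the claim fails, e.g. for ξ_{k+1}=ZΔ_k with Z an independent random sign. *)

theory Defs
  imports "HOL-Probability.Probability"
begin

section \<open>Functions on Euclidean space\<close>

definition continuously_differentiable :: "('x::real_inner \<Rightarrow> real) \<Rightarrow> bool" where
  "continuously_differentiable f \<longleftrightarrow>
     (\<exists>g. (\<forall>x. GDERIV f x :> g x) \<and> continuous_on UNIV g)"

definition locally_lipschitz_gradient :: "('x::real_inner \<Rightarrow> real) \<Rightarrow> bool" where
  "locally_lipschitz_gradient f \<longleftrightarrow>
     (\<exists>g. (\<forall>x. GDERIV f x :> g x) \<and> (\<forall>x. \<exists>e>0. \<exists>L. L-lipschitz_on (ball x e) g))"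

definition unique_global_min :: "('x \<Rightarrow> real) \<Rightarrow> 'x \<Rightarrow> bool" where
  "unique_global_min f m \<longleftrightarrow>
     (\<forall>y. f m \<le> f y) \<and> (\<forall>z. (\<forall>y. f z \<le> f y) \<longrightarrow> z = m)"

section \<open>Communication network\<close>

definition doubly_stochastic :: "real^'v^'v \<Rightarrow> bool" where
  "doubly_stochastic A \<longleftrightarrow>
     (\<forall>i j. 0 \<le> A $ i $ j) \<and> (\<forall>i. (\<Sum>j\<in>UNIV. A $ i $ j) = 1) \<and> (\<forall>j. (\<Sum>i\<in>UNIV. A $ i $ j) = 1)"

text \<open>An edge \<open>(j, i)\<close> means that \<open>i\<close> receives information from \<open>j\<close>.\<close>

definition in_nbrs :: "('v \<times> 'v) set \<Rightarrow> 'v \<Rightarrow> 'v set" where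
  "in_nbrs E i = {j. (j, i) \<in> E}"

definition recurrent_edges :: "(nat \<Rightarrow> ('v \<times> 'v) set) \<Rightarrow> ('v \<times> 'v) set" where
  "recurrent_edges E = {e. infinite {k. e \<in> E k}}"

definition strongly_connected :: "('v \<times> 'v) set \<Rightarrow> bool" where
  "strongly_connected E \<longleftrightarrow> (\<forall>i j. (i, j) \<in> E\<^sup>*)"

text \<open>The digraphs \<open>E k\<close> on the agents have nonnegative adjacency matrices \<open>W k\<close>, and
  every agent is its own neighbour at all times.\<close>

definition network :: "(nat \<Rightarrow> ('v \<times> 'v) set) \<Rightarrow> (nat \<Rightarrow> real^'v^'v) \<Rightarrow> bool" where
  "network E W \<longleftrightarrow>
     (\<forall>k i j. 0 \<le> W k $ i $ j) \<and>
     (\<forall>k i j. 0 < W k $ i $ j \<longleftrightarrow> (j, i) \<in> E k) \<and>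
     (\<forall>k i. i \<in> in_nbrs (E k) i)"

definition communication_condition ::
    "(nat \<Rightarrow> ('v \<times> 'v) set) \<Rightarrow> (nat \<Rightarrow> real^'v^'v) \<Rightarrow> bool" where
  "communication_condition E W \<longleftrightarrow>
     (\<forall>k. doubly_stochastic (W k)) \<and>
     (\<exists>\<eta>. 0 < \<eta> \<and> \<eta> < 1 \<and> (\<forall>k i. \<forall>j\<in>in_nbrs (E k) i. \<eta> \<le> W k $ i $ j)) \<and>
     strongly_connected (recurrent_edges E) \<and>
     (\<exists>B>0. \<forall>e\<in>recurrent_edges E. \<forall>k. e \<in> (\<Union>s\<in>{k..<k+B}. E s))"

section \<open>The algorithm DSAAWET\<close>

text \<open>One time step, from the estimates \<open>x\<close> and truncation counters \<open>s\<close> of all agents: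
  \<open>A\<close> is the current weight matrix, \<open>g\<close> the step size and \<open>o\<^sub>i\<close> the observation of agent \<open>i\<close>.\<close>

definition max_counter :: "('v \<times> 'v) set \<Rightarrow> ('v \<Rightarrow> nat) \<Rightarrow> 'v \<Rightarrow> nat" where
  "max_counter E s i = Max (s ` in_nbrs E i)"

definition trial_point ::
    "('v \<times> 'v) set \<Rightarrow> real^'v^'v \<Rightarrow> real \<Rightarrow> real^'l \<Rightarrow> ('v \<Rightarrow> real^'l) \<Rightarrow> ('v \<Rightarrow> nat)
      \<Rightarrow> real^'l \<Rightarrow> 'v \<Rightarrow> real^'l" where
  "trial_point E A g xstar x s o\<^sub>i i =
     of_bool (s i = max_counter E s i) *\<^sub>R
       ((\<Sum>j\<in>in_nbrs E i. A $ i $ j *\<^sub>R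
           (of_bool (s j = max_counter E s i) *\<^sub>R x j + of_bool (s j < max_counter E s i) *\<^sub>R xstar))
        + g *\<^sub>R o\<^sub>i)
     + of_bool (s i < max_counter E s i) *\<^sub>R xstar"

text \<open>\<open>dsaawet E W \<gamma> xstar M Obs x \<sigma>\<close>: the sequences \<open>x\<close> and \<open>\<sigma>\<close> are generated by the algorithm
  from the initial values \<open>x i 0\<close> and the observations \<open>Obs i (k+1)\<close>.\<close>

definition dsaawet ::
    "(nat \<Rightarrow> ('v \<times> 'v) set) \<Rightarrow> (nat \<Rightarrow> real^'v^'v) \<Rightarrow> (nat \<Rightarrow> real) \<Rightarrow> real^'l \<Rightarrow> (nat \<Rightarrow> real)
      \<Rightarrow> ('v \<Rightarrow> nat \<Rightarrow> real^'l) \<Rightarrow> ('v \<Rightarrow> nat \<Rightarrow> real^'l) \<Rightarrow> ('v \<Rightarrow> nat \<Rightarrow> nat) \<Rightarrow> bool" where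
  "dsaawet E W \<gamma> xstar M Obs x \<sigma> \<longleftrightarrow>
     (\<forall>i. \<sigma> i 0 = 0) \<and>
     (\<forall>i k.
        let m = max_counter (E k) (\<lambda>j. \<sigma> j k) i;
            x' = trial_point (E k) (W k) (\<gamma> k) xstar (\<lambda>j. x j k) (\<lambda>j. \<sigma> j k) (Obs i (Suc k)) i
        in x i (Suc k) = of_bool (norm x' > M m) *\<^sub>R xstar + of_bool (norm x' \<le> M m) *\<^sub>R x' \<and>
           \<sigma> i (Suc k) = m + of_bool (norm x' > M m))"

section \<open>Random directions and observation noise\<close>

definition random_directions :: "'a measure \<Rightarrow> (nat \<Rightarrow> 'a \<Rightarrow> real^'l) \<Rightarrow> bool" where
  "random_directions P D \<longleftrightarrow>
     prob_space.indep_vars P (\<lambda>_. borel) D UNIV \<and>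
     (\<forall>k. prob_space.indep_vars P (\<lambda>_. borel) (\<lambda>r \<omega>. D k \<omega> $ r) UNIV) \<and>
     (\<forall>k r. measure P {\<omega>\<in>space P. D k \<omega> $ r = 1} = 1/2 \<and>
            measure P {\<omega>\<in>space P. D k \<omega> $ r = -1} = 1/2)"

text \<open>Independence is understood jointly in time: for every \<open>k\<close>, the noises up to \<open>\<xi> (k+1)\<close> are
  independent of the directions \<open>D 1, \<dots>, D k\<close>. Requiring it only of the single variable
  \<open>\<xi> (k+1)\<close> would be too weak: if \<open>Z\<close> is a random sign independent of scalar directions \<open>D\<close>, then
  each \<open>\<xi> (k+1) = Z * D k\<close> is independent of \<open>D 1, \<dots>, D k\<close>, but the gradient estimate
  then has the systematic error \<open>Z / (2 * \<alpha> k)\<close>.\<close>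

definition noise_indep_directions ::
    "'a measure \<Rightarrow> (nat \<Rightarrow> 'a \<Rightarrow> real) \<Rightarrow> (nat \<Rightarrow> 'a \<Rightarrow> real^'l) \<Rightarrow> bool" where
  "noise_indep_directions P \<xi> D \<longleftrightarrow>
     (\<forall>k. prob_space.indep_set P
            (sets (vimage_algebra (space P) (\<lambda>\<omega>. \<lambda>s\<in>{1..k+1}. \<xi> s \<omega>) (Pi\<^sub>M {1..k+1} (\<lambda>_. borel))))
            (sets (vimage_algebra (space P) (\<lambda>\<omega>. \<lambda>s\<in>{1..k}. D s \<omega>) (Pi\<^sub>M {1..k} (\<lambda>_. borel)))))"

text \<open>Noise indices start at 1.\<close>

definition noise_bounded :: "'a measure \<Rightarrow> (nat \<Rightarrow> 'a \<Rightarrow> real) \<Rightarrow> bool" where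
  "noise_bounded P \<xi> \<longleftrightarrow>
     (\<exists>b\<in>borel_measurable P. AE \<omega> in P. \<forall>k. \<bar>\<xi> (Suc k) \<omega>\<bar> \<le> (b \<omega> :: real))"

definition noise_bounded_second_moment :: "'a measure \<Rightarrow> (nat \<Rightarrow> 'a \<Rightarrow> real) \<Rightarrow> bool" where
  "noise_bounded_second_moment P \<xi> \<longleftrightarrow>
     (SUP k. \<integral>\<^sup>+\<omega>. ennreal ((\<xi> (Suc k) \<omega>)\<^sup>2) \<partial>P) < \<infinity>"

end

theory Submission
  imports Defs
begin

text \<open>
  The argument is pathwise, on the almost sure event that the directions are sign vectors and the
  series \<open>\<Sum>\<gamma>\<^sub>k (\<Delta>\<^sub>k \<Delta>\<^sub>k\<^sup>T - I)\<close> and \<open>\<Sum>(\<gamma>\<^sub>k / \<alpha>\<^sub>k) \<xi>\<^sub>k\<^sub>+\<^sub>1 \<Delta>\<^sub>k\<close> converge for every agent.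
  The first series is covered by Kolmogorov's criterion, the second by the same criterion after
  conditioning on the noise. By the mean value theorem the observation of an agent is
  \<open>-\<Delta> \<Delta>\<^sup>T \<nabla>c\<^sub>i(x)\<close> plus noise plus a vanishing error. Over a window whose step sizes sum to a
  small \<open>T\<close> the iterates hardly move, so \<open>\<nabla>c\<^sub>i(x)\<close> is almost constant there and
  \<open>\<Delta> \<Delta>\<^sup>T\<close> averages out to the identity, although the iterates may depend on the directions. As the weights are doubly stochastic and their products
  contract, the agents agree up to a small error, and by convexity every window brings their mean
  closer to the minimiser by a fixed amount as long as it is not yet near it.

  For the truncations, gradients are evaluated at the projection of the argument to a large ball
  around the minimiser, which makes all bounds global. The recursion with projection that is
  started late and near \<open>xstar\<close> never leaves a fixed ball, hence coincides with the algorithm and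
  causes no further truncation; so the truncation counters are bounded, and after the last
  truncation the algorithm is again a recursion of this kind.
\<close>

section \<open>Consensus\<close>

text \<open>Nothing is assumed about the joint law of different agents: the directions of one may
  depend on the directions and noises of another. Averaging mixes these into \<open>x i k\<close>,
  so the conditional mean of \<open>\<Delta> \<Delta>^T\<close> given the past need not be the
  identity, and no martingale structure is at hand. Probability is therefore used only for series
  that involve a single agent and no iterate. The passage to iterates works because the Cauchy bound
  for sums of \<open>\<gamma> k *\<^sub>R (A i k v - v)\<close> is linear in \<open>v\<close>: it
  holds for all \<open>v\<close> at once, so \<open>v\<close> may be a gradient frozen along the
  path.

  A second obstacle is circular: gradient bounds need bounded iterates, and boundedness rests on
  gradient bounds. The recursion with projection is stable without any such knowledge. Its
  thresholds depend on the sample path but on neither the starting time nor the starting state,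
  because the time of the decisive restart is itself random.\<close>

lemma recurrent_flooding:
  fixes E :: "nat \<Rightarrow> ('v::finite \<times> 'v) set"
  assumes net: "network E W" and com: "communication_condition E W"
  obtains L where "L > 0" "\<And>S s j k. (\<And>k i j. k \<ge> s \<Longrightarrow> j \<in> S k \<Longrightarrow> (j, i) \<in> E k \<Longrightarrow> i \<in> S (Suc k))
      \<Longrightarrow> j \<in> S s \<Longrightarrow> k \<ge> s + L \<Longrightarrow> S k = UNIV"
proof -
  obtain B where B: "B > 0" "\<And>e k. e \<in> recurrent_edges E \<Longrightarrow> e \<in> (\<Union>s\<in>{k..<k+B}. E s)"
    using com unfolding communication_condition_def by blast
  have sc: "(i, j) \<in> (recurrent_edges E)\<^sup>*" for i j
    using com unfolding communication_condition_def strongly_connected_def by blast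
  have self: "(i, i) \<in> E k" for i k
    using net unfolding network_def in_nbrs_def by blast
  have "\<forall>i j. \<exists>n. (i, j) \<in> recurrent_edges E ^^ n"
    using sc rtrancl_imp_relpow by fast
  then obtain len where len: "\<And>i j. (i, j) \<in> recurrent_edges E ^^ len i j" by metis
  define n0 where "n0 = Max (range (\<lambda>(i, j). len i j))"
  have n0: "len i j \<le> n0" for i j
    unfolding n0_def by (rule Max_ge) (auto intro!: image_eqI[of _ _ "(i,j)"])
  \<comment> \<open>\<open>S k\<close> stands for the agents reached by time \<open>k\<close>. It
    stays abstract because two kinds of information are propagated below: lower bounds in a matrix
    column and truncation levels.\<close>
  have main: "S k = UNIV" if cl: "\<And>k i j. k \<ge> s \<Longrightarrow> j \<in> S k \<Longrightarrow> (j, i) \<in> E k \<Longrightarrow> i \<in> S (Suc k)"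
    and j: "j \<in> S s" and k: "k \<ge> s + (n0 + 1) * B" for S :: "nat \<Rightarrow> 'v set" and s j k
  proof -
    have mono: "i \<in> S b" if "i \<in> S a" "s \<le> a" "a \<le> b" for a b i
      using that(3) by (induction rule: dec_induct) (use that cl self in auto)
    \<comment> \<open>A recurrent edge occurs in every period of \<open>B\<close> steps, and until
      it does the self-loops keep \<open>i\<close> in the set; so \<open>B\<close> steps suffice for
      one hop.\<close>
    have edge: "i' \<in> S (a + B)" if "i \<in> S a" "s \<le> a" "(i, i') \<in> recurrent_edges E" for i i' a
    proof -
      from B(2)[OF that(3), of a] obtain t where "a \<le> t" "t < a + B" "(i, i') \<in> E t" by auto
      moreover from this have "i \<in> S t" using mono[OF that(1,2)] by auto
      ultimately have "i' \<in> S (Suc t)" using cl that by auto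
      then show ?thesis using mono[of i' "Suc t" "a + B"] \<open>t < a + B\<close> \<open>a \<le> t\<close> that by auto
    qed
    have path: "(i, i') \<in> recurrent_edges E ^^ n \<Longrightarrow> i \<in> S s \<Longrightarrow> i' \<in> S (s + n * B)" for n i i'
    proof (induction n arbitrary: i')
      case (Suc n)
      then obtain l where "(i, l) \<in> recurrent_edges E ^^ n" "(l, i') \<in> recurrent_edges E" by auto
      then have "i' \<in> S (s + n * B + B)" using Suc edge[of l "s + n * B" i'] by auto
      then show ?case by (simp add: algebra_simps)
    qed auto
    have "i \<in> S k" for i
    proof -
      have "i \<in> S (s + len j i * B)" using path[OF len j] .
      moreover have "s + len j i * B \<le> k"
        using k n0[of j i] mult_le_mono1[of "len j i" "n0 + 1" B] by linarith
      ultimately show ?thesis using mono[of i "s + len j i * B" k] by auto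
    qed
    then show ?thesis by auto
  qed
  show thesis
  proof (rule that)
    \<comment> \<open>The additional \<open>B\<close> keeps the length positive even if all chosen
      paths have length 0.\<close>
    show "(n0 + 1) * B > 0" using B(1) by simp
  next
    fix S s j k
    assume "\<And>k i j. k \<ge> s \<Longrightarrow> j \<in> S k \<Longrightarrow> (j, i) \<in> E k \<Longrightarrow> i \<in> S (Suc k)" "j \<in> S s" "s + (n0 + 1) * B \<le> k"
    then show "S k = UNIV" by (rule main)
  qed
qed

section \<open>Products of doubly stochastic weight matrices\<close>

fun transition_matrix :: "(nat \<Rightarrow> real^'v^'v) \<Rightarrow> nat \<Rightarrow> nat \<Rightarrow> real^'v^'v" where
  "transition_matrix W s 0 = mat 1"
| "transition_matrix W s (Suc n) = W (s + n) ** transition_matrix W s n"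

lemma doubly_stochastic_mat_1: "doubly_stochastic (mat 1 :: real^'v::finite^'v)"
  unfolding doubly_stochastic_def by (auto simp: mat_def if_distrib cong: if_cong)

lemma doubly_stochastic_mult:
  fixes A B :: "real^'v::finite^'v"
  assumes "doubly_stochastic A" "doubly_stochastic B"
  shows "doubly_stochastic (A ** B)"
  unfolding doubly_stochastic_def
proof (intro conjI allI)
  note a = assms[unfolded doubly_stochastic_def]
  fix i j
  show "0 \<le> (A ** B) $ i $ j"
    using a by (auto simp: matrix_matrix_mult_def intro!: sum_nonneg mult_nonneg_nonneg)
  have "(\<Sum>j\<in>UNIV. (A ** B) $ i $ j) = (\<Sum>k\<in>UNIV. A $ i $ k * (\<Sum>j\<in>UNIV. B $ k $ j))"
    unfolding matrix_matrix_mult_def sum_distrib_left by (simp, rule sum.swap)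
  then show "(\<Sum>j\<in>UNIV. (A ** B) $ i $ j) = 1" using a by simp
  have "(\<Sum>i\<in>UNIV. (A ** B) $ i $ j) = (\<Sum>k\<in>UNIV. (\<Sum>i\<in>UNIV. A $ i $ k) * B $ k $ j)"
    unfolding matrix_matrix_mult_def sum_distrib_right by (simp, rule sum.swap)
  then show "(\<Sum>i\<in>UNIV. (A ** B) $ i $ j) = 1" using a by simp
qed

lemma doubly_stochastic_transition_matrix:
  assumes "\<And>k. doubly_stochastic (W k)"
  shows "doubly_stochastic (transition_matrix W s n)"
  by (induction n) (auto intro: doubly_stochastic_mat_1 doubly_stochastic_mult assms)

text \<open>Fix a column \<open>j\<close>. The rows whose entry after \<open>n\<close> steps is at
  least \<open>\<eta> ^ n\<close> form a set that is passed on along edges: a neighbour's entry is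
  inherited with a factor of at least \<eta>, and all other terms of the product are nonnegative.
  Flooding fills the column after \<open>L\<close> steps, uniformly in the starting time.\<close>

lemma transition_matrix_lower_bound:
  fixes E :: "nat \<Rightarrow> ('v::finite \<times> 'v) set"
  assumes net: "network E W" and com: "communication_condition E W"
  obtains L \<beta> where "L > 0" "\<beta> > 0" "\<And>s i j. transition_matrix W s L $ i $ j \<ge> \<beta>"
proof -
  obtain L where L: "L > 0" "\<And>S s j k. (\<And>k i j. k \<ge> s \<Longrightarrow> j \<in> S k \<Longrightarrow> (j, i) \<in> E k \<Longrightarrow> i \<in> S (Suc k))
      \<Longrightarrow> j \<in> S s \<Longrightarrow> k \<ge> s + L \<Longrightarrow> S k = UNIV"
    using recurrent_flooding[OF net com] by blast
  obtain \<eta> where \<eta>: "0 < \<eta>" "\<eta> < 1" "\<And>k i j. (j, i) \<in> E k \<Longrightarrow> \<eta> \<le> W k $ i $ j"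
    using com unfolding communication_condition_def in_nbrs_def by blast
  have ds: "doubly_stochastic (W k)" for k
    using com unfolding communication_condition_def by blast
  have "transition_matrix W s L $ i $ j \<ge> \<eta> ^ L" for s i j
  proof -
    define S where "S k = {i. transition_matrix W s (k - s) $ i $ j \<ge> \<eta> ^ (k - s)}" for k
    have "S (s + L) = UNIV"
    proof (rule L(2)[of s S j])
      show "j \<in> S s" by (simp add: S_def mat_def)
    next
      fix k i l assume k: "s \<le> k" and l: "l \<in> S k" and e: "(l, i) \<in> E k"
      have nn: "0 \<le> W k $ i $ a * transition_matrix W s (k - s) $ a $ j" for a
        using ds[of k] doubly_stochastic_transition_matrix[of W, OF ds, of s "k - s"]
        unfolding doubly_stochastic_def by simp
      have "\<eta> ^ (Suc k - s) = \<eta> * \<eta> ^ (k - s)" using k by (simp add: Suc_diff_le)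
      also have "\<dots> \<le> W k $ i $ l * transition_matrix W s (k - s) $ l $ j"
        using l \<eta>(1) \<eta>(3)[OF e] by (intro mult_mono) (auto simp: S_def)
      also have "\<dots> \<le> (\<Sum>a\<in>UNIV. W k $ i $ a * transition_matrix W s (k - s) $ a $ j)"
        by (rule member_le_sum) (use nn in auto)
      also have "\<dots> = transition_matrix W s (Suc k - s) $ i $ j"
        using k by (simp add: Suc_diff_le matrix_matrix_mult_def)
      finally show "i \<in> S (Suc k)" by (simp add: S_def)
    qed auto
    then have "i \<in> S (s + L)" by auto
    then show ?thesis by (simp add: S_def)
  qed
  then show thesis using that[of L "\<eta> ^ L"] L(1) \<eta>(1) by auto
qed

section \<open>Agent means and the decay of disagreement\<close>

definition agent_mean :: "('v::finite \<Rightarrow> 'b::real_normed_vector) \<Rightarrow> 'b" where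
  "agent_mean x = (1 / real CARD('v)) *\<^sub>R (\<Sum>i\<in>UNIV. x i)"

lemma agent_mean_add: "agent_mean (\<lambda>i. x i + y i) = agent_mean x + agent_mean y"
  by (simp add: agent_mean_def sum.distrib scaleR_right_distrib)

lemma agent_mean_const [simp]: "agent_mean (\<lambda>i::'v::finite. a) = a"
  by (simp add: agent_mean_def sum_constant_scaleR)

lemma norm_agent_mean_le:
  fixes x :: "'v::finite \<Rightarrow> 'b::real_normed_vector"
  assumes "\<And>i. norm (x i) \<le> d"
  shows "norm (agent_mean x) \<le> d"
proof -
  have "norm (\<Sum>i\<in>UNIV. x i) \<le> of_nat CARD('v) * d"
    by (rule sum_norm_bound) (use assms in auto)
  then show ?thesis by (simp add: agent_mean_def divide_simps mult.commute)
qed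

lemma agent_mean_stochastic:
  fixes x :: "'v::finite \<Rightarrow> 'b::real_normed_vector"
  assumes "doubly_stochastic A"
  shows "agent_mean (\<lambda>i. \<Sum>j\<in>UNIV. A $ i $ j *\<^sub>R x j) = agent_mean x"
proof -
  have "(\<Sum>i\<in>UNIV. \<Sum>j\<in>UNIV. A $ i $ j *\<^sub>R x j) = (\<Sum>j\<in>UNIV. (\<Sum>i\<in>UNIV. A $ i $ j) *\<^sub>R x j)"
    unfolding scaleR_sum_left by (rule sum.swap)
  then show ?thesis using assms by (simp add: agent_mean_def doubly_stochastic_def)
qed

lemma norm_weighted_sum_le:
  fixes x :: "'v::finite \<Rightarrow> 'b::real_normed_vector"
  assumes "\<And>j. 0 \<le> a j" "\<And>j. norm (x j) \<le> d"
  shows "norm (\<Sum>j\<in>UNIV. a j *\<^sub>R x j) \<le> (\<Sum>j\<in>UNIV. a j) * d"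
  unfolding sum_distrib_right
  by (rule sum_norm_le) (use assms in \<open>auto intro!: mult_left_mono\<close>)

text \<open>The free perturbation \<open>p\<close> separates consensus from gradients; in the
  application it depends on \<open>x\<close> itself.\<close>

definition averaging_process ::
    "(nat \<Rightarrow> real^'v^'v) \<Rightarrow> nat \<Rightarrow> ('v::finite \<Rightarrow> nat \<Rightarrow> 'b::real_normed_vector) \<Rightarrow> ('v \<Rightarrow> nat \<Rightarrow> 'b) \<Rightarrow> bool" where
  "averaging_process W s x p \<longleftrightarrow>
     (\<forall>k\<ge>s. \<forall>i. x i (Suc k) = (\<Sum>j\<in>UNIV. W k $ i $ j *\<^sub>R x j k) + p i k)"

lemma averaging_process_mono: "averaging_process W s x p \<Longrightarrow> s \<le> t \<Longrightarrow> averaging_process W t x p"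
  by (auto simp: averaging_process_def)

lemma agent_mean_averaging_process:
  assumes "averaging_process W s x p" "\<And>k. doubly_stochastic (W k)" "k \<ge> s"
  shows "agent_mean (\<lambda>i. x i (Suc k)) = agent_mean (\<lambda>i. x i k) + agent_mean (\<lambda>i. p i k)"
  using assms by (simp add: averaging_process_def agent_mean_add agent_mean_stochastic)

text \<open>Each step adds one perturbation, and stochastic weights do not amplify those already
  accumulated.\<close>

lemma averaging_process_expand:
  fixes x :: "'v::finite \<Rightarrow> nat \<Rightarrow> 'b::real_normed_vector"
  assumes ap: "averaging_process W s x p" and ds: "\<And>k. doubly_stochastic (W k)"
    and p: "\<And>i k. k \<ge> s \<Longrightarrow> norm (p i k) \<le> \<pi>"
  shows "norm (x i (s + n) - (\<Sum>j\<in>UNIV. transition_matrix W s n $ i $ j *\<^sub>R x j s)) \<le> real n * \<pi>"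
proof (induction n arbitrary: i)
  case 0
  have "(\<Sum>j\<in>UNIV. (mat 1 :: real^'v^'v) $ i $ j *\<^sub>R x j s) = (\<Sum>j\<in>UNIV. if i = j then x j s else 0)"
    by (rule sum.cong) (auto simp: mat_def)
  then show ?case by simp
next
  case (Suc n)
  let ?T = "transition_matrix W s"
  let ?r = "\<lambda>i. x i (s + n) - (\<Sum>j\<in>UNIV. ?T n $ i $ j *\<^sub>R x j s)"
  have "(\<Sum>j\<in>UNIV. ?T (Suc n) $ i $ j *\<^sub>R x j s)
      = (\<Sum>l\<in>UNIV. W (s + n) $ i $ l *\<^sub>R (\<Sum>j\<in>UNIV. ?T n $ l $ j *\<^sub>R x j s))"
    unfolding scaleR_sum_right
    by (simp add: matrix_matrix_mult_def scaleR_sum_left, rule sum.swap)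
  moreover have "x i (s + Suc n) = (\<Sum>l\<in>UNIV. W (s + n) $ i $ l *\<^sub>R x l (s + n)) + p i (s + n)"
    using ap by (simp add: averaging_process_def)
  ultimately have "x i (s + Suc n) - (\<Sum>j\<in>UNIV. ?T (Suc n) $ i $ j *\<^sub>R x j s)
      = (\<Sum>l\<in>UNIV. W (s + n) $ i $ l *\<^sub>R ?r l) + p i (s + n)"
    by (simp add: scaleR_right_diff_distrib sum_subtractf del: transition_matrix.simps)
  also have "norm \<dots> \<le> norm (\<Sum>l\<in>UNIV. W (s + n) $ i $ l *\<^sub>R ?r l) + \<pi>"
    by (rule norm_triangle_le) (use p[of "s+n" i] in auto)
  also have "norm (\<Sum>l\<in>UNIV. W (s + n) $ i $ l *\<^sub>R ?r l) \<le> (\<Sum>l\<in>UNIV. W (s + n) $ i $ l) * (n * \<pi>)"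
    by (rule norm_weighted_sum_le) (use ds[of "s + n"] Suc in \<open>auto simp: doubly_stochastic_def\<close>)
  also have "(\<Sum>l\<in>UNIV. W (s + n) $ i $ l) = 1" using ds[of "s + n"] by (simp add: doubly_stochastic_def)
  finally show ?case by (simp add: algebra_simps)
qed

text \<open>As the deviations from the mean sum to zero, the constant \<open>\<beta>\<close> may be subtracted
  from all entries of the transition matrix.\<close>

lemma deviation_contracts:
  fixes x :: "'v::finite \<Rightarrow> nat \<Rightarrow> 'b::real_normed_vector"
  assumes ap: "averaging_process W s x p" and ds: "\<And>k. doubly_stochastic (W k)"
    and p: "\<And>i k. k \<ge> s \<Longrightarrow> norm (p i k) \<le> \<pi>"
    and dev: "\<And>i. norm (x i s - agent_mean (\<lambda>i. x i s)) \<le> d"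
    and \<beta>: "\<And>i j. transition_matrix W s n $ i $ j \<ge> \<beta>"
  shows "norm (x i (s + n) - agent_mean (\<lambda>i. x i (s + n))) \<le> (1 - real CARD('v) * \<beta>) * d + 2 * real n * \<pi>"
proof -
  let ?T = "transition_matrix W s n"
  define m where "m = agent_mean (\<lambda>i. x i s)"
  define r where "r i = x i (s + n) - (\<Sum>j\<in>UNIV. ?T $ i $ j *\<^sub>R x j s)" for i
  have T: "doubly_stochastic ?T" by (rule doubly_stochastic_transition_matrix[of W, OF ds])
  have r: "norm (r i) \<le> real n * \<pi>" for i
    unfolding r_def by (rule averaging_process_expand[OF ap ds p])
  have mean: "agent_mean (\<lambda>i. x i (s + n)) = m + agent_mean r"
    using agent_mean_add[of "\<lambda>i. \<Sum>j\<in>UNIV. ?T $ i $ j *\<^sub>R x j s" r] agent_mean_stochastic[OF T]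
    by (simp add: r_def m_def)
  have "(\<Sum>j\<in>UNIV. x j s - m) = 0"
    by (simp add: m_def agent_mean_def sum_subtractf sum_constant_scaleR)
  then have "(\<Sum>j\<in>UNIV. (?T $ i $ j - \<beta>) *\<^sub>R (x j s - m)) = (\<Sum>j\<in>UNIV. ?T $ i $ j *\<^sub>R (x j s - m))"
    by (simp add: scaleR_left_diff_distrib sum_subtractf scaleR_sum_right[symmetric])
  also have "\<dots> = (\<Sum>j\<in>UNIV. ?T $ i $ j *\<^sub>R x j s) - m"
    using T by (simp add: scaleR_right_diff_distrib sum_subtractf scaleR_sum_left[symmetric] doubly_stochastic_def)
  finally have "x i (s + n) - agent_mean (\<lambda>i. x i (s + n))
      = (\<Sum>j\<in>UNIV. (?T $ i $ j - \<beta>) *\<^sub>R (x j s - m)) + r i - agent_mean r"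
    by (simp add: mean r_def)
  also have "norm \<dots> \<le> norm (\<Sum>j\<in>UNIV. (?T $ i $ j - \<beta>) *\<^sub>R (x j s - m)) + norm (r i) + norm (agent_mean r)"
    by (meson add_right_mono norm_triangle_ineq norm_triangle_ineq4 order_trans)
  also have "norm (\<Sum>j\<in>UNIV. (?T $ i $ j - \<beta>) *\<^sub>R (x j s - m)) \<le> (\<Sum>j\<in>UNIV. ?T $ i $ j - \<beta>) * d"
    by (rule norm_weighted_sum_le) (use \<beta> dev in \<open>auto simp: m_def\<close>)
  also have "(\<Sum>j\<in>UNIV. ?T $ i $ j - \<beta>) = 1 - real CARD('v) * \<beta>"
    using T by (simp add: sum_subtractf doubly_stochastic_def)
  also have "norm (r i) \<le> real n * \<pi>" by (rule r)
  also have "norm (agent_mean r) \<le> real n * \<pi>" by (rule norm_agent_mean_le) (rule r)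
  finally show ?thesis by (simp add: algebra_simps)
qed

text \<open>The disagreement contracts over blocks of \<open>L\<close> steps. The first conclusion
  covers all times at the cost of the initial disagreement, the second one eventually forgets it.
  \<open>C\<close> is quantified before the process, since it has to serve for processes that are
  chosen after the tolerances.\<close>

lemma consensus_bound:
  fixes E :: "nat \<Rightarrow> ('v::finite \<times> 'v) set"
  assumes net: "network E W" and com: "communication_condition E W"
  shows "\<exists>C>0. \<forall>\<pi> s d (x :: 'v \<Rightarrow> nat \<Rightarrow> 'b::real_normed_vector) p. averaging_process W s x p \<longrightarrow> \<pi> > 0 \<longrightarrow>
      (\<forall>i. \<forall>k\<ge>s. norm (p i k) \<le> \<pi>) \<longrightarrow> (\<forall>i. norm (x i s - agent_mean (\<lambda>i. x i s)) \<le> d) \<longrightarrow>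
      (\<forall>k\<ge>s. \<forall>i. norm (x i k - agent_mean (\<lambda>i. x i k)) \<le> d + C * \<pi>) \<and>
      (\<exists>K. \<forall>k\<ge>K. \<forall>i. norm (x i k - agent_mean (\<lambda>i. x i k)) \<le> C * \<pi>)"
proof -
  obtain L \<beta> where L: "L > 0" and \<beta>: "\<beta> > 0" "\<And>s i j. transition_matrix W s L $ i $ j \<ge> \<beta>"
    using transition_matrix_lower_bound[OF net com] by blast
  have ds: "doubly_stochastic (W k)" for k
    using com unfolding communication_condition_def by blast
  define \<rho> where "\<rho> = 1 - real CARD('v) * \<beta>"
  have "real CARD('v) * \<beta> \<le> 1"
  proof -
    fix i :: 'v
    have "(\<Sum>j\<in>(UNIV :: 'v set). \<beta>) \<le> (\<Sum>j\<in>UNIV. transition_matrix W 0 L $ i $ j)"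
      by (rule sum_mono) (rule \<beta>)
    then show ?thesis using doubly_stochastic_transition_matrix[of W, OF ds, of 0 L]
      by (simp add: doubly_stochastic_def)
  qed
  then have \<rho>: "0 \<le> \<rho>" "\<rho> < 1" using \<beta>(1) by (auto simp: \<rho>_def)
  \<comment> \<open>\<open>C0 * \<pi>\<close> is the fixed point of the block recursion
    \<open>d \<mapsto> \<rho> * d + 2 * real L * \<pi>\<close>.\<close>
  define C0 where "C0 = 2 * real L / (1 - \<rho>)"
  have C0: "C0 > 0" using L \<rho> by (simp add: C0_def)
  have C0_eq: "\<rho> * C0 + 2 * real L = C0" using \<rho> by (simp add: C0_def field_simps)
  show ?thesis
  \<comment> \<open>Beyond \<open>C0\<close>, the summand \<open>2 * real L\<close> pays for an
    incomplete last block and \<open>1\<close> for what is left of the geometrically decaying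
    initial disagreement.\<close>
  proof (intro exI[of _ "C0 + 2 * real L + 1"] conjI[of "_ > 0"] allI impI)
    fix \<pi> s d and x p :: "'v \<Rightarrow> nat \<Rightarrow> 'b"
    assume ap: "averaging_process W s x p" and \<pi>: "\<pi> > 0"
      and p': "\<forall>i. \<forall>k\<ge>s. norm (p i k) \<le> \<pi>"
      and dev': "\<forall>i. norm (x i s - agent_mean (\<lambda>i. x i s)) \<le> d"
    have p: "\<And>i k. k \<ge> s \<Longrightarrow> norm (p i k) \<le> \<pi>" and dev: "\<And>i. norm (x i s - agent_mean (\<lambda>i. x i s)) \<le> d"
      using p' dev' by auto
    have d0: "0 \<le> d" using dev norm_ge_zero order_trans by blast
    let ?dev = "\<lambda>k i. norm (x i k - agent_mean (\<lambda>i. x i k))"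
    have block: "?dev (s + q * L) i \<le> \<rho> ^ q * d + C0 * \<pi>" for q i
    proof (induction q arbitrary: i)
      case 0 then show ?case using dev[of i] C0 \<pi> by (simp add: add_increasing2)
    next
      case (Suc q)
      have "?dev (s + q * L + L) i \<le> (1 - real CARD('v) * \<beta>) * (\<rho> ^ q * d + C0 * \<pi>) + 2 * real L * \<pi>"
        by (rule deviation_contracts[OF averaging_process_mono[OF ap] ds])
           (use p Suc \<beta> in auto)
      also have "\<dots> = \<rho> ^ Suc q * d + (\<rho> * C0 + 2 * real L) * \<pi>"
        by (simp add: \<rho>_def algebra_simps)
      finally show ?case by (simp add: C0_eq add.assoc add.commute[of L])
    qed
    have all: "?dev k i \<le> \<rho> ^ ((k - s) div L) * d + (C0 + 2 * real L) * \<pi>" if k: "k \<ge> s" for k i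
    proof -
      define q r where "q = (k - s) div L" and "r = (k - s) mod L"
      have kk: "k = s + q * L + r" using k by (simp add: q_def r_def)
      have r: "r \<le> L" using L by (simp add: r_def less_imp_le)
      \<comment> \<open>The trivial lower bound \<open>0\<close> for the matrix entries allows
        blocks of any length, without contraction.\<close>
      have "?dev (s + q * L + r) i \<le> (1 - real CARD('v) * 0) * (\<rho> ^ q * d + C0 * \<pi>) + 2 * real r * \<pi>"
        by (rule deviation_contracts[OF averaging_process_mono[OF ap] ds])
           (use p block doubly_stochastic_transition_matrix[of W, OF ds] in \<open>auto simp: doubly_stochastic_def\<close>)
      also have "\<dots> \<le> \<rho> ^ q * d + (C0 + 2 * real L) * \<pi>"
        using r \<pi> by (simp add: algebra_simps)
      finally have "?dev (s + q * L + r) i \<le> \<rho> ^ q * d + (C0 + 2 * real L) * \<pi>" .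
      then show ?thesis unfolding kk[symmetric] unfolding q_def .
    qed
    have "?dev k i \<le> d + (C0 + 2 * real L + 1) * \<pi>" if "k \<ge> s" for k i
    proof -
      have "\<rho> ^ ((k - s) div L) * d \<le> d" using \<rho> d0 by (simp add: mult_left_le_one_le power_le_one)
      then show ?thesis using all[OF that, of i] \<pi> by (simp add: algebra_simps)
    qed
    moreover have "\<exists>K. \<forall>k\<ge>K. \<forall>i. ?dev k i \<le> (C0 + 2 * real L + 1) * \<pi>"
    proof -
      have "(\<lambda>q. \<rho> ^ q * d) \<longlonglongrightarrow> 0 * d" using \<rho> by (intro tendsto_intros LIMSEQ_power_zero) auto
      then have "\<forall>\<^sub>F q in sequentially. \<rho> ^ q * d < \<pi>" using \<pi> by (intro order_tendstoD(2)) auto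
      then obtain q0 where q0: "\<And>q. q \<ge> q0 \<Longrightarrow> \<rho> ^ q * d < \<pi>" by (auto simp: eventually_sequentially)
      have "?dev k i \<le> (C0 + 2 * real L + 1) * \<pi>" if k: "k \<ge> s + q0 * L" for k i
      proof -
        have "q0 \<le> (k - s) div L" using k L by (simp add: less_eq_div_iff_mult_less_eq)
        then have "\<rho> ^ ((k - s) div L) * d < \<pi>" by (rule q0)
        then show ?thesis using all[of k i] k by (simp add: algebra_simps)
      qed
      then show ?thesis by blast
    qed
    ultimately show "(\<forall>k\<ge>s. \<forall>i. ?dev k i \<le> d + (C0 + 2 * real L + 1) * \<pi>) \<and> (\<exists>K. \<forall>k\<ge>K. \<forall>i. ?dev k i \<le> (C0 + 2 * real L + 1) * \<pi>)"
      by blast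
  qed (use C0 in auto)
qed

section \<open>Averaged descent\<close>

text \<open>\<open>m\<close> is the first index at which the sum reaches \<open>T\<close>: the sum
  before it is below \<open>T\<close>, and the last step adds at most \<open>T\<close>.\<close>

lemma window_sum:
  fixes \<gamma> :: "nat \<Rightarrow> real"
  assumes nn: "\<And>k. 0 \<le> \<gamma> k" and ns: "\<not> summable \<gamma>" and T: "T > 0" and le: "\<And>k. k \<ge> n \<Longrightarrow> \<gamma> k \<le> T"
  obtains m where "m > n" "T \<le> (\<Sum>k\<in>{n..<m}. \<gamma> k)" "(\<Sum>k\<in>{n..<m}. \<gamma> k) \<le> 2 * T"
proof -
  have "\<exists>m. T \<le> (\<Sum>k\<in>{n..<m}. \<gamma> k)"
  proof (rule ccontr)
    assume "\<not> ?thesis"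
    then have lt: "(\<Sum>k\<in>{n..<m}. \<gamma> k) \<le> T" for m by (simp add: not_le less_imp_le)
    have "summable (\<lambda>k. \<gamma> (k + n))"
    proof (rule summableI_nonneg_bounded)
      show "(\<Sum>k<m. \<gamma> (k + n)) \<le> T" for m
        using lt[of "m + n"] sum.shift_bounds_nat_ivl[of \<gamma> 0 n m] by (simp add: lessThan_atLeast0)
    qed (use nn in auto)
    then show False using ns by simp
  qed
  then have ex: "T \<le> (\<Sum>k\<in>{n..<(LEAST m. T \<le> (\<Sum>k\<in>{n..<m}. \<gamma> k))}. \<gamma> k)" by (rule LeastI_ex)
  define m where "m = (LEAST m. T \<le> (\<Sum>k\<in>{n..<m}. \<gamma> k))"
  have m: "T \<le> (\<Sum>k\<in>{n..<m}. \<gamma> k)" using ex by (simp add: m_def)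
  have "m > n"
  proof (rule ccontr)
    assume "\<not> m > n" then show False using m T by simp
  qed
  then obtain m' where m': "m = Suc m'" "n \<le> m'" by (metis Suc_le_eq less_imp_Suc_add le_add1 add_Suc_right)
  have "\<not> T \<le> (\<Sum>k\<in>{n..<m'}. \<gamma> k)" using not_less_Least[of m' "\<lambda>m. T \<le> sum \<gamma> {n..<m}"] m' by (simp add: m_def)
  then have "(\<Sum>k\<in>{n..<m}. \<gamma> k) \<le> 2 * T" using m' le[of m'] by simp
  then show thesis using that \<open>m > n\<close> m by blast
qed

text \<open>A bound \<open>D \<ge> 2 * \<epsilon>\<close> is inherited from one window end to the
  next: a window that starts at or above \<epsilon> descends, and one that starts below \<epsilon>
  ends below \<open>2 * \<epsilon>\<close>. Inside a window at most \<epsilon> is added. If all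
  values were at least \<epsilon>, repeated decrements \<open>h\<close> would make \<open>d\<close>
  negative.\<close>

lemma windows_descend:
  fixes d :: "nat \<Rightarrow> real"
  assumes nn: "\<And>k. d k \<ge> 0" and h: "h > 0"
    and w: "\<And>n. n \<ge> K \<Longrightarrow> \<exists>n'>n. (\<forall>k\<in>{n..n'}. \<bar>d k - d n\<bar> \<le> \<epsilon>) \<and> (\<epsilon> \<le> d n \<longrightarrow> d n' \<le> d n - h)"
    and n: "n \<ge> K"
  shows "d n \<le> D \<Longrightarrow> 2 * \<epsilon> \<le> D \<Longrightarrow> k \<ge> n \<Longrightarrow> d k \<le> D + \<epsilon>"
    and "\<exists>k\<ge>n. d k < \<epsilon>"
proof -
  assume D: "d n \<le> D" "2 * \<epsilon> \<le> D" and k: "k \<ge> n"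
  have "\<exists>m\<ge>n + j. d m \<le> D \<and> (\<forall>k\<in>{n..m}. d k \<le> D + \<epsilon>)" for j
  proof (induction j)
    case 0
    obtain n' where "\<forall>k\<in>{n..n'}. \<bar>d k - d n\<bar> \<le> \<epsilon>" "n' > n" using w[OF n] by blast
    then have "\<epsilon> \<ge> 0" using abs_ge_zero[of "d n - d n"] by fastforce
    then show ?case using D by (intro exI[of _ n]) auto
  next
    case (Suc j)
    then obtain m where m: "m \<ge> n + j" "d m \<le> D" "\<And>k. k \<in> {n..m} \<Longrightarrow> d k \<le> D + \<epsilon>" by blast
    then obtain m' where m': "m' > m" "\<And>k. k \<in> {m..m'} \<Longrightarrow> \<bar>d k - d m\<bar> \<le> \<epsilon>" "\<epsilon> \<le> d m \<longrightarrow> d m' \<le> d m - h"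
      using w[of m] n by auto
    have "d m' \<le> D"
    proof (cases "\<epsilon> \<le> d m")
      case False
      then show ?thesis using m'(2)[of m'] m'(1) D by auto
    qed (use m' m h in auto)
    moreover have "d k \<le> D + \<epsilon>" if "k \<in> {n..m'}" for k
    proof (cases "k \<le> m")
      case False
      then show ?thesis using m'(2)[of k] m(2) that by (auto simp: abs_le_iff)
    qed (use m(3) that in auto)
    ultimately show ?case using m m' by (intro exI[of _ m']) auto
  qed
  from this[of "k - n"] show "d k \<le> D + \<epsilon>" using k by auto
next
  show "\<exists>k\<ge>n. d k < \<epsilon>"
  proof (rule ccontr)
    assume "\<not> ?thesis"
    then have ge: "\<epsilon> \<le> d k" if "k \<ge> n" for k using that by force
    have "\<exists>m\<ge>n. d m \<le> d n - real j * h" for j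
    proof (induction j)
      case (Suc j)
      then obtain m where m: "m \<ge> n" "d m \<le> d n - real j * h" by blast
      obtain m' where "m' > m" "d m' \<le> d m - h" using w[of m] ge[of m] m n by auto
      then show ?case using m by (intro exI[of _ m']) (auto simp: algebra_simps)
    qed auto
    moreover obtain j where "d n < real j * h" using reals_Archimedean3[OF h] by blast
    ultimately obtain m where "d m < 0" by (metis diff_less_0_iff_less order_le_less_trans)
    then show False using nn[of m] by simp
  qed
qed

section \<open>Descent of the agent mean towards a point\<close>

lemma agent_mean_diff: "agent_mean (\<lambda>i. x i - y i) = agent_mean x - agent_mean y"
  by (simp add: agent_mean_def sum_subtractf scaleR_right_diff_distrib)

lemma agent_mean_scaleR: "agent_mean (\<lambda>i. r *\<^sub>R x i) = r *\<^sub>R agent_mean x"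
  by (simp add: agent_mean_def scaleR_sum_right[symmetric] mult.commute)

lemma agent_mean_averaging_process_sum:
  assumes "averaging_process W s x p" "\<And>k. doubly_stochastic (W k)" "n \<ge> s" "m \<ge> n"
  shows "agent_mean (\<lambda>i. x i m) = agent_mean (\<lambda>i. x i n) + agent_mean (\<lambda>i. \<Sum>k\<in>{n..<m}. p i k)"
  using assms(4)
proof (induction m rule: dec_induct)
  case base
  then show ?case by simp
next
  case (step m)
  then show ?case using agent_mean_averaging_process[OF assms(1,2), of m] assms(3)
    by (simp add: agent_mean_add)
qed

lemma descent_step:
  fixes u g :: "'b::real_inner"
  assumes u: "\<epsilon> \<le> norm u" and \<epsilon>: "\<epsilon> > 0" and \<kappa>: "\<kappa> > 0" and S: "S \<ge> 0" and g: "norm g \<le> C"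
    and drift: "\<kappa> * norm u \<le> g \<bullet> u" and small: "S * C\<^sup>2 \<le> \<kappa> * \<epsilon>" "S * \<kappa> \<le> 2 * \<epsilon>"
  shows "norm (u - S *\<^sub>R g) \<le> norm u - S * \<kappa> / 2"
proof -
  have "(norm (u - S *\<^sub>R g))\<^sup>2 = (norm u)\<^sup>2 - 2 * S * (g \<bullet> u) + S * (S * (norm g)\<^sup>2)"
    by (simp only: power2_norm_eq_inner)
       (simp add: inner_diff_left inner_diff_right inner_commute algebra_simps)
  also have "\<dots> \<le> (norm u)\<^sup>2 - 2 * S * (\<kappa> * norm u) + S * (\<kappa> * norm u)"
  proof -
    have "S * (g \<bullet> u) \<ge> S * (\<kappa> * norm u)" by (rule mult_left_mono[OF drift S])
    moreover have "S * (norm g)\<^sup>2 \<le> \<kappa> * norm u"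
    proof -
      have "S * (norm g)\<^sup>2 \<le> S * C\<^sup>2" using g S by (intro mult_left_mono power_mono) auto
      also have "\<dots> \<le> \<kappa> * norm u" using small(1) u \<kappa> by (meson mult_left_mono less_imp_le order_trans)
      finally show ?thesis .
    qed
    then have "S * (S * (norm g)\<^sup>2) \<le> S * (\<kappa> * norm u)" by (rule mult_left_mono[OF _ S])
    ultimately show ?thesis by simp
  qed
  also have "\<dots> \<le> (norm u - S * \<kappa> / 2)\<^sup>2"
    by (simp add: power2_diff algebra_simps)
  finally show ?thesis
    by (rule power2_le_imp_le) (use small(2) u in auto)
qed

text \<open>\<open>G\<close> is to be the projected gradient, \<open>A i k\<close> the matrix
  \<open>D D^T\<close> of a direction, \<open>F\<close> the difference quotient, and \<nu> the noise
  with its step size multiplied in. Randomness has disappeared: of the averaging effect of the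
  directions only the Cauchy condition \<open>A_average\<close> is kept. A drift is asked only of
  the agent mean of \<open>G\<close>, since the individual costs need not share the minimiser, and
  only of order \<open>norm (z - a)\<close>, the most that a bounded \<open>G\<close>
  allows.\<close>

locale averaged_descent =
  fixes E :: "nat \<Rightarrow> ('v::finite \<times> 'v) set" and W :: "nat \<Rightarrow> real^'v^'v"
    and \<gamma> :: "nat \<Rightarrow> real" and F :: "'v \<Rightarrow> nat \<Rightarrow> 'b::euclidean_space \<Rightarrow> 'b" and G :: "'v \<Rightarrow> 'b \<Rightarrow> 'b"
    and A :: "'v \<Rightarrow> nat \<Rightarrow> 'b \<Rightarrow> 'b" and \<nu> :: "'v \<Rightarrow> nat \<Rightarrow> 'b" and a :: 'b and C :: real
  assumes net: "network E W" and com: "communication_condition E W"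
    and step_pos: "\<And>k. \<gamma> k > 0" and step_lim: "\<gamma> \<longlonglongrightarrow> 0" and step_sum: "\<not> summable \<gamma>"
    and C_pos: "C > 0" and G_bound: "\<And>i y. norm (G i y) \<le> C"
    and G_cont: "\<And>i. uniformly_continuous_on UNIV (G i)"
    and A_linear: "\<And>i k. linear (A i k)" and A_bound: "\<And>i k v. norm (A i k v) \<le> C * norm v"
    and A_average: "\<And>i \<epsilon>. \<epsilon> > 0 \<Longrightarrow> \<exists>K. \<forall>m\<ge>K. \<forall>n v. norm (\<Sum>k\<in>{m..<n}. \<gamma> k *\<^sub>R (A i k v - v)) \<le> \<epsilon> * norm v"
    and noise: "\<And>i. summable (\<nu> i)"
    and F_approx: "\<And>i \<epsilon>. \<epsilon> > 0 \<Longrightarrow> \<exists>K. \<forall>k\<ge>K. \<forall>y. norm (F i k y - A i k (G i y)) \<le> \<epsilon>"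
    and drift: "\<And>\<epsilon>. \<epsilon> > 0 \<Longrightarrow> \<exists>\<kappa>>0. \<forall>z. \<epsilon> \<le> norm (z - a) \<longrightarrow>
                  \<kappa> * norm (z - a) \<le> agent_mean (\<lambda>i. G i z) \<bullet> (z - a)"
begin

abbreviation process :: "nat \<Rightarrow> ('v \<Rightarrow> nat \<Rightarrow> 'b) \<Rightarrow> bool" where
  "process s x \<equiv> averaging_process W s x (\<lambda>i k. \<nu> i k - \<gamma> k *\<^sub>R F i k (x i k))"

abbreviation centre :: "('v \<Rightarrow> nat \<Rightarrow> 'b) \<Rightarrow> nat \<Rightarrow> 'b" where
  "centre x k \<equiv> agent_mean (\<lambda>i. x i k)"

lemma stochastic: "doubly_stochastic (W k)"
  using com unfolding communication_condition_def by blast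

lemma uniform_in_agents:
  assumes "\<And>i::'v. \<exists>K::nat. \<forall>k\<ge>K. P i k"
  shows "\<exists>K. \<forall>k\<ge>K. \<forall>i. P i k"
proof -
  have "\<forall>\<^sub>F k in sequentially. \<forall>i. P i k"
    by (rule eventually_all_finite) (use assms in \<open>auto simp: eventually_sequentially\<close>)
  then show ?thesis by (simp add: eventually_sequentially)
qed

lemma F_bounded: "\<exists>K. \<forall>k\<ge>K. \<forall>i y. norm (F i k y) \<le> C * C + 1"
proof -
  have "\<exists>K. \<forall>k\<ge>K. \<forall>y. norm (F i k y) \<le> C * C + 1" for i
  proof -
    obtain K where K: "\<And>k y. k \<ge> K \<Longrightarrow> norm (F i k y - A i k (G i y)) \<le> 1" using F_approx[of 1 i] by auto
    have "norm (F i k y) \<le> C * C + 1" if "k \<ge> K" for k y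
    proof -
      have "norm (A i k (G i y)) \<le> C * C"
        using A_bound[of i k "G i y"] G_bound[of i y] C_pos by (meson mult_left_mono less_imp_le order_trans)
      then show ?thesis using K[OF that, of y] norm_triangle_sub[of "F i k y" "A i k (G i y)"] by linarith
    qed
    then show ?thesis by blast
  qed
  then show ?thesis using uniform_in_agents[of "\<lambda>i k. \<forall>y. norm (F i k y) \<le> C * C + 1"] by blast
qed

text \<open>Uniformity in \<open>y\<close> matters: consensus can be secured before anything is
  known about where the iterates are.\<close>

lemma perturbation_small:
  assumes "\<pi> > 0"
  shows "\<exists>K. \<forall>k\<ge>K. \<forall>i y. norm (\<nu> i k - \<gamma> k *\<^sub>R F i k y) \<le> \<pi>"
proof -
  obtain K1 where K1: "\<And>k i y. k \<ge> K1 \<Longrightarrow> norm (F i k y) \<le> C * C + 1" using F_bounded by blast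
  have pos: "C * C + 1 > 0" using C_pos by (simp add: add_pos_pos)
  have "\<forall>\<^sub>F k in sequentially. \<gamma> k < \<pi> / 2 / (C * C + 1)"
    using step_lim assms pos by (intro order_tendstoD(2)) auto
  then obtain K2 where K2: "\<And>k. k \<ge> K2 \<Longrightarrow> \<gamma> k < \<pi> / 2 / (C * C + 1)" by (auto simp: eventually_sequentially)
  have "\<exists>K. \<forall>k\<ge>K. norm (\<nu> i k) < \<pi> / 2" for i
    using LIMSEQ_D[OF summable_LIMSEQ_zero[OF noise[of i]], of "\<pi> / 2"] assms by auto
  then obtain K3 where K3: "\<And>k i. k \<ge> K3 \<Longrightarrow> norm (\<nu> i k) < \<pi> / 2"
    using uniform_in_agents[of "\<lambda>i k. norm (\<nu> i k) < \<pi> / 2"] by blast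
  have "norm (\<nu> i k - \<gamma> k *\<^sub>R F i k y) \<le> \<pi>" if k: "k \<ge> max K1 (max K2 K3)" for k i y
  proof -
    have "norm (\<gamma> k *\<^sub>R F i k y) \<le> \<gamma> k * (C * C + 1)"
      using K1[of k i y] k step_pos[of k] by (simp add: mult_left_mono)
    also have "\<dots> \<le> \<pi> / 2" using K2[of k] k pos by (simp add: pos_less_divide_eq algebra_simps)
    finally show ?thesis using K3[of k i] k norm_triangle_ineq4[of "\<nu> i k" "\<gamma> k *\<^sub>R F i k y"] by auto
  qed
  then show ?thesis by blast
qed

text \<open>The motion of the mean over a window is compared with a single gradient step of length
  \<open>?S n'\<close> taken from its start. \<open>h\<close>, \<theta> and \<open>K\<close> depend
  on \<epsilon> and the sample path, not on the process, because an auxiliary process is started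
  after \<open>K\<close> has been fixed.\<close>

lemma window:
  assumes \<epsilon>: "\<epsilon> > 0"
  obtains h \<theta> K where "h > 0" "\<theta> > 0"
    and "\<And>s x n. process s x \<Longrightarrow> n \<ge> K \<Longrightarrow> n \<ge> s \<Longrightarrow> (\<And>k i. k \<ge> n \<Longrightarrow> norm (x i k - centre x k) \<le> \<theta>) \<Longrightarrow>
      \<exists>n'>n. (\<forall>k\<in>{n..n'}. norm (centre x k - centre x n) \<le> \<epsilon>) \<and>
        (\<epsilon> \<le> norm (centre x n - a) \<longrightarrow> norm (centre x n' - a) \<le> norm (centre x n - a) - h)"
proof -
  obtain \<kappa> where \<kappa>: "\<kappa> > 0"
    "\<And>z. \<epsilon> \<le> norm (z - a) \<Longrightarrow> \<kappa> * norm (z - a) \<le> agent_mean (\<lambda>i. G i z) \<bullet> (z - a)"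
    using drift[OF \<epsilon>] by blast
  \<comment> \<open>Budget per unit of step size: the gradient step gains
    \<open>\<kappa> / 2\<close>, the variation of \<open>G\<close> over the window costs
    \<open>\<kappa> / 16\<close> (this fixes \<phi>), and \<open>F_approx\<close> costs another
    \<open>\<kappa> / 16\<close>.\<close>
  define \<phi> where "\<phi> = \<kappa> / (16 * C)"
  have \<phi>: "\<phi> > 0" "C * \<phi> = \<kappa> / 16" using \<kappa> C_pos by (auto simp: \<phi>_def)
  have "\<exists>\<theta>>0. \<forall>y z. dist y z < \<theta> \<longrightarrow> dist (G i y) (G i z) < \<phi>" for i
    using G_cont[of i] \<phi>(1) unfolding uniformly_continuous_on_def by (metis UNIV_I dist_commute)
  then obtain th where th: "\<And>i. th i > 0" "\<And>i y z. dist y z < th i \<Longrightarrow> dist (G i y) (G i z) < \<phi>" by metis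
  define \<theta>0 where "\<theta>0 = Min (range th)"
  have \<theta>0: "\<theta>0 > 0" "\<theta>0 \<le> th i" for i using th(1) by (auto simp: \<theta>0_def)
  define C' where "C' = C * C + 1"
  have C': "C' > 0" using C_pos by (simp add: C'_def add_pos_pos)
  \<comment> \<open>\<open>2 * T * C'\<close> bounds the movement caused by \<open>F\<close> inside
    a window. The first two entries keep it below \<open>\<epsilon> / 2\<close> and
    \<open>\<theta>0 / 4\<close>; the last two are the smallness conditions of
    \<open>descent_step\<close> for a step of length up to \<open>2 * T\<close>.\<close>
  define T where "T = Min {\<epsilon> / (4 * C'), \<theta>0 / (8 * C'), \<kappa> * \<epsilon> / (2 * C\<^sup>2), \<epsilon> / \<kappa>}"
  have T: "T > 0" using \<epsilon> C' \<theta>0 \<kappa> C_pos by (simp add: T_def)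
  have "T \<le> \<epsilon> / (4 * C')" "T \<le> \<theta>0 / (8 * C')" "T \<le> \<kappa> * \<epsilon> / (2 * C\<^sup>2)" "T \<le> \<epsilon> / \<kappa>"
    by (simp_all add: T_def)
  then have T1: "2 * T * C' \<le> \<epsilon> / 2" and T2: "2 * T * C' \<le> \<theta>0 / 4" and T3: "2 * T * C\<^sup>2 \<le> \<kappa> * \<epsilon>"
    and T4: "T * \<kappa> \<le> \<epsilon>"
    using C' C_pos \<kappa> by (simp_all add: field_simps)
  \<comment> \<open>\<delta> bounds the noise of a window and, per unit of \<open>norm v\<close>,
    its averaging defect. Together they cost at most \<open>\<delta> * (C + 1)\<close>, which the
    last entry limits to \<open>T * \<kappa> / 8\<close>.\<close>
  define \<delta> where "\<delta> = Min {\<epsilon> / 2, \<theta>0 / 4, T * \<kappa> / (8 * (C + 1))}"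
  have \<delta>: "\<delta> > 0" using \<epsilon> \<theta>0 T \<kappa> C_pos by (simp add: \<delta>_def)
  have "\<delta> \<le> T * \<kappa> / (8 * (C + 1))" by (simp add: \<delta>_def)
  then have \<delta>1: "\<delta> \<le> \<epsilon> / 2" "\<delta> \<le> \<theta>0 / 4" "\<delta> * (C + 1) \<le> T * \<kappa> / 8"
    using C_pos by (simp_all add: \<delta>_def field_simps)
  obtain K1 where K1: "\<And>k i y. k \<ge> K1 \<Longrightarrow> norm (F i k y) \<le> C'" using F_bounded unfolding C'_def by blast
  have "\<forall>\<^sub>F k in sequentially. \<gamma> k < T" using step_lim T by (intro order_tendstoD(2)) auto
  then obtain K2 where K2: "\<And>k. k \<ge> K2 \<Longrightarrow> \<gamma> k < T" by (auto simp: eventually_sequentially)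
  have "\<exists>K. \<forall>k\<ge>K. \<forall>n. norm (\<Sum>j\<in>{k..<n}. \<nu> i j) < \<delta>" for i
    using noise[of i] \<delta> unfolding summable_Cauchy by blast
  then obtain K3 where K3: "\<And>k i n. k \<ge> K3 \<Longrightarrow> norm (\<Sum>j\<in>{k..<n}. \<nu> i j) < \<delta>"
    using uniform_in_agents[of "\<lambda>i k. \<forall>n. norm (\<Sum>j\<in>{k..<n}. \<nu> i j) < \<delta>"] by blast
  obtain K4 where K4: "\<And>k i n v. k \<ge> K4 \<Longrightarrow> norm (\<Sum>j\<in>{k..<n}. \<gamma> j *\<^sub>R (A i j v - v)) \<le> \<delta> * norm v"
    using uniform_in_agents[of "\<lambda>i k. \<forall>n v. norm (\<Sum>j\<in>{k..<n}. \<gamma> j *\<^sub>R (A i j v - v)) \<le> \<delta> * norm v"]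
      A_average[OF \<delta>] by blast
  have \<kappa>16: "\<kappa> / 16 > 0" using \<kappa> by simp
  obtain K5 where K5: "\<And>k i y. k \<ge> K5 \<Longrightarrow> norm (F i k y - A i k (G i y)) \<le> \<kappa> / 16"
    using uniform_in_agents[of "\<lambda>i k. \<forall>y. norm (F i k y - A i k (G i y)) \<le> \<kappa> / 16"] F_approx[OF \<kappa>16] by blast
  define K where "K = Max {K1, K2, K3, K4, K5}"
  have K: "K1 \<le> K" "K2 \<le> K" "K3 \<le> K" "K4 \<le> K" "K5 \<le> K" by (simp_all add: K_def)
  show thesis
  proof (rule that[of "T * \<kappa> / 4" "\<theta>0 / 4" K])
    fix s x n
    assume pr: "process s x" and nK: "n \<ge> K" and ns: "n \<ge> s"
      and dev: "\<And>k i. k \<ge> n \<Longrightarrow> norm (x i k - centre x k) \<le> \<theta>0 / 4"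
    let ?p = "\<lambda>i k. \<nu> i k - \<gamma> k *\<^sub>R F i k (x i k)"
    let ?z = "centre x" and ?S = "\<lambda>m. \<Sum>k\<in>{n..<m}. \<gamma> k"
    obtain n' where n': "n' > n" "T \<le> ?S n'" "?S n' \<le> 2 * T"
      by (rule window_sum[OF _ step_sum T, of n]) (use step_pos K2 nK K in \<open>auto simp: less_imp_le\<close>)
    have S: "?S m \<le> 2 * T" if "m \<le> n'" for m
    proof -
      have "?S m \<le> ?S n'" by (rule sum_mono2) (use that step_pos in \<open>auto simp: less_imp_le\<close>)
      then show ?thesis using n' by simp
    qed
    have z: "?z m = ?z n + agent_mean (\<lambda>i. \<Sum>k\<in>{n..<m}. ?p i k)" if "m \<ge> n" for m
      by (rule agent_mean_averaging_process_sum[OF pr stochastic ns that])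
    have crude: "norm (?z m - ?z n) \<le> 2 * T * C' + \<delta>" if m: "m \<in> {n..n'}" for m
    proof -
      have "norm (\<Sum>k\<in>{n..<m}. ?p i k) \<le> 2 * T * C' + \<delta>" for i
      proof -
        have "norm (\<Sum>k\<in>{n..<m}. \<gamma> k *\<^sub>R F i k (x i k)) \<le> (\<Sum>k\<in>{n..<m}. \<gamma> k * C')"
          by (rule sum_norm_le) (use K1 K nK step_pos in \<open>auto simp: less_imp_le intro!: mult_left_mono\<close>)
        also have "\<dots> \<le> 2 * T * C'" using S[of m] m C' by (simp add: sum_distrib_right[symmetric])
        finally have "norm (\<Sum>k\<in>{n..<m}. \<gamma> k *\<^sub>R F i k (x i k)) \<le> 2 * T * C'" .
        then show ?thesis
          using K3[of n i m] K nK norm_triangle_ineq4[of "\<Sum>k\<in>{n..<m}. \<nu> i k" "\<Sum>k\<in>{n..<m}. \<gamma> k *\<^sub>R F i k (x i k)"]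
          by (simp add: sum_subtractf)
      qed
      then have "norm (agent_mean (\<lambda>i. \<Sum>k\<in>{n..<m}. ?p i k)) \<le> 2 * T * C' + \<delta>" by (rule norm_agent_mean_le)
      then show ?thesis using z[of m] m by simp
    qed
    have "norm (?z n' - a) \<le> norm (?z n - a) - T * \<kappa> / 4" if far: "\<epsilon> \<le> norm (?z n - a)"
    proof -
      \<comment> \<open>The gradients are frozen at the mean at the start of the window. They depend
        on the whole past, but are constant over the window, and \<open>K4\<close> was obtained for
        all vectors at once.\<close>
      define g where "g i = G i (?z n)" for i
      have err: "norm ((\<Sum>k\<in>{n..<n'}. ?p i k) + ?S n' *\<^sub>R g i) \<le> \<delta> * (C + 1) + ?S n' * (\<kappa> / 8)" for i
      proof -
        have "norm (F i k (x i k) - A i k (g i)) \<le> \<kappa> / 8" if k: "k \<in> {n..<n'}" for k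
        proof -
          have "norm (x i k - ?z n) \<le> norm (x i k - ?z k) + norm (?z k - ?z n)"
            using norm_triangle_ineq[of "x i k - ?z k" "?z k - ?z n"] by simp
          also have "\<dots> \<le> \<theta>0 / 4 + (2 * T * C' + \<delta>)" using dev[of k i] crude[of k] k by auto
          also have "\<dots> < \<theta>0" using T2 \<delta>1 \<theta>0(1) by linarith
          finally have "dist (x i k) (?z n) < th i" using \<theta>0(2)[of i] by (simp add: dist_norm)
          then have "norm (G i (x i k) - g i) \<le> \<phi>" using th(2) by (force simp: g_def dist_norm)
          then have "norm (A i k (G i (x i k) - g i)) \<le> \<kappa> / 16"
            using A_bound[of i k "G i (x i k) - g i"] \<phi>(2) C_pos by (metis less_imp_le mult_left_mono order_trans)
          moreover have "norm (F i k (x i k) - A i k (G i (x i k))) \<le> \<kappa> / 16" using K5 k K nK by auto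
          ultimately show ?thesis
            using norm_triangle_ineq[of "F i k (x i k) - A i k (G i (x i k))" "A i k (G i (x i k) - g i)"]
            by (simp add: linear_diff[OF A_linear])
        qed
        then have r: "norm (\<Sum>k\<in>{n..<n'}. \<gamma> k *\<^sub>R (F i k (x i k) - A i k (g i))) \<le> ?S n' * (\<kappa> / 8)"
          unfolding sum_distrib_right
          by (intro sum_norm_le) (use step_pos in \<open>auto simp: less_imp_le intro!: mult_left_mono\<close>)
        have q: "norm (\<Sum>k\<in>{n..<n'}. \<gamma> k *\<^sub>R (A i k (g i) - g i)) \<le> \<delta> * C"
        proof (rule order_trans[OF K4 mult_left_mono])
          show "norm (g i) \<le> C" by (simp add: g_def G_bound)
        qed (use K nK \<delta> in auto)
        have w: "norm (\<Sum>k\<in>{n..<n'}. \<nu> i k) \<le> \<delta>" using K3[of n i n'] K nK by simp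
        have "(\<Sum>k\<in>{n..<n'}. ?p i k) + ?S n' *\<^sub>R g i = (\<Sum>k\<in>{n..<n'}. \<nu> i k)
            - (\<Sum>k\<in>{n..<n'}. \<gamma> k *\<^sub>R (A i k (g i) - g i)) - (\<Sum>k\<in>{n..<n'}. \<gamma> k *\<^sub>R (F i k (x i k) - A i k (g i)))"
          by (simp add: scaleR_sum_left sum_subtractf scaleR_right_diff_distrib)
        then have "norm ((\<Sum>k\<in>{n..<n'}. ?p i k) + ?S n' *\<^sub>R g i) \<le> \<delta> + \<delta> * C + ?S n' * (\<kappa> / 8)"
          using r q w by (auto intro!: order_trans[OF norm_triangle_ineq4] add_mono)
        then show ?thesis by (simp add: algebra_simps)
      qed
      have "norm (agent_mean (\<lambda>i. (\<Sum>k\<in>{n..<n'}. ?p i k) + ?S n' *\<^sub>R g i)) \<le> \<delta> * (C + 1) + ?S n' * (\<kappa> / 8)"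
        by (rule norm_agent_mean_le) (rule err)
      then have e: "norm (?z n' - ?z n + ?S n' *\<^sub>R agent_mean g) \<le> \<delta> * (C + 1) + ?S n' * (\<kappa> / 8)"
        using z[of n'] n' by (simp add: agent_mean_add agent_mean_scaleR)
      have "norm (?z n - a - ?S n' *\<^sub>R agent_mean g) \<le> norm (?z n - a) - ?S n' * \<kappa> / 2"
      proof (rule descent_step[OF far \<epsilon> \<kappa>(1)])
        show "0 \<le> ?S n'" using n' T by simp
        show "norm (agent_mean g) \<le> C" by (rule norm_agent_mean_le) (simp add: g_def G_bound)
        show "\<kappa> * norm (?z n - a) \<le> agent_mean g \<bullet> (?z n - a)" using \<kappa>(2)[OF far] by (simp add: g_def[abs_def])
        have "?S n' * C\<^sup>2 \<le> 2 * T * C\<^sup>2" by (rule mult_right_mono[OF n'(3)]) simp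
        then show "?S n' * C\<^sup>2 \<le> \<kappa> * \<epsilon>" using T3 by linarith
        have "?S n' * \<kappa> \<le> 2 * T * \<kappa>" by (rule mult_right_mono[OF n'(3)]) (use \<kappa> in simp)
        then show "?S n' * \<kappa> \<le> 2 * \<epsilon>" using T4 by linarith
      qed
      moreover have "norm (?z n' - a) \<le> norm (?z n - a - ?S n' *\<^sub>R agent_mean g) + norm (?z n' - ?z n + ?S n' *\<^sub>R agent_mean g)"
        using norm_triangle_ineq[of "?z n - a - ?S n' *\<^sub>R agent_mean g" "?z n' - ?z n + ?S n' *\<^sub>R agent_mean g"] by simp
      \<comment> \<open>With \<open>S\<close> for the length of the window, the balance
        \<open>S * \<kappa> / 2 - S * \<kappa> / 8 - T * \<kappa> / 8\<close> is at least
        \<open>T * \<kappa> / 4\<close> because \<open>S \<ge> T\<close>.\<close>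
      moreover have "T * \<kappa> \<le> ?S n' * \<kappa>" by (rule mult_right_mono[OF n'(2)]) (use \<kappa> in simp)
      ultimately show ?thesis using e \<delta>1(3) by (simp add: field_simps)
    qed
    moreover have "norm (?z k - ?z n) \<le> \<epsilon>" if "k \<in> {n..n'}" for k
      using crude[OF that] T1 \<delta>1 by linarith
    ultimately show "\<exists>n'>n. (\<forall>k\<in>{n..n'}. norm (?z k - ?z n) \<le> \<epsilon>) \<and>
        (\<epsilon> \<le> norm (?z n - a) \<longrightarrow> norm (?z n' - a) \<le> norm (?z n - a) - T * \<kappa> / 4)"
      using n'(1) by blast
  qed (use T \<kappa> \<theta>0 in auto)
qed

lemma norm_dist_window:
  fixes z :: "nat \<Rightarrow> 'b"
  assumes "\<exists>n'>n. (\<forall>k\<in>{n..n'}. norm (z k - z n) \<le> \<epsilon>) \<and>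
        (\<epsilon> \<le> norm (z n - a) \<longrightarrow> norm (z n' - a) \<le> norm (z n - a) - h)"
  shows "\<exists>n'>n. (\<forall>k\<in>{n..n'}. \<bar>norm (z k - a) - norm (z n - a)\<bar> \<le> \<epsilon>) \<and>
        (\<epsilon> \<le> norm (z n - a) \<longrightarrow> norm (z n' - a) \<le> norm (z n - a) - h)"
proof -
  have "\<bar>norm (z k - a) - norm (z n - a)\<bar> \<le> norm (z k - z n)" for k
    using norm_triangle_ineq3[of "z k - a" "z n - a"] by simp
  then show ?thesis using assms by (meson order_trans)
qed

text \<open>Late processes have perturbations of norm at most \<open>q / Cc\<close>, which makes the
  tolerance in the consensus bound arbitrary.\<close>

lemma process_consensus:
  assumes q: "q > 0"
  shows "\<exists>K. \<forall>s\<ge>K. \<forall>x d. process s x \<longrightarrow> (\<forall>i. norm (x i s - centre x s) \<le> d) \<longrightarrow>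
    (\<forall>k\<ge>s. \<forall>i. norm (x i k - centre x k) \<le> d + q) \<and> (\<exists>K. \<forall>k\<ge>K. \<forall>i. norm (x i k - centre x k) \<le> q)"
proof -
  from consensus_bound[OF net com, where 'b = 'b]
  obtain Cc where Cc: "Cc > 0" and con: "\<forall>\<pi> s d (x :: 'v \<Rightarrow> nat \<Rightarrow> 'b) p. averaging_process W s x p \<longrightarrow> \<pi> > 0 \<longrightarrow>
      (\<forall>i. \<forall>k\<ge>s. norm (p i k) \<le> \<pi>) \<longrightarrow> (\<forall>i. norm (x i s - centre x s) \<le> d) \<longrightarrow>
      (\<forall>k\<ge>s. \<forall>i. norm (x i k - centre x k) \<le> d + Cc * \<pi>) \<and>
      (\<exists>K. \<forall>k\<ge>K. \<forall>i. norm (x i k - centre x k) \<le> Cc * \<pi>)"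
    by (elim exE conjE)
  have \<pi>: "q / Cc > 0" "Cc * (q / Cc) = q" using q Cc by auto
  obtain K where K: "\<And>k i y. k \<ge> K \<Longrightarrow> norm (\<nu> i k - \<gamma> k *\<^sub>R F i k y) \<le> q / Cc"
    using perturbation_small[OF \<pi>(1)] by blast
  show ?thesis
  proof (intro exI[of _ K] allI impI)
    fix s d and x :: "'v \<Rightarrow> nat \<Rightarrow> 'b"
    assume s: "K \<le> s" and pr: "process s x" and dev: "\<forall>i. norm (x i s - centre x s) \<le> d"
    have "\<forall>i. \<forall>k\<ge>s. norm (\<nu> i k - \<gamma> k *\<^sub>R F i k (x i k)) \<le> q / Cc" using K s by simp
    from con[rule_format, OF pr \<pi>(1)] this dev
    show "(\<forall>k\<ge>s. \<forall>i. norm (x i k - centre x k) \<le> d + q) \<and> (\<exists>K. \<forall>k\<ge>K. \<forall>i. norm (x i k - centre x k) \<le> q)"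
      unfolding \<pi>(2) by blast
  qed
qed

text \<open>The start is arbitrary: \<open>G\<close> is bounded and the drift holds everywhere, so
  the mean reaches every neighbourhood of \<open>a\<close> and is then kept close by the
  windows.\<close>

lemma process_converges:
  assumes pr: "process s x"
  shows "(\<lambda>k. x i k) \<longlonglongrightarrow> a"
  unfolding LIMSEQ_iff
proof (intro allI impI)
  fix e :: real assume e: "e > 0"
  obtain h \<theta> K where h: "h > 0" and \<theta>: "\<theta> > 0"
    and win: "\<And>s x n. process s x \<Longrightarrow> n \<ge> K \<Longrightarrow> n \<ge> s \<Longrightarrow> (\<And>k i. k \<ge> n \<Longrightarrow> norm (x i k - centre x k) \<le> \<theta>) \<Longrightarrow>
      \<exists>n'>n. (\<forall>k\<in>{n..n'}. norm (centre x k - centre x n) \<le> e / 8) \<and>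
        (e / 8 \<le> norm (centre x n - a) \<longrightarrow> norm (centre x n' - a) \<le> norm (centre x n - a) - h)"
    by (rule window[of "e / 8"]) (use e in auto)
  define q where "q = min \<theta> (e / 4)"
  have q: "q > 0" "q \<le> \<theta>" "q \<le> e / 4" using \<theta> e by (auto simp: q_def)
  obtain K1 where K1: "\<forall>s\<ge>K1. \<forall>x d. process s x \<longrightarrow> (\<forall>i. norm (x i s - centre x s) \<le> d) \<longrightarrow>
      (\<forall>k\<ge>s. \<forall>i. norm (x i k - centre x k) \<le> d + q) \<and> (\<exists>K. \<forall>k\<ge>K. \<forall>i. norm (x i k - centre x k) \<le> q)"
    using process_consensus[OF q(1)] by (elim exE)
  \<comment> \<open>Consensus estimates apply from \<open>K1\<close> on. The disagreement at that
    time is just some finite number, which is forgotten eventually.\<close>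
  define s1 where "s1 = max s K1"
  define d where "d = Max (range (\<lambda>i. norm (x i s1 - centre x s1)))"
  have "\<forall>i. norm (x i s1 - centre x s1) \<le> d" by (simp add: d_def)
  then have "\<exists>K. \<forall>k\<ge>K. \<forall>i. norm (x i k - centre x k) \<le> q"
    using K1[rule_format, of s1 x d] averaging_process_mono[OF pr, of s1] by (simp add: s1_def)
  then obtain K2 where K2: "\<And>k i. k \<ge> K2 \<Longrightarrow> norm (x i k - centre x k) \<le> q" by blast
  define K3 where "K3 = max (max K K2) s1"
  have w: "\<exists>n'>n. (\<forall>k\<in>{n..n'}. \<bar>norm (centre x k - a) - norm (centre x n - a)\<bar> \<le> e / 8) \<and>
        (e / 8 \<le> norm (centre x n - a) \<longrightarrow> norm (centre x n' - a) \<le> norm (centre x n - a) - h)"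
    if "n \<ge> K3" for n
  proof (intro norm_dist_window win[OF pr])
    show "norm (x i k - centre x k) \<le> \<theta>" if "k \<ge> n" for k i
      using K2[of k i] q that \<open>n \<ge> K3\<close> by (auto simp: K3_def)
  qed (use that in \<open>auto simp: K3_def s1_def\<close>)
  obtain n where n: "n \<ge> K3" "norm (centre x n - a) < e / 8"
    using windows_descend(2)[of "\<lambda>k. norm (centre x k - a)", OF _ h w, of K3] by auto
  have "norm (centre x k - a) \<le> 2 * (e / 8) + e / 8" if "k \<ge> n" for k
    by (rule windows_descend(1)[of "\<lambda>k. norm (centre x k - a)", OF _ h w n(1)]) (use n that e in auto)
  then have "norm (x i k - a) < e" if "k \<ge> n" for k
    using K2[of k i] q(3) n(1) that norm_triangle_ineq[of "x i k - centre x k" "centre x k - a"] e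
    by (force simp: K3_def)
  then show "\<exists>no. \<forall>n\<ge>no. norm (x i n - a) < e" by blast
qed

text \<open>In contrast to convergence this is uniform, as \<theta> and \<open>K\<close> precede the
  process; it is meant for a recursion started at a random time near \<open>xstar\<close>. All
  agents must start near a common \<open>y\<close>, because the windows have to begin at
  \<open>s\<close> itself and require consensus from there on.\<close>

lemma process_stable:
  assumes e: "e > 0"
  obtains \<theta> K where "\<theta> > 0"
    and "\<And>s x y k i. process s x \<Longrightarrow> s \<ge> K \<Longrightarrow> (\<And>i. norm (x i s - y) \<le> \<theta>) \<Longrightarrow> k \<ge> s \<Longrightarrow> norm (x i k - a) \<le> norm (y - a) + e"
proof -
  obtain h \<theta> K where h: "h > 0" and \<theta>: "\<theta> > 0"
    and win: "\<And>s x n. process s x \<Longrightarrow> n \<ge> K \<Longrightarrow> n \<ge> s \<Longrightarrow> (\<And>k i. k \<ge> n \<Longrightarrow> norm (x i k - centre x k) \<le> \<theta>) \<Longrightarrow>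
      \<exists>n'>n. (\<forall>k\<in>{n..n'}. norm (centre x k - centre x n) \<le> e / 8) \<and>
        (e / 8 \<le> norm (centre x n - a) \<longrightarrow> norm (centre x n' - a) \<le> norm (centre x n - a) - h)"
    by (rule window[of "e / 8"]) (use e in auto)
  define q where "q = min \<theta> (e / 4)"
  have q: "q > 0" "q \<le> \<theta>" "q \<le> e / 4" using \<theta> e by (auto simp: q_def)
  obtain K1 where K1: "\<forall>s\<ge>K1. \<forall>x d. process s x \<longrightarrow> (\<forall>i. norm (x i s - centre x s) \<le> d) \<longrightarrow>
      (\<forall>k\<ge>s. \<forall>i. norm (x i k - centre x k) \<le> d + q / 2) \<and> (\<exists>K. \<forall>k\<ge>K. \<forall>i. norm (x i k - centre x k) \<le> q / 2)"
    using process_consensus[of "q / 2"] q(1) by auto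
  show thesis
  \<comment> \<open>Starting within \<open>q / 4\<close> of \<open>y\<close> gives an initial
    disagreement of at most \<open>q / 2\<close>, and consensus lets it grow by another
    \<open>q / 2\<close>.\<close>
  proof (rule that[of "q / 4" "max K K1"])
    fix s x y k i
    assume pr: "process s x" and s: "s \<ge> max K K1" and init: "\<And>i. norm (x i s - y) \<le> q / 4" and k: "k \<ge> s"
    have c0: "norm (centre x s - y) \<le> q / 4"
      using norm_agent_mean_le[of "\<lambda>i. x i s - y", OF init] by (simp add: agent_mean_diff)
    have "norm (x i s - centre x s) \<le> q / 2" for i
      using init[of i] c0 norm_triangle_ineq4[of "x i s - y" "centre x s - y"] by simp
    then have dev: "norm (x i k - centre x k) \<le> q" if "k \<ge> s" for k i
      using K1[rule_format, of s x "q / 2"] pr s that by simp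
    have w: "\<exists>n'>n. (\<forall>k\<in>{n..n'}. \<bar>norm (centre x k - a) - norm (centre x n - a)\<bar> \<le> e / 8) \<and>
        (e / 8 \<le> norm (centre x n - a) \<longrightarrow> norm (centre x n' - a) \<le> norm (centre x n - a) - h)"
      if "n \<ge> s" for n
    proof (intro norm_dist_window win[OF pr])
      show "norm (x i k - centre x k) \<le> \<theta>" if "k \<ge> n" for k i
        using dev[of k i] q that \<open>n \<ge> s\<close> by auto
    qed (use that s in auto)
    have "norm (centre x k - a) \<le> (norm (y - a) + q / 4 + 2 * (e / 8)) + e / 8"
    proof (rule windows_descend(1)[of "\<lambda>k. norm (centre x k - a)", OF _ h w order_refl _ _ k])
      show "norm (centre x s - a) \<le> norm (y - a) + q / 4 + 2 * (e / 8)"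
        using c0 e norm_triangle_ineq[of "centre x s - y" "y - a"] by simp
    qed (use q in auto)
    moreover have "norm (x i k - a) \<le> norm (x i k - centre x k) + norm (centre x k - a)"
      using norm_triangle_ineq[of "x i k - centre x k" "centre x k - a"] by simp
    ultimately show "norm (x i k - a) \<le> norm (y - a) + e"
      using dev[OF k, of i] q by linarith
  qed (use q in simp)
qed

end

section \<open>Almost sure convergence of random series\<close>

text \<open>Partial sums frozen as soon as their modulus reaches \<open>c\<close>. This encodes a
  stopping time: a crossing at any time up to \<open>n\<close> is still visible in the value at time
  \<open>n\<close>.\<close>

fun stopped_sum :: "real \<Rightarrow> (nat \<Rightarrow> real) \<Rightarrow> nat \<Rightarrow> real" where
  "stopped_sum c f 0 = 0"
| "stopped_sum c f (Suc n) = stopped_sum c f n + (if \<bar>stopped_sum c f n\<bar> < c then f n else 0)"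

lemma stopped_sum_cases:
  "(\<forall>j\<le>n. \<bar>sum f {..<j}\<bar> < c) \<and> stopped_sum c f n = sum f {..<n} \<or> c \<le> \<bar>stopped_sum c f n\<bar>"
proof (induction n)
  case (Suc n)
  then show ?case by (auto simp: le_Suc_eq)
qed auto

lemma stopped_sum_cong:
  "(\<And>j. j < n \<Longrightarrow> f j = g j) \<Longrightarrow> stopped_sum c f n = stopped_sum c g n"
  by (induction n) auto

lemma abs_stopped_sum_le: "\<bar>stopped_sum c f n\<bar> \<le> (\<Sum>j<n. \<bar>f j\<bar>)"
  by (induction n) (auto simp: abs_if)

lemma measurable_stopped_sum:
  "n \<le> m \<Longrightarrow> (\<lambda>f. stopped_sum c f n) \<in> borel_measurable (Pi\<^sub>M {..<m} (\<lambda>_. borel))"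
proof (induction n)
  case (Suc n)
  have [measurable]: "(\<lambda>f. f n) \<in> borel_measurable (Pi\<^sub>M {..<m} (\<lambda>_. borel :: real measure))"
    by (rule measurable_component_singleton) (use Suc.prems in auto)
  have [measurable]: "(\<lambda>f. stopped_sum c f n) \<in> borel_measurable (Pi\<^sub>M {..<m} (\<lambda>_. borel))"
    using Suc by auto
  show ?case by simp
qed simp

lemma abs_power2_le: "\<bar>x :: real\<bar> \<le> B \<Longrightarrow> \<bar>x\<^sup>2\<bar> \<le> B\<^sup>2"
  using power_mono[of "\<bar>x\<bar>" B 2] by simp

context prob_space
begin

lemma integrable_AE_bounded:
  fixes f :: "'a \<Rightarrow> real"
  assumes "f \<in> borel_measurable M" "AE \<omega> in M. \<bar>f \<omega>\<bar> \<le> B"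
  shows "integrable M f"
  using integrable_const_bound[of f B] assms by simp

text \<open>Whether the next summand is added is decided by the earlier ones. The increment is
  therefore orthogonal to the current value, and only the squares of the increments
  accumulate.\<close>

lemma stopped_sum_second_moment:
  fixes X :: "nat \<Rightarrow> 'a \<Rightarrow> real"
  assumes ind: "indep_vars (\<lambda>_. borel) X UNIV"
    and bd: "\<And>k. AE \<omega> in M. \<bar>X k \<omega>\<bar> \<le> B k"
    and mean: "\<And>k. expectation (X k) = 0"
  shows "expectation (\<lambda>\<omega>. (stopped_sum c (\<lambda>k. X k \<omega>) n)\<^sup>2) \<le> (\<Sum>k<n. (B k)\<^sup>2)"
proof (induction n)
  case (Suc n)
  let ?U = "\<lambda>n \<omega>. stopped_sum c (\<lambda>k. X k \<omega>) n"
  have X [measurable]: "X k \<in> borel_measurable M" for k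
    using ind by (auto simp: indep_vars_def)
  have U [measurable]: "?U n \<in> borel_measurable M" for n
    by (induction n) auto
  have bdall: "AE \<omega> in M. \<forall>k. \<bar>X k \<omega>\<bar> \<le> B k"
    unfolding AE_all_countable using bd by blast
  have Ubd: "AE \<omega> in M. \<bar>?U n \<omega>\<bar> \<le> (\<Sum>j<n. B j)" for n
    using bdall
  proof eventually_elim
    case (elim \<omega>)
    have "(\<Sum>j<n. \<bar>X j \<omega>\<bar>) \<le> (\<Sum>j<n. B j)" by (rule sum_mono) (use elim in auto)
    then show ?case using abs_stopped_sum_le[of c "\<lambda>k. X k \<omega>" n] by linarith
  qed
  define D where "D \<omega> = (of_bool (\<bar>?U n \<omega>\<bar> < c) :: real)" for \<omega>
  have [measurable]: "D \<in> borel_measurable M" unfolding D_def by measurable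
  have split: "(?U (Suc n) \<omega>)\<^sup>2 = (?U n \<omega>)\<^sup>2 + 2 * (?U n \<omega> * D \<omega> * X n \<omega>) + (D \<omega> * X n \<omega>)\<^sup>2" for \<omega>
    by (simp add: D_def power2_eq_square algebra_simps)
  \<comment> \<open>Value and freezing decision are functions of the variables with index below
    \<open>n\<close>, hence independent of \<open>X n\<close>.\<close>
  have indXU: "indep_var borel (\<lambda>\<omega>. ?U n \<omega> * D \<omega>) borel (X n)"
  proof -
    let ?Y = "\<lambda>f. stopped_sum c f n * of_bool (\<bar>stopped_sum c f n\<bar> < c)"
    have "indep_var borel (?Y \<circ> (\<lambda>\<omega>. restrict (\<lambda>i. X i \<omega>) {..<n}))
        borel ((\<lambda>f. f n) \<circ> (\<lambda>\<omega>. restrict (\<lambda>i. X i \<omega>) {n}))"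
    proof (rule indep_var_compose)
      show "indep_var (PiM {..<n} (\<lambda>_. borel)) (\<lambda>\<omega>. restrict (\<lambda>i. X i \<omega>) {..<n})
          (PiM {n} (\<lambda>_. borel)) (\<lambda>\<omega>. restrict (\<lambda>i. X i \<omega>) {n})"
        by (rule indep_var_restrict[OF ind]) auto
      have [measurable]: "(\<lambda>f. stopped_sum c f n) \<in> borel_measurable (Pi\<^sub>M {..<n} (\<lambda>_. borel))"
        by (rule measurable_stopped_sum) simp
      show "?Y \<in> borel_measurable (Pi\<^sub>M {..<n} (\<lambda>_. borel))"
        by measurable
    qed simp
    moreover have "stopped_sum c (restrict (\<lambda>i. X i \<omega>) {..<n}) n = ?U n \<omega>" for \<omega>
      by (rule stopped_sum_cong) simp
    ultimately show ?thesis by (simp add: comp_def D_def)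
  qed
  have i1: "integrable M (\<lambda>\<omega>. (?U n \<omega>)\<^sup>2)"
  proof (rule integrable_AE_bounded[where B="(\<Sum>j<n. B j)\<^sup>2"])
    show "AE \<omega> in M. \<bar>(?U n \<omega>)\<^sup>2\<bar> \<le> (\<Sum>j<n. B j)\<^sup>2"
      using Ubd[of n] by eventually_elim (rule abs_power2_le)
  qed measurable
  have i2: "integrable M (\<lambda>\<omega>. ?U n \<omega> * D \<omega>)"
  proof (rule integrable_AE_bounded[where B="\<Sum>j<n. B j"])
    show "AE \<omega> in M. \<bar>?U n \<omega> * D \<omega>\<bar> \<le> (\<Sum>j<n. B j)"
      using Ubd[of n] by eventually_elim (auto simp: D_def)
  qed measurable
  have i3: "integrable M (X n)"
    by (rule integrable_AE_bounded[where B="B n"]) (use bd in auto)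
  have bd2: "AE \<omega> in M. \<bar>(D \<omega> * X n \<omega>)\<^sup>2\<bar> \<le> (B n)\<^sup>2"
    using bd[of n]
  proof eventually_elim
    case (elim \<omega>)
    then show ?case by (intro abs_power2_le) (auto simp: D_def)
  qed
  have i4: "integrable M (\<lambda>\<omega>. (D \<omega> * X n \<omega>)\<^sup>2)"
    by (rule integrable_AE_bounded[OF _ bd2]) measurable
  have cross: "expectation (\<lambda>\<omega>. ?U n \<omega> * D \<omega> * X n \<omega>) = 0"
    using indep_var_lebesgue_integral[OF indXU i2 i3] mean by simp
  have i5: "integrable M (\<lambda>\<omega>. ?U n \<omega> * D \<omega> * X n \<omega>)"
    by (rule indep_var_integrable[OF indXU i2 i3])
  have "expectation (\<lambda>\<omega>. (?U (Suc n) \<omega>)\<^sup>2)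
      = expectation (\<lambda>\<omega>. (?U n \<omega>)\<^sup>2) + 2 * expectation (\<lambda>\<omega>. ?U n \<omega> * D \<omega> * X n \<omega>)
        + expectation (\<lambda>\<omega>. (D \<omega> * X n \<omega>)\<^sup>2)"
    unfolding split using i1 i4 i5 by simp
  also have "expectation (\<lambda>\<omega>. (D \<omega> * X n \<omega>)\<^sup>2) \<le> expectation (\<lambda>_. (B n)\<^sup>2)"
    by (rule integral_mono_AE[OF i4]) (use bd2 in auto)
  finally show ?case using Suc cross by (simp add: prob_space)
qed simp

text \<open>The event is contained in the one that the stopped sum is large at the single time
  \<open>n\<close>, to which Chebyshev's inequality applies.\<close>

lemma kolmogorov_maximal:
  fixes X :: "nat \<Rightarrow> 'a \<Rightarrow> real"
  assumes ind: "indep_vars (\<lambda>_. borel) X UNIV"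
    and bd: "\<And>k. AE \<omega> in M. \<bar>X k \<omega>\<bar> \<le> B k"
    and mean: "\<And>k. expectation (X k) = 0"
    and c: "c > 0"
  shows "prob {\<omega>\<in>space M. \<exists>j\<le>n. c \<le> \<bar>\<Sum>k<j. X k \<omega>\<bar>} \<le> (\<Sum>k<n. (B k)\<^sup>2) / c\<^sup>2"
proof -
  let ?U = "\<lambda>\<omega>. stopped_sum c (\<lambda>k. X k \<omega>) n"
  have X [measurable]: "X k \<in> borel_measurable M" for k
    using ind by (auto simp: indep_vars_def)
  have U [measurable]: "(\<lambda>\<omega>. stopped_sum c (\<lambda>k. X k \<omega>) n) \<in> borel_measurable M" for n
    by (induction n) auto
  have int: "integrable M (\<lambda>\<omega>. (?U \<omega>)\<^sup>2)"
  proof (rule integrable_AE_bounded[where B="(\<Sum>j<n. B j)\<^sup>2"])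
    have "AE \<omega> in M. \<forall>k. \<bar>X k \<omega>\<bar> \<le> B k"
      unfolding AE_all_countable using bd by blast
    then show "AE \<omega> in M. \<bar>(?U \<omega>)\<^sup>2\<bar> \<le> (\<Sum>j<n. B j)\<^sup>2"
    proof eventually_elim
      case (elim \<omega>)
      have "(\<Sum>j<n. \<bar>X j \<omega>\<bar>) \<le> (\<Sum>j<n. B j)" by (rule sum_mono) (use elim in auto)
      then have "\<bar>?U \<omega>\<bar> \<le> (\<Sum>j<n. B j)"
        using abs_stopped_sum_le[of c "\<lambda>k. X k \<omega>" n] by linarith
      then show ?case by (rule abs_power2_le)
    qed
  qed measurable
  have "{\<omega>\<in>space M. \<exists>j\<le>n. c \<le> \<bar>\<Sum>k<j. X k \<omega>\<bar>} \<subseteq> {\<omega>\<in>space M. c\<^sup>2 \<le> (?U \<omega>)\<^sup>2}"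
  proof safe
    fix \<omega> j assume "j \<le> n" "c \<le> \<bar>\<Sum>k<j. X k \<omega>\<bar>"
    then have "c \<le> \<bar>?U \<omega>\<bar>"
      using stopped_sum_cases[of n "\<lambda>k. X k \<omega>" c] by force
    then show "c\<^sup>2 \<le> (?U \<omega>)\<^sup>2"
      using c power_mono[of c "\<bar>?U \<omega>\<bar>" 2] by simp
  qed
  then have "prob {\<omega>\<in>space M. \<exists>j\<le>n. c \<le> \<bar>\<Sum>k<j. X k \<omega>\<bar>} \<le> prob {\<omega>\<in>space M. c\<^sup>2 \<le> (?U \<omega>)\<^sup>2}"
    by (rule finite_measure_mono) measurable
  also have "\<dots> \<le> expectation (\<lambda>\<omega>. (?U \<omega>)\<^sup>2) / c\<^sup>2"
    by (rule integral_Markov_inequality_measure[where A="{}", OF int]) (use c in auto)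
  also have "\<dots> \<le> (\<Sum>k<n. (B k)\<^sup>2) / c\<^sup>2"
    by (rule divide_right_mono[OF stopped_sum_second_moment[OF ind bd mean]]) simp
  finally show ?thesis .
qed

lemma indep_vars_shift:
  fixes X :: "nat \<Rightarrow> 'a \<Rightarrow> 'c"
  assumes "indep_vars (\<lambda>_. N) X UNIV"
  shows "indep_vars (\<lambda>_. N) (\<lambda>k. X (k + m)) UNIV"
proof -
  have "indep_vars (\<lambda>j. Pi\<^sub>M {j + m} (\<lambda>_. N)) (\<lambda>j \<omega>. restrict (\<lambda>i. X i \<omega>) {j + m}) UNIV"
    by (rule indep_vars_restrict[OF assms]) (auto simp: disjoint_family_on_def)
  then have "indep_vars (\<lambda>_. N) (\<lambda>j \<omega>. restrict (\<lambda>i. X i \<omega>) {j + m} (j + m)) UNIV"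
    by (rule indep_vars_compose2) auto
  then show ?thesis by simp
qed

text \<open>The maximal inequality for sums starting at \<open>m\<close> bounds the probability of
  an excursion of size \<open>c\<close> by a tail of the series of \<open>(B k)\<^sup>2\<close>,
  uniformly in the horizon. So almost surely some \<open>m\<close> has no excursion; doing this for
  all \<open>c = 1 / (i + 1)\<close> gives the Cauchy property.\<close>

lemma kolmogorov_convergence:
  fixes X :: "nat \<Rightarrow> 'a \<Rightarrow> real"
  assumes ind: "indep_vars (\<lambda>_. borel) X UNIV"
    and bd: "\<And>k. AE \<omega> in M. \<bar>X k \<omega>\<bar> \<le> B k"
    and mean: "\<And>k. expectation (X k) = 0"
    and sB: "summable (\<lambda>k. (B k)\<^sup>2)"
  shows "AE \<omega> in M. summable (\<lambda>k. X k \<omega>)"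
proof -
  have X [measurable]: "X k \<in> borel_measurable M" for k
    using ind by (auto simp: indep_vars_def)
  have tail: "AE \<omega> in M. \<exists>m. \<forall>n. \<bar>\<Sum>k<n. X (k + m) \<omega>\<bar> < c" if c: "c > 0" for c
  proof -
    define A where "A m n = {\<omega>\<in>space M. \<exists>j\<le>n. c \<le> \<bar>\<Sum>k<j. X (k + m) \<omega>\<bar>}" for m n
    define A' where "A' m = {\<omega>\<in>space M. \<exists>j. c \<le> \<bar>\<Sum>k<j. X (k + m) \<omega>\<bar>}" for m
    have [measurable]: "A m n \<in> events" "A' m \<in> events" for m n unfolding A_def A'_def by (measurable, measurable)
    have A: "prob (A m n) \<le> (\<Sum>k. (B (k + m))\<^sup>2) / c\<^sup>2" for m n
    proof -
      have sm: "summable (\<lambda>k. (B (k + m))\<^sup>2)" by (rule summable_ignore_initial_segment[OF sB])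
      have "indep_vars (\<lambda>_. borel) (\<lambda>k. X (k + m)) UNIV" by (rule indep_vars_shift[OF ind])
      then have "prob (A m n) \<le> (\<Sum>k<n. (B (k + m))\<^sup>2) / c\<^sup>2"
        unfolding A_def by (rule kolmogorov_maximal) (use bd mean c in auto)
      also have "\<dots> \<le> (\<Sum>k. (B (k + m))\<^sup>2) / c\<^sup>2"
        by (intro divide_right_mono sum_le_suminf sm) auto
      finally show ?thesis .
    qed
    have A': "prob (A' m) \<le> (\<Sum>k. (B (k + m))\<^sup>2) / c\<^sup>2" for m
    proof -
      have "(\<lambda>n. prob (A m n)) \<longlonglongrightarrow> prob (\<Union>n. A m n)"
        by (rule finite_Lim_measure_incseq) (auto simp: incseq_def A_def intro: le_trans)
      moreover have "(\<Union>n. A m n) = A' m" by (auto simp: A_def A'_def)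
      ultimately show ?thesis using A by (intro LIMSEQ_le_const2[of "\<lambda>n. prob (A m n)"]) auto
    qed
    have lim: "(\<lambda>m. (\<Sum>k. (B (k + m))\<^sup>2) / c\<^sup>2) \<longlonglongrightarrow> 0 / c\<^sup>2"
      by (intro tendsto_divide suminf_exist_split2[OF sB] tendsto_const) (use c in auto)
    have "prob (\<Inter>m. A' m) \<le> (\<Sum>k. (B (k + m))\<^sup>2) / c\<^sup>2" for m
      by (rule order_trans[OF finite_measure_mono A'[of m]]) auto
    then have "prob (\<Inter>m. A' m) \<le> 0"
      using LIMSEQ_le_const[OF lim] by auto
    then have "prob (\<Inter>m. A' m) = 0" using measure_le_0_iff by blast
    then have "(\<Inter>m. A' m) \<in> null_sets M"
      by (intro null_setsI) (auto simp: emeasure_eq_measure)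
    then have "AE \<omega> in M. \<omega> \<notin> (\<Inter>m. A' m)" by (rule AE_not_in)
    then show ?thesis
    proof (rule AE_mp, intro AE_I2 impI)
      fix \<omega> assume "\<omega> \<in> space M" "\<omega> \<notin> (\<Inter>m. A' m)"
      then show "\<exists>m. \<forall>n. \<bar>\<Sum>k<n. X (k + m) \<omega>\<bar> < c"
        by (auto simp: A'_def not_le)
    qed
  qed
  have "AE \<omega> in M. \<forall>i::nat. \<exists>m. \<forall>n. \<bar>\<Sum>k<n. X (k + m) \<omega>\<bar> < inverse (real (Suc i))"
    unfolding AE_all_countable by (intro allI tail) auto
  then show ?thesis
  proof eventually_elim
    case (elim \<omega>)
    show ?case unfolding summable_Cauchy
    proof (intro allI impI)
      fix e :: real assume "e > 0"
      then obtain i where i: "inverse (real (Suc i)) < e / 2"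
        using reals_Archimedean[of "e / 2"] by auto
      obtain m where m: "\<And>n. \<bar>\<Sum>k<n. X (k + m) \<omega>\<bar> < inverse (real (Suc i))" using elim by blast
      have eq: "(\<Sum>k<n. X (k + m) \<omega>) = sum (\<lambda>k. X k \<omega>) {m..<n + m}" for n
        using sum.shift_bounds_nat_ivl[of "\<lambda>k. X k \<omega>" 0 m n] by (simp add: lessThan_atLeast0)
      have "norm (sum (\<lambda>k. X k \<omega>) {a..<b}) < e" if "a \<ge> m" for a b
      proof (cases "a \<le> b")
        case True
        have "sum (\<lambda>k. X k \<omega>) {m..<a} + sum (\<lambda>k. X k \<omega>) {a..<b} = sum (\<lambda>k. X k \<omega>) {m..<b}"
          using that True by (simp add: sum.atLeastLessThan_concat)
        moreover have "\<bar>sum (\<lambda>k. X k \<omega>) {m..<a}\<bar> < e / 2" "\<bar>sum (\<lambda>k. X k \<omega>) {m..<b}\<bar> < e / 2"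
          using eq[of "a - m"] eq[of "b - m"] m[of "a - m"] m[of "b - m"] i that True by auto
        ultimately show ?thesis unfolding real_norm_def by linarith
      qed (use \<open>e > 0\<close> in auto)
      then show "\<exists>N. \<forall>m\<ge>N. \<forall>n. norm (sum (\<lambda>k. X k \<omega>) {m..<n}) < e" by blast
    qed
  qed
qed

end

section \<open>Measurability and independence of whole sequences\<close>

lemma sets_Collect_summable:
  fixes f :: "nat \<Rightarrow> 'a \<Rightarrow> real"
  assumes [measurable]: "\<And>k. f k \<in> borel_measurable N"
  shows "{x\<in>space N. summable (\<lambda>k. f k x)} \<in> sets N"
  unfolding summable_iff_convergent Cauchy_convergent_iff[symmetric] by measurable

lemma sets_vimage_algebra_mono:
  fixes Z :: "nat \<Rightarrow> 'a \<Rightarrow> 'b::topological_space"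
  assumes "m \<le> n"
  shows "sets (vimage_algebra \<Omega> (\<lambda>\<omega>. \<lambda>s\<in>{1..m}. Z s \<omega>) (Pi\<^sub>M {1..m} (\<lambda>_. borel)))
       \<subseteq> sets (vimage_algebra \<Omega> (\<lambda>\<omega>. \<lambda>s\<in>{1..n}. Z s \<omega>) (Pi\<^sub>M {1..n} (\<lambda>_. borel)))" (is "_ \<subseteq> sets ?V")
proof (rule sets_image_in_sets)
  have f: "(\<lambda>\<omega>. \<lambda>s\<in>{1..n}. Z s \<omega>) \<in> measurable ?V (Pi\<^sub>M {1..n} (\<lambda>_. borel))"
    by (rule measurable_vimage_algebra1) (auto simp: space_PiM)
  have "Z s \<in> borel_measurable ?V" if "s \<in> {1..n}" for s
    using measurable_compose[OF f measurable_component_singleton[OF that]] that by simp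
  then show "(\<lambda>\<omega>. \<lambda>s\<in>{1..m}. Z s \<omega>) \<in> measurable ?V (Pi\<^sub>M {1..m} (\<lambda>_. borel))"
    using assms by (intro measurable_restrict) auto
qed simp

text \<open>Events of the whole sequence are generated by single coordinates, and each coordinate is
  visible at some finite horizon. The shift by one reflects that horizons start at index 1.\<close>

lemma vimage_sequence_in_sigma_sets:
  fixes Z :: "nat \<Rightarrow> 'a \<Rightarrow> 'b::topological_space"
  assumes "A \<in> sets (Pi\<^sub>M UNIV (\<lambda>_::nat. borel))"
  shows "(\<lambda>\<omega> k. Z (Suc k) \<omega>) -` A \<inter> \<Omega> \<in> sigma_sets \<Omega>
    (\<Union>n. sets (vimage_algebra \<Omega> (\<lambda>\<omega>. \<lambda>s\<in>{1..n}. Z s \<omega>) (Pi\<^sub>M {1..n} (\<lambda>_. borel))))"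
    (is "_ \<in> sigma_sets \<Omega> (\<Union>n. sets (?V n))")
proof -
  define S where "S = sigma \<Omega> (\<Union>n. sets (?V n))"
  have sub: "(\<Union>n. sets (?V n)) \<subseteq> Pow \<Omega>"
    using sets.sets_into_space[of _ "?V _"] by auto
  have sets_S: "sets S = sigma_sets \<Omega> (\<Union>n. sets (?V n))" and space_S: "space S = \<Omega>"
    unfolding S_def using sub by (auto simp: space_measure_of_conv)
  have "Z (Suc k) \<in> borel_measurable S" for k
  proof -
    have f: "(\<lambda>\<omega>. \<lambda>s\<in>{1..Suc k}. Z s \<omega>) \<in> measurable (?V (Suc k)) (Pi\<^sub>M {1..Suc k} (\<lambda>_. borel))"
      by (rule measurable_vimage_algebra1) (auto simp: space_PiM)
    have "Z (Suc k) \<in> borel_measurable (?V (Suc k))"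
      using measurable_compose[OF f measurable_component_singleton[of "Suc k"]] by simp
    then show ?thesis
      by (rule measurable_mono[THEN subsetD, rotated -1])
         (auto simp: space_S sets_S intro: sigma_sets.Basic)
  qed
  then have "(\<lambda>\<omega> k. Z (Suc k) \<omega>) \<in> measurable S (Pi\<^sub>M UNIV (\<lambda>_. borel))"
    by (intro measurable_PiM_single') auto
  from measurable_sets[OF this assms] show ?thesis by (simp add: space_S sets_S)
qed

text \<open>The hypothesis pairs noises up to \<open>k + 1\<close> with directions up to
  \<open>k\<close>. These families increase with \<open>k\<close>, so their unions are
  intersection-stable and any two events lie in a common independent pair; independence then extends
  to the generated sigma-algebras.\<close>

lemma indep_var_noise_directions:
  fixes \<xi> :: "nat \<Rightarrow> 'a \<Rightarrow> real" and D :: "nat \<Rightarrow> 'a \<Rightarrow> real^'l"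
  assumes "prob_space P" and \<xi>: "\<And>k. \<xi> (Suc k) \<in> borel_measurable P"
    and D: "\<And>k. D k \<in> borel_measurable P" and ind: "noise_indep_directions P \<xi> D"
  shows "prob_space.indep_var P (Pi\<^sub>M UNIV (\<lambda>_. borel)) (\<lambda>\<omega> k. \<xi> (Suc k) \<omega>)
      (Pi\<^sub>M UNIV (\<lambda>_. borel)) (\<lambda>\<omega> k. D (Suc k) \<omega> $ r)"
proof -
  interpret prob_space P by fact
  define V where "V n = sets (vimage_algebra (space P) (\<lambda>\<omega>. \<lambda>s\<in>{1..n}. \<xi> s \<omega>) (Pi\<^sub>M {1..n} (\<lambda>_. borel)))" for n
  define U where "U n = sets (vimage_algebra (space P) (\<lambda>\<omega>. \<lambda>s\<in>{1..n}. D s \<omega>) (Pi\<^sub>M {1..n} (\<lambda>_. borel)))" for n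
  have mono: "m \<le> n \<Longrightarrow> V m \<subseteq> V n" "m \<le> n \<Longrightarrow> U m \<subseteq> U n" for m n
    unfolding V_def U_def by (intro sets_vimage_algebra_mono, assumption)+
  have Int: "a \<inter> b \<in> V n" if "a \<in> V n" "b \<in> V n" for a b n
    using that unfolding V_def by (rule sets.Int)
  have Int': "a \<inter> b \<in> U n" if "a \<in> U n" "b \<in> U n" for a b n
    using that unfolding U_def by (rule sets.Int)
  have VU: "indep_set (V (k + 1)) (U k)" for k
    using ind unfolding noise_indep_directions_def V_def U_def by blast
  have VI: "Int_stable (\<Union>n. V n)"
  proof (rule Int_stableI, clarify)
    fix a b m n assume "a \<in> V m" "b \<in> V n"
    then have "a \<inter> b \<in> V (max m n)" using mono[of m "max m n"] mono[of n "max m n"] by (intro Int) auto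
    then show "a \<inter> b \<in> (\<Union>n. V n)" by blast
  qed
  have UI: "Int_stable (\<Union>n. U n)"
  proof (rule Int_stableI, clarify)
    fix a b m n assume "a \<in> U m" "b \<in> U n"
    then have "a \<inter> b \<in> U (max m n)" using mono[of m "max m n"] mono[of n "max m n"] by (intro Int') auto
    then show "a \<inter> b \<in> (\<Union>n. U n)" by blast
  qed
  have "indep_set (\<Union>n. V n) (\<Union>n. U n)"
    unfolding indep_sets2_eq
  proof (intro conjI ballI)
    show "(\<Union>n. V n) \<subseteq> events"
      using VU mono(1) unfolding indep_sets2_eq by (metis Suc_eq_plus1 UN_subset_iff le_add1 order_trans)
    show "(\<Union>n. U n) \<subseteq> events"
      using VU unfolding indep_sets2_eq by blast
    fix a b assume "a \<in> (\<Union>n. V n)" "b \<in> (\<Union>n. U n)"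
    then obtain m n where "a \<in> V m" "b \<in> U n" by auto
    then have "a \<in> V (max m n + 1)" "b \<in> U (max m n)"
      using mono(1)[of m "max m n + 1"] mono(2)[of n "max m n"] by (auto simp: le_SucI)
    then show "prob (a \<inter> b) = prob a * prob b"
      using VU unfolding indep_sets2_eq by blast
  qed
  then have ind': "indep_set (sigma_sets (space P) (\<Union>n. V n)) (sigma_sets (space P) (\<Union>n. U n))"
    by (rule indep_set_sigma_sets[OF _ VI UI])
  show ?thesis
    unfolding indep_var_eq
  proof (intro conjI)
    show "random_variable (Pi\<^sub>M UNIV (\<lambda>_. borel)) (\<lambda>\<omega> k. \<xi> (Suc k) \<omega>)"
      by (rule measurable_PiM_single') (use \<xi> in auto)
    show "random_variable (Pi\<^sub>M UNIV (\<lambda>_. borel)) (\<lambda>\<omega> k. D (Suc k) \<omega> $ r)"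
    proof (rule measurable_PiM_single')
      show "(\<lambda>\<omega>. D (Suc k) \<omega> $ r) \<in> borel_measurable P" for k
        by (rule measurable_compose[OF D]) measurable
    qed auto
    have 1: "sigma_sets (space P) {(\<lambda>\<omega> k. \<xi> (Suc k) \<omega>) -` A \<inter> space P |A. A \<in> sets (Pi\<^sub>M UNIV (\<lambda>_. borel))}
        \<subseteq> sigma_sets (space P) (\<Union>n. V n)"
      using vimage_sequence_in_sigma_sets[of _ \<xi> "space P"] unfolding V_def
      by (intro sigma_sets_mono) blast
    have 2: "sigma_sets (space P) {(\<lambda>\<omega> k. D (Suc k) \<omega> $ r) -` A \<inter> space P |A. A \<in> sets (Pi\<^sub>M UNIV (\<lambda>_. borel))}
        \<subseteq> sigma_sets (space P) (\<Union>n. U n)"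
    proof (rule sigma_sets_mono, clarify)
      fix A :: "(nat \<Rightarrow> real) set" assume A: "A \<in> sets (Pi\<^sub>M UNIV (\<lambda>_. borel))"
      have "(\<lambda>v k. v k $ r) \<in> measurable (Pi\<^sub>M UNIV (\<lambda>_. borel :: (real^'l) measure)) (Pi\<^sub>M UNIV (\<lambda>_. borel))"
        by (intro measurable_PiM_single' measurable_compose[OF measurable_component_singleton[OF UNIV_I]]) auto
      from vimage_sequence_in_sigma_sets[OF measurable_sets[OF this A], of D "space P"]
      show "(\<lambda>\<omega> k. D (Suc k) \<omega> $ r) -` A \<inter> space P \<in> sigma_sets (space P) (\<Union>n. U n)"
        unfolding U_def by (simp add: vimage_def space_PiM)
    qed
    show "indep_set (sigma_sets (space P) {(\<lambda>\<omega> k. \<xi> (Suc k) \<omega>) -` A \<inter> space P |A. A \<in> sets (Pi\<^sub>M UNIV (\<lambda>_. borel))})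
      (sigma_sets (space P) {(\<lambda>\<omega> k. D (Suc k) \<omega> $ r) -` A \<inter> space P |A. A \<in> sets (Pi\<^sub>M UNIV (\<lambda>_. borel))})"
      using ind' 1 2 unfolding indep_sets2_eq by (meson subset_iff)
  qed
qed

section \<open>Series of random signs\<close>

context
  fixes P :: "'a measure" and D :: "nat \<Rightarrow> 'a \<Rightarrow> real^'l"
  assumes P: "prob_space P" and D: "random_directions P D"
begin

interpretation prob_space P by (rule P)

lemma directions_measurable: "D k \<in> borel_measurable P"
  using D unfolding random_directions_def indep_vars_def by blast

lemma directions_component_measurable: "(\<lambda>\<omega>. D k \<omega> $ r) \<in> borel_measurable P"
  using D unfolding random_directions_def indep_vars_def by blast

lemma AE_directions: "AE \<omega> in P. \<forall>k r. D k \<omega> $ r = 1 \<or> D k \<omega> $ r = -1"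
proof -
  have "AE \<omega> in P. D k \<omega> $ r = 1 \<or> D k \<omega> $ r = -1" for k r
  proof -
    note directions_component_measurable[of k r, measurable]
    let ?A = "\<lambda>a. {\<omega>\<in>space P. D k \<omega> $ r = a}"
    have "prob (?A 1 \<union> ?A (-1)) = prob (?A 1) + prob (?A (-1))"
      by (rule finite_measure_Union) auto
    also have "prob (?A 1) = 1 / 2" using D unfolding random_directions_def by blast
    also have "prob (?A (-1)) = 1 / 2" using D unfolding random_directions_def by blast
    finally have "prob (?A 1 \<union> ?A (-1)) = 1" by simp
    then have "AE \<omega> in P. \<omega> \<in> ?A 1 \<union> ?A (-1)" by (rule AE_prob_1)
    then show ?thesis by eventually_elim auto
  qed
  then show ?thesis by (simp add: AE_all_countable)
qed

lemma integrable_directions: "integrable P (\<lambda>\<omega>. D k \<omega> $ r)"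
  by (rule integrable_AE_bounded[where B=1, OF directions_component_measurable])
     (use AE_directions in eventually_elim, smt (verit))

lemma expectation_directions: "expectation (\<lambda>\<omega>. D k \<omega> $ r) = 0"
proof -
  note directions_component_measurable[of k r, measurable]
  let ?A = "\<lambda>a. {\<omega>\<in>space P. D k \<omega> $ r = a}"
  have "expectation (\<lambda>\<omega>. D k \<omega> $ r) = expectation (\<lambda>\<omega>. indicat_real (?A 1) \<omega> - indicat_real (?A (-1)) \<omega>)"
  proof (rule integral_cong_AE)
    show "AE \<omega> in P. D k \<omega> $ r = indicat_real (?A 1) \<omega> - indicat_real (?A (-1)) \<omega>"
      using AE_directions AE_space
    proof eventually_elim
      case (elim \<omega>)
      then show ?case by (auto simp: indicator_def split: if_splits)
    qed
  qed measurable
  also have "\<dots> = prob (?A 1) - prob (?A (-1))"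
    by (subst Bochner_Integration.integral_diff) (auto simp: emeasure_eq_measure)
  also have "prob (?A 1) = 1 / 2" using D unfolding random_directions_def by blast
  also have "prob (?A (-1)) = 1 / 2" using D unfolding random_directions_def by blast
  finally show ?thesis by simp
qed

text \<open>On the diagonal all terms vanish almost surely, as the components are signs. Off the
  diagonal the two factors are independent with mean zero, and different times are
  independent.\<close>

lemma directions_product_series:
  assumes g: "summable (\<lambda>k. (g k)\<^sup>2)"
  shows "AE \<omega> in P. \<forall>r s. summable (\<lambda>k. g k * (D k \<omega> $ r * D k \<omega> $ s - of_bool (r = s)))"
proof -
  have "AE \<omega> in P. summable (\<lambda>k. g k * (D k \<omega> $ r * D k \<omega> $ s - of_bool (r = s)))" for r s
  proof (cases "r = s")
    case True
    show ?thesis using AE_directions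
    proof eventually_elim
      case (elim \<omega>)
      then have "D k \<omega> $ s * D k \<omega> $ s = 1" for k by (metis minus_mult_minus mult_1)
      then show ?case using True by simp
    qed
  next
    case False
    have "AE \<omega> in P. summable (\<lambda>k. g k * (D k \<omega> $ r * D k \<omega> $ s))"
    proof (rule kolmogorov_convergence[where B="\<lambda>k. \<bar>g k\<bar>"])
      have "indep_vars (\<lambda>_. borel) D UNIV" using D unfolding random_directions_def by blast
      then show "indep_vars (\<lambda>_. borel) (\<lambda>k \<omega>. g k * (D k \<omega> $ r * D k \<omega> $ s)) UNIV"
        by (rule indep_vars_compose2) measurable
    next
      fix k
      have iv: "indep_var borel (\<lambda>\<omega>. D k \<omega> $ r) borel (\<lambda>\<omega>. D k \<omega> $ s)"
      proof -
        have "indep_vars (\<lambda>_. borel) (\<lambda>r \<omega>. D k \<omega> $ r) UNIV" using D unfolding random_directions_def by blast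
        then have "indep_var (PiM {r} (\<lambda>_. borel)) (\<lambda>\<omega>. restrict (\<lambda>i. D k \<omega> $ i) {r})
            (PiM {s} (\<lambda>_. borel)) (\<lambda>\<omega>. restrict (\<lambda>i. D k \<omega> $ i) {s})"
          by (rule indep_var_restrict) (use False in auto)
        then have "indep_var borel ((\<lambda>f. f r) \<circ> (\<lambda>\<omega>. restrict (\<lambda>i. D k \<omega> $ i) {r}))
            borel ((\<lambda>f. f s) \<circ> (\<lambda>\<omega>. restrict (\<lambda>i. D k \<omega> $ i) {s}))"
          by (rule indep_var_compose) auto
        then show ?thesis by (simp add: comp_def)
      qed
      show "expectation (\<lambda>\<omega>. g k * (D k \<omega> $ r * D k \<omega> $ s)) = 0"
        using indep_var_lebesgue_integral[OF iv integrable_directions integrable_directions] expectation_directions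
        by simp
    next
      show "summable (\<lambda>k. \<bar>g k\<bar>\<^sup>2)" using g by simp
    next
      show "AE \<omega> in P. \<bar>g k * (D k \<omega> $ r * D k \<omega> $ s)\<bar> \<le> \<bar>g k\<bar>" for k
        using AE_directions
      proof eventually_elim
        case (elim \<omega>)
        then have "\<bar>D k \<omega> $ r\<bar> = 1" "\<bar>D k \<omega> $ s\<bar> = 1" by (smt (verit))+
        then show ?case by (simp add: abs_mult)
      qed
    qed
    then show ?thesis using False by simp
  qed
  then show ?thesis by (simp add: AE_all_countable)
qed

text \<open>For a fixed noise sequence \<open>u\<close> the terms are independent centred signs with
  weights \<open>a k * u (Suc k)\<close>, and these are square summable for almost every
  \<open>u\<close>. Conditioning takes the form of Fubini for the product of the two laws, which is
  the joint law by independence of the whole sequences.\<close>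

lemma noise_series:
  assumes \<xi>: "\<And>k. \<xi> (Suc k) \<in> borel_measurable P" and ind: "noise_indep_directions P \<xi> D"
    and sq: "AE \<omega> in P. summable (\<lambda>k. (a k * \<xi> (Suc (Suc k)) \<omega>)\<^sup>2)"
  shows "AE \<omega> in P. \<forall>r. summable (\<lambda>k. a k * \<xi> (Suc (Suc k)) \<omega> * D (Suc k) \<omega> $ r)"
proof -
  have "AE \<omega> in P. summable (\<lambda>k. a k * \<xi> (Suc (Suc k)) \<omega> * D (Suc k) \<omega> $ r)" for r
  proof -
    let ?N = "Pi\<^sub>M UNIV (\<lambda>_::nat. borel :: real measure)"
    let ?X = "\<lambda>\<omega> k. \<xi> (Suc k) \<omega>" and ?Y = "\<lambda>\<omega> k. D (Suc k) \<omega> $ r"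
    have iv: "indep_var ?N ?X ?N ?Y"
      by (rule indep_var_noise_directions[OF P \<xi> directions_measurable ind])
    have X [measurable]: "?X \<in> measurable P ?N" and Y [measurable]: "?Y \<in> measurable P ?N"
      using iv by (auto dest: indep_var_rv1 indep_var_rv2)
    interpret X: prob_space "distr P ?N ?X" by (rule prob_space_distr) (rule X)
    interpret Y: prob_space "distr P ?N ?Y" by (rule prob_space_distr) (rule Y)
    interpret XY: pair_prob_space "distr P ?N ?X" "distr P ?N ?Y" ..
    \<comment> \<open>Both coordinate sequences begin with the term of index 1, so
      \<open>fst z (Suc k)\<close> is \<open>\<xi> (Suc (Suc k))\<close> and meets direction
      \<open>Suc k\<close>.\<close>
    define Q where "Q z = summable (\<lambda>k. a k * fst z (Suc k) * snd z k)" for z :: "(nat \<Rightarrow> real) \<times> (nat \<Rightarrow> real)"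
    have Qm: "{z\<in>space (?N \<Otimes>\<^sub>M ?N). Q z} \<in> sets (?N \<Otimes>\<^sub>M ?N)"
    proof -
      have [measurable]: "(\<lambda>z. fst z (Suc k)) \<in> borel_measurable (?N \<Otimes>\<^sub>M ?N)"
           "(\<lambda>z. snd z k) \<in> borel_measurable (?N \<Otimes>\<^sub>M ?N)" for k
        by measurable
      show ?thesis unfolding Q_def by (rule sets_Collect_summable) measurable
    qed
    have "AE u in distr P ?N ?X. summable (\<lambda>k. (a k * u (Suc k))\<^sup>2)"
    proof (subst AE_distr_iff[OF X])
      show "{u\<in>space ?N. summable (\<lambda>k. (a k * u (Suc k))\<^sup>2)} \<in> sets ?N"
        by (rule sets_Collect_summable) measurable
      show "AE \<omega> in P. summable (\<lambda>k. (a k * ?X \<omega> (Suc k))\<^sup>2)" by (rule sq)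
    qed
    then have "AE u in distr P ?N ?X. AE v in distr P ?N ?Y. Q (u, v)"
    proof eventually_elim
      case (elim u)
      show ?case
      proof (subst AE_distr_iff[OF Y])
        show "{v\<in>space ?N. Q (u, v)} \<in> sets ?N"
          unfolding Q_def fst_conv snd_conv by (rule sets_Collect_summable) measurable
        have "AE \<omega> in P. summable (\<lambda>k. a k * u (Suc k) * D (k + 1) \<omega> $ r)"
        proof (rule kolmogorov_convergence[where B="\<lambda>k. \<bar>a k * u (Suc k)\<bar>"])
          have "indep_vars (\<lambda>_. borel) D UNIV" using D unfolding random_directions_def by blast
          from indep_vars_shift[OF this]
          show "indep_vars (\<lambda>_. borel) (\<lambda>k \<omega>. a k * u (Suc k) * D (k + 1) \<omega> $ r) UNIV"
            by (rule indep_vars_compose2) measurable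
          show "AE \<omega> in P. \<bar>a k * u (Suc k) * D (k + 1) \<omega> $ r\<bar> \<le> \<bar>a k * u (Suc k)\<bar>" for k
            using AE_directions
          proof eventually_elim
            case (elim \<omega>)
            then have "\<bar>D (k + 1) \<omega> $ r\<bar> = 1" by (smt (verit))
            then show ?case by (simp add: abs_mult)
          qed
          show "expectation (\<lambda>\<omega>. a k * u (Suc k) * D (k + 1) \<omega> $ r) = 0" for k
            using expectation_directions by simp
          show "summable (\<lambda>k. \<bar>a k * u (Suc k)\<bar>\<^sup>2)" using elim by simp
        qed
        then show "AE \<omega> in P. Q (u, ?Y \<omega>)" by (simp add: Q_def)
      qed
    qed
    then have "AE z in distr P ?N ?X \<Otimes>\<^sub>M distr P ?N ?Y. Q z"
      by (intro XY.AE_pair_measure) (use Qm in \<open>simp_all add: space_pair_measure cong: sets_pair_measure_cong\<close>)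
    then have "AE z in distr P (?N \<Otimes>\<^sub>M ?N) (\<lambda>\<omega>. (?X \<omega>, ?Y \<omega>)). Q z"
      using iv unfolding indep_var_distribution_eq by metis
    then have "AE \<omega> in P. Q (?X \<omega>, ?Y \<omega>)"
      by (subst (asm) AE_distr_iff) (use Qm in auto)
    then show ?thesis by (simp add: Q_def)
  qed
  then show ?thesis by (simp add: AE_all_countable)
qed

end

text \<open>A bound on the noise, even a random one, permits a comparison path by path. With bounded
  second moments the whole nonnegative series has finite expectation and is therefore finite almost
  surely.\<close>

lemma AE_summable_weighted_noise:
  assumes "prob_space P" and \<xi> [measurable]: "\<And>k. \<xi> (Suc k) \<in> borel_measurable P"
    and nb: "noise_bounded P \<xi> \<or> noise_bounded_second_moment P \<xi>"
    and a: "summable (\<lambda>k. (a k)\<^sup>2)"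
  shows "AE \<omega> in P. summable (\<lambda>k. (a k * \<xi> (Suc (Suc k)) \<omega>)\<^sup>2)"
  using nb
proof
  assume "noise_bounded P \<xi>"
  then obtain b where "AE \<omega> in P. \<forall>k. \<bar>\<xi> (Suc k) \<omega>\<bar> \<le> (b \<omega> :: real)"
    unfolding noise_bounded_def by blast
  then show ?thesis
  proof eventually_elim
    case (elim \<omega>)
    show ?case
    proof (rule summable_comparison_test'[OF summable_mult2[OF a, of "(b \<omega>)\<^sup>2"]])
      fix k :: nat
      have "(\<xi> (Suc (Suc k)) \<omega>)\<^sup>2 \<le> (b \<omega>)\<^sup>2"
        using abs_power2_le elim by fastforce
      then show "norm ((a k * \<xi> (Suc (Suc k)) \<omega>)\<^sup>2) \<le> (a k)\<^sup>2 * (b \<omega>)\<^sup>2"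
        by (simp add: power_mult_distrib mult_left_mono)
    qed
  qed
next
  assume "noise_bounded_second_moment P \<xi>"
  then have fin: "(SUP k. \<integral>\<^sup>+\<omega>. ennreal ((\<xi> (Suc k) \<omega>)\<^sup>2) \<partial>P) < \<infinity>" (is "?S < _")
    unfolding noise_bounded_second_moment_def .
  have "(\<integral>\<^sup>+\<omega>. (\<Sum>k. ennreal ((a k * \<xi> (Suc (Suc k)) \<omega>)\<^sup>2)) \<partial>P)
      = (\<Sum>k. \<integral>\<^sup>+\<omega>. ennreal ((a k * \<xi> (Suc (Suc k)) \<omega>)\<^sup>2) \<partial>P)"
    by (rule nn_integral_suminf) measurable
  also have "\<dots> \<le> (\<Sum>k. ennreal ((a k)\<^sup>2) * ?S)"
  proof (rule suminf_le)
    fix k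
    have "(\<integral>\<^sup>+\<omega>. ennreal ((a k * \<xi> (Suc (Suc k)) \<omega>)\<^sup>2) \<partial>P)
        = ennreal ((a k)\<^sup>2) * (\<integral>\<^sup>+\<omega>. ennreal ((\<xi> (Suc (Suc k)) \<omega>)\<^sup>2) \<partial>P)"
      by (subst nn_integral_cmult[symmetric]) (auto simp: power_mult_distrib ennreal_mult)
    also have "\<dots> \<le> ennreal ((a k)\<^sup>2) * ?S"
      by (intro mult_left_mono SUP_upper2[of "Suc k"]) auto
    finally show "(\<integral>\<^sup>+\<omega>. ennreal ((a k * \<xi> (Suc (Suc k)) \<omega>)\<^sup>2) \<partial>P) \<le> ennreal ((a k)\<^sup>2) * ?S" .
  qed auto
  also have "\<dots> = ennreal (\<Sum>k. (a k)\<^sup>2) * ?S"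
    using a by (simp add: suminf_ennreal2)
  also have "\<dots> < \<infinity>" using fin by (simp add: ennreal_mult_less_top)
  finally have "(\<integral>\<^sup>+\<omega>. (\<Sum>k. ennreal ((a k * \<xi> (Suc (Suc k)) \<omega>)\<^sup>2)) \<partial>P) \<noteq> \<infinity>" by simp
  then have "AE \<omega> in P. (\<Sum>k. ennreal ((a k * \<xi> (Suc (Suc k)) \<omega>)\<^sup>2)) \<noteq> \<infinity>"
    by (rule nn_integral_PInf_AE[rotated]) measurable
  then show ?thesis
    by eventually_elim (rule summable_suminf_not_top, auto)
qed

section \<open>Difference estimates of the gradients\<close>

lemma central_difference_mean_value:
  fixes f :: "'b::real_inner \<Rightarrow> real"
  assumes g: "\<And>x. GDERIV f x :> g x" and h: "h > 0"
  obtains t where "\<bar>t\<bar> < h" "f (y + h *\<^sub>R d) - f (y - h *\<^sub>R d) = 2 * h * (g (y + t *\<^sub>R d) \<bullet> d)"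
proof -
  have der: "((\<lambda>t. f (y + t *\<^sub>R d)) has_real_derivative (g (y + t *\<^sub>R d) \<bullet> d)) (at t)" for t
  proof -
    have "((\<lambda>t. f (y + t *\<^sub>R d)) has_derivative (\<lambda>s. (s *\<^sub>R d) \<bullet> g (y + t *\<^sub>R d))) (at t)"
    proof (rule has_derivative_compose[of "\<lambda>t. y + t *\<^sub>R d" "\<lambda>s. s *\<^sub>R d" t UNIV f])
      show "((\<lambda>t. y + t *\<^sub>R d) has_derivative (\<lambda>s. s *\<^sub>R d)) (at t)" by (auto intro!: derivative_eq_intros)
      show "(f has_derivative (\<lambda>h. h \<bullet> g (y + t *\<^sub>R d))) (at (y + t *\<^sub>R d))"
        using g[of "y + t *\<^sub>R d"] by (simp add: gderiv_def)
    qed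
    then show ?thesis by (simp add: has_field_derivative_def inner_commute mult_commute_abs)
  qed
  obtain t where "- h < t" "t < h" "f (y + h *\<^sub>R d) - f (y + (- h) *\<^sub>R d) = (h - (- h)) * (g (y + t *\<^sub>R d) \<bullet> d)"
    using MVT2[of "-h" h "\<lambda>t. f (y + t *\<^sub>R d)" "\<lambda>t. g (y + t *\<^sub>R d) \<bullet> d"] der h by auto
  then show thesis using that[of t] by simp
qed

lemma convex_gradient_inequality:
  fixes f :: "'b::real_inner \<Rightarrow> real"
  assumes cv: "convex_on UNIV f" and g: "GDERIV f x :> g"
  shows "f x - f y \<le> g \<bullet> (x - y)"
proof -
  let ?\<phi> = "\<lambda>t. f (x + t *\<^sub>R (y - x))"
  have "convex_on UNIV ?\<phi>"
  proof (rule convex_onI)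
    fix t u v :: real assume t: "0 < t" "t < 1"
    have "x + ((1 - t) *\<^sub>R u + t *\<^sub>R v) *\<^sub>R (y - x) = (1 - t) *\<^sub>R (x + u *\<^sub>R (y - x)) + t *\<^sub>R (x + v *\<^sub>R (y - x))"
      by (simp add: algebra_simps)
    then show "?\<phi> ((1 - t) *\<^sub>R u + t *\<^sub>R v) \<le> (1 - t) * ?\<phi> u + t * ?\<phi> v"
      using convex_onD[OF cv, of t] t by simp
  qed simp
  moreover have "(?\<phi> has_real_derivative (g \<bullet> (y - x))) (at 0)"
  proof -
    have "(?\<phi> has_derivative (\<lambda>s. (s *\<^sub>R (y - x)) \<bullet> g)) (at 0)"
    proof (rule has_derivative_compose[of "\<lambda>t. x + t *\<^sub>R (y - x)" "\<lambda>s. s *\<^sub>R (y - x)" 0 UNIV f])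
      show "((\<lambda>t. x + t *\<^sub>R (y - x)) has_derivative (\<lambda>s. s *\<^sub>R (y - x))) (at 0)" by (auto intro!: derivative_eq_intros)
      show "(f has_derivative (\<lambda>h. h \<bullet> g)) (at (x + 0 *\<^sub>R (y - x)))"
        using g by (simp add: gderiv_def)
    qed
    then show ?thesis by (simp add: has_field_derivative_def inner_commute mult_commute_abs)
  qed
  ultimately have "?\<phi> 1 - ?\<phi> 0 \<ge> g \<bullet> (y - x) * (1 - 0)"
    by (intro convex_on_imp_above_tangent[of UNIV]) auto
  then show ?thesis by (simp add: inner_diff_right)
qed

text \<open>Needed to see that projecting keeps the direction from the centre. By the triangle
  inequality every point of the ball has distance at least \<open>norm (z - a) - R\<close> from
  \<open>z\<close>, and this value is attained.\<close>

lemma closest_point_cball_outside: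
  fixes a :: "'b::euclidean_space"
  assumes "R > 0" "norm (z - a) > R"
  shows "closest_point (cball a R) z = a + (R / norm (z - a)) *\<^sub>R (z - a)"
proof (rule closest_point_unique[symmetric])
  let ?p = "a + (R / norm (z - a)) *\<^sub>R (z - a)"
  show "?p \<in> cball a R" using assms by (auto simp: dist_norm)
  have "z - ?p = (1 - R / norm (z - a)) *\<^sub>R (z - a)" by (simp add: algebra_simps)
  then have "dist z ?p = \<bar>1 - R / norm (z - a)\<bar> * norm (z - a)"
    by (simp only: dist_norm norm_scaleR)
  also have "\<bar>1 - R / norm (z - a)\<bar> = 1 - R / norm (z - a)"
    by (rule abs_of_nonneg) (use assms in \<open>simp add: divide_le_eq\<close>)
  also have "\<dots> * norm (z - a) = norm (z - a) - R" using assms by (cases "z = a") (simp_all add: left_diff_distrib)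
  finally have "dist z ?p = norm (z - a) - R" .
  moreover have "norm (z - a) - R \<le> dist z w" if "w \<in> cball a R" for w
    using that norm_triangle_ineq[of "z - w" "w - a"] by (simp add: dist_norm norm_minus_commute)
  ultimately show "\<forall>w\<in>cball a R. dist z ?p \<le> dist z w" by simp
qed auto

text \<open>One sample path on the almost sure event. The probabilistic input consists of
  \<open>signs\<close>, \<open>products\<close> and \<open>noise\<close>; \<nu> carries its step
  size.\<close>

locale spsa_path =
  fixes E :: "nat \<Rightarrow> ('v::finite \<times> 'v) set" and W :: "nat \<Rightarrow> real^'v^'v"
    and \<gamma> \<alpha> :: "nat \<Rightarrow> real" and c :: "'v \<Rightarrow> real^'l \<Rightarrow> real" and g :: "'v \<Rightarrow> real^'l \<Rightarrow> real^'l"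
    and D :: "'v \<Rightarrow> nat \<Rightarrow> real^'l" and \<nu> :: "'v \<Rightarrow> nat \<Rightarrow> real^'l" and a :: "real^'l"
  assumes net: "network E W" and com: "communication_condition E W"
    and step_pos: "\<And>k. \<gamma> k > 0" and step_lim: "\<gamma> \<longlonglongrightarrow> 0" and step_sum: "\<not> summable \<gamma>"
    and \<alpha>_pos: "\<And>k. \<alpha> k > 0" and \<alpha>_lim: "\<alpha> \<longlonglongrightarrow> 0"
    and grad: "\<And>i y. GDERIV (c i) y :> g i y" and grad_cont: "\<And>i. continuous_on UNIV (g i)"
    and convex: "convex_on UNIV (\<lambda>y. \<Sum>i\<in>UNIV. c i y)"
    and minimum: "unique_global_min (\<lambda>y. \<Sum>i\<in>UNIV. c i y) a"
    and signs: "\<And>i k r. D i k $ r = 1 \<or> D i k $ r = -1"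
    and products: "\<And>i r s. summable (\<lambda>k. \<gamma> k * (D i k $ r * D i k $ s - of_bool (r = s)))"
    and noise: "\<And>i. summable (\<nu> i)"
begin

lemma gradient_continuous_on: "continuous_on S (g i)"
  by (rule continuous_on_subset[OF grad_cont]) simp

definition difference_estimate :: "'v \<Rightarrow> nat \<Rightarrow> real^'l \<Rightarrow> real^'l" where
  "difference_estimate i k y =
     ((c i (y + \<alpha> k *\<^sub>R D i k) - c i (y - \<alpha> k *\<^sub>R D i k)) / (2 * \<alpha> k)) *\<^sub>R D i k"

lemma norm_direction: "(norm (D i k))\<^sup>2 = real CARD('l)"
proof -
  have "D i k $ r * D i k $ r = 1" for r using signs[of i k r] by auto
  then show ?thesis by (simp add: power2_norm_eq_inner inner_vec_def)
qed

text \<open>Each entry of the matrix series converges, hence has small tails. One \<open>K\<close>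
  serves the finitely many entries, and a matrix bound is uniform in \<open>v\<close>.\<close>

lemma direction_average:
  assumes \<epsilon>: "\<epsilon> > 0"
  shows "\<exists>K. \<forall>m\<ge>K. \<forall>n v. norm (\<Sum>k\<in>{m..<n}. \<gamma> k *\<^sub>R ((D i k \<bullet> v) *\<^sub>R D i k - v)) \<le> \<epsilon> * norm v"
proof -
  define l where "l = real CARD('l)"
  have l: "l > 0" by (simp add: l_def)
  let ?e = "\<lambda>r s k. \<gamma> k * (D i k $ r * D i k $ s - of_bool (r = s))"
  \<comment> \<open>Summing over \<open>l\<close> columns for a component, and over \<open>l\<close>
    components for the norm, loses the factor \<open>l * l\<close>.\<close>
  have "\<exists>K. \<forall>m\<ge>K. \<forall>n. norm (\<Sum>k\<in>{m..<n}. ?e r s k) < \<epsilon> / (l * l)" for r s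
    using products[of i r s] \<epsilon> l unfolding summable_Cauchy by simp
  then have "\<forall>\<^sub>F m in sequentially. \<forall>r s. \<forall>n. norm (\<Sum>k\<in>{m..<n}. ?e r s k) < \<epsilon> / (l * l)"
    by (intro eventually_all_finite) (auto simp: eventually_sequentially)
  then obtain K where "\<forall>m\<ge>K. \<forall>r s. \<forall>n. norm (\<Sum>k\<in>{m..<n}. ?e r s k) < \<epsilon> / (l * l)"
    unfolding eventually_sequentially by blast
  then have K: "\<bar>\<Sum>k\<in>{m..<n}. ?e r s k\<bar> < \<epsilon> / (l * l)" if "m \<ge> K" for m n r s
    using that by simp
  have "norm (\<Sum>k\<in>{m..<n}. \<gamma> k *\<^sub>R ((D i k \<bullet> v) *\<^sub>R D i k - v)) \<le> \<epsilon> * norm v" if m: "m \<ge> K" for m n v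
  proof -
    let ?s = "\<Sum>k\<in>{m..<n}. \<gamma> k *\<^sub>R ((D i k \<bullet> v) *\<^sub>R D i k - v)"
    have "\<bar>?s $ r\<bar> \<le> l * (\<epsilon> / (l * l) * norm v)" for r
    proof -
      have "(\<gamma> k *\<^sub>R ((D i k \<bullet> v) *\<^sub>R D i k - v)) $ r = (\<Sum>s\<in>UNIV. ?e r s k * v $ s)" for k
      proof -
        have "v $ r = (\<Sum>s\<in>UNIV. if r = s then v $ s else 0)" by simp
        also have "\<dots> = (\<Sum>s\<in>UNIV. of_bool (r = s) * v $ s)" by (rule sum.cong) auto
        finally have "v $ r = (\<Sum>s\<in>UNIV. of_bool (r = s) * v $ s)" .
        then have "(\<gamma> k *\<^sub>R ((D i k \<bullet> v) *\<^sub>R D i k - v)) $ r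
            = \<gamma> k * ((\<Sum>s\<in>UNIV. D i k $ s * v $ s) * D i k $ r - (\<Sum>s\<in>UNIV. of_bool (r = s) * v $ s))"
          by (simp add: inner_vec_def)
        also have "\<dots> = (\<Sum>s\<in>UNIV. ?e r s k * v $ s)"
          unfolding sum_distrib_left sum_distrib_right sum_subtractf[symmetric]
          by (rule sum.cong) (simp_all add: algebra_simps)
        finally show ?thesis .
      qed
      then have "?s $ r = (\<Sum>s\<in>UNIV. (\<Sum>k\<in>{m..<n}. ?e r s k) * v $ s)"
        unfolding sum_component sum_distrib_right by (subst sum.swap) simp
      also have "\<bar>\<dots>\<bar> \<le> (\<Sum>s\<in>(UNIV :: 'l set). \<epsilon> / (l * l) * norm v)"
      proof (rule order_trans[OF sum_abs sum_mono])
        fix s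
        show "\<bar>(\<Sum>k\<in>{m..<n}. ?e r s k) * v $ s\<bar> \<le> \<epsilon> / (l * l) * norm v"
          unfolding abs_mult
          by (rule mult_mono) (use K[OF m, of r s n] \<epsilon> l component_le_norm_cart[of v s] in \<open>auto simp: less_imp_le\<close>)
      qed
      finally show ?thesis by (simp add: l_def)
    qed
    then have "(\<Sum>r\<in>UNIV. \<bar>?s $ r\<bar>) \<le> (\<Sum>r\<in>(UNIV :: 'l set). l * (\<epsilon> / (l * l) * norm v))" by (intro sum_mono)
    also have "\<dots> = \<epsilon> * norm v" using l by (simp add: l_def[symmetric] field_simps)
    finally show ?thesis using norm_le_l1_cart[of ?s] by linarith
  qed
  then show ?thesis by blast
qed

lemma difference_estimate_approx:
  assumes \<epsilon>: "\<epsilon> > 0"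
  shows "\<exists>K. \<forall>k\<ge>K. \<forall>y\<in>cball a R. norm (difference_estimate i k y - (D i k \<bullet> g i y) *\<^sub>R D i k) \<le> \<epsilon>"
proof -
  define l where "l = real CARD('l)"
  have l: "l > 0" by (simp add: l_def)
  have nD: "norm (D i k) = sqrt l" for k
    using real_sqrt_unique[OF norm_direction[of i k] norm_ge_zero] by (simp add: l_def)
  \<comment> \<open>The mean value theorem evaluates the gradient off \<open>y\<close>, possibly
    outside \<open>cball a R\<close>. The \<open>1\<close> in \<open>min 1 \<theta>\<close> below
    keeps that point in the larger ball.\<close>
  have "uniformly_continuous_on (cball a (R + 1)) (g i)"
    by (rule compact_uniformly_continuous) (auto intro: gradient_continuous_on)
  then obtain \<theta> where \<theta>: "\<theta> > 0" "\<And>y z. y \<in> cball a (R + 1) \<Longrightarrow> z \<in> cball a (R + 1) \<Longrightarrow> dist z y < \<theta> \<Longrightarrow> dist (g i z) (g i y) < \<epsilon> / l"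
    unfolding uniformly_continuous_on_def using divide_pos_pos[OF \<epsilon> l] by blast
  have "\<forall>\<^sub>F k in sequentially. \<alpha> k < min 1 \<theta> / sqrt l"
    using \<alpha>_lim \<theta> l by (intro order_tendstoD(2)) auto
  then obtain K where K: "\<And>k. k \<ge> K \<Longrightarrow> \<alpha> k < min 1 \<theta> / sqrt l" by (auto simp: eventually_sequentially)
  have "norm (difference_estimate i k y - (D i k \<bullet> g i y) *\<^sub>R D i k) \<le> \<epsilon>" if k: "k \<ge> K" and y: "y \<in> cball a R" for k y
  proof -
    obtain t where t: "\<bar>t\<bar> < \<alpha> k"
      "c i (y + \<alpha> k *\<^sub>R D i k) - c i (y - \<alpha> k *\<^sub>R D i k) = 2 * \<alpha> k * (g i (y + t *\<^sub>R D i k) \<bullet> D i k)"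
      by (rule central_difference_mean_value[OF grad \<alpha>_pos])
    have "dist (y + t *\<^sub>R D i k) y = \<bar>t\<bar> * sqrt l" by (simp add: dist_norm nD)
    also have "\<dots> \<le> \<alpha> k * sqrt l" using t l by (simp add: mult_right_mono)
    also have "\<dots> < min 1 \<theta>" using K[OF k] l by (simp add: pos_less_divide_eq)
    finally have d: "dist (y + t *\<^sub>R D i k) y < min 1 \<theta>" .
    moreover have "y + t *\<^sub>R D i k \<in> cball a (R + 1)"
      using d y dist_triangle[of a "y + t *\<^sub>R D i k" y] by (simp add: dist_commute)
    ultimately have "dist (g i (y + t *\<^sub>R D i k)) (g i y) < \<epsilon> / l" using y by (intro \<theta>(2)) auto
    then have n: "norm (g i (y + t *\<^sub>R D i k) - g i y) \<le> \<epsilon> / l" by (simp add: dist_norm)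
    have "difference_estimate i k y - (D i k \<bullet> g i y) *\<^sub>R D i k = ((g i (y + t *\<^sub>R D i k) - g i y) \<bullet> D i k) *\<^sub>R D i k"
      using t(2) \<alpha>_pos[of k]
      by (simp add: difference_estimate_def inner_commute inner_diff_left inner_diff_right scaleR_left_diff_distrib)
    also have "norm \<dots> \<le> norm (g i (y + t *\<^sub>R D i k) - g i y) * norm (D i k) * norm (D i k)"
      by (simp add: Cauchy_Schwarz_ineq2 mult_right_mono)
    also have "\<dots> = norm (g i (y + t *\<^sub>R D i k) - g i y) * l" using nD l by (simp add: mult.assoc)
    also have "\<dots> \<le> \<epsilon>" using n l by (simp add: pos_le_divide_eq)
    finally show ?thesis .
  qed
  then show ?thesis by blast
qed

text \<open>Projection to a ball centred at the minimiser merely shortens \<open>z - a\<close>. The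
  convexity inequality at the projection \<open>p\<close> bounds the inner product of the gradient
  with \<open>p - a\<close> below by the gap between the costs of \<open>p\<close> and
  \<open>a\<close>, and rescaling carries this over to \<open>z - a\<close>.\<close>

lemma projected_drift:
  assumes R: "R > 0" and \<epsilon>: "\<epsilon> > 0"
  shows "\<exists>\<kappa>>0. \<forall>z. \<epsilon> \<le> norm (z - a) \<longrightarrow>
    \<kappa> * norm (z - a) \<le> agent_mean (\<lambda>i. g i (closest_point (cball a R) z)) \<bullet> (z - a)"
proof -
  let ?f = "\<lambda>y. \<Sum>i\<in>UNIV. c i y" and ?N = "real CARD('v)"
  have gf: "GDERIV ?f y :> (\<Sum>i\<in>UNIV. g i y)" for y
    unfolding gderiv_def inner_sum_right
    by (rule has_derivative_sum) (use grad in \<open>simp add: gderiv_def\<close>)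
  have pos: "?f z > ?f a" if "z \<noteq> a" for z
  proof (rule ccontr)
    assume "\<not> ?f z > ?f a"
    then have "\<forall>y. ?f z \<le> ?f y" using minimum unfolding unique_global_min_def by (meson not_less order_trans)
    then show False using minimum that unfolding unique_global_min_def by blast
  qed
  \<comment> \<open>This compact shell contains the projection of every \<open>z\<close> with
    \<open>\<epsilon> \<le> norm (z - a)\<close>: either \<open>z\<close> itself or a point of the
    sphere, also if \<epsilon> exceeds \<open>R\<close>. It omits \<open>a\<close>, so the cost gap
    has a positive minimum on it.\<close>
  define S where "S = cball a R - ball a (min \<epsilon> R)"
  have contf: "continuous_on UNIV ?f"
    by (rule has_derivative_continuous_on[of _ _ "\<lambda>y h. h \<bullet> (\<Sum>i\<in>UNIV. g i y)"]) (use gf in \<open>simp add: gderiv_def\<close>)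
  obtain \<mu> where \<mu>: "\<mu> > 0" "\<And>p. p \<in> S \<Longrightarrow> \<mu> \<le> ?f p - ?f a"
  proof (cases "S = {}")
    case True then show thesis using that[of 1] by auto
  next
    case False
    have "compact S" unfolding S_def by (rule compact_diff) auto
    then obtain q where q: "q \<in> S" "\<And>p. p \<in> S \<Longrightarrow> ?f q \<le> ?f p"
      using continuous_attains_inf[of S ?f] False continuous_on_subset[OF contf] by auto
    have "q \<noteq> a" using q(1) \<epsilon> R by (auto simp: S_def)
    then show thesis using that[of "?f q - ?f a"] pos[of q] q(2) by auto
  qed
  have "(\<mu> / (R * ?N)) * norm (z - a) \<le> agent_mean (\<lambda>i. g i (closest_point (cball a R) z)) \<bullet> (z - a)"
    if z: "\<epsilon> \<le> norm (z - a)" for z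
  proof -
    define p where "p = closest_point (cball a R) z"
    define \<rho> where "\<rho> = norm (p - a)"
    have \<rho>: "min \<epsilon> R \<le> \<rho>" "\<rho> \<le> R" and zp: "z - a = (norm (z - a) / \<rho>) *\<^sub>R (p - a)"
    proof -
      consider "norm (z - a) \<le> R" | "norm (z - a) > R" by linarith
      then have "min \<epsilon> R \<le> \<rho> \<and> \<rho> \<le> R \<and> z - a = (norm (z - a) / \<rho>) *\<^sub>R (p - a)"
      proof cases
        case 1
        then have "p = z" unfolding p_def by (intro closest_point_self) (simp add: dist_norm norm_minus_commute)
        then show ?thesis using 1 z \<epsilon> by (auto simp: \<rho>_def)
      next
        case 2
        then have "p = a + (R / norm (z - a)) *\<^sub>R (z - a)"
          unfolding p_def by (rule closest_point_cball_outside[OF R])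
        then have "p - a = (R / norm (z - a)) *\<^sub>R (z - a)" by simp
        moreover have "z \<noteq> a" using 2 R by auto
        moreover from calculation have "\<rho> = R" using R by (simp add: \<rho>_def)
        ultimately show ?thesis using 2 R by auto
      qed
      then show "min \<epsilon> R \<le> \<rho>" "\<rho> \<le> R" "z - a = (norm (z - a) / \<rho>) *\<^sub>R (p - a)" by auto
    qed
    have \<rho>0: "\<rho> > 0" using \<rho>(1) \<epsilon> R by auto
    have "p \<in> S" using \<rho> by (auto simp: S_def \<rho>_def dist_norm norm_minus_commute)
    then have "\<mu> \<le> (\<Sum>i\<in>UNIV. g i p) \<bullet> (p - a)"
      using \<mu>(2)[of p] convex_gradient_inequality[OF convex gf, of p a] by linarith
    then have "norm (z - a) / \<rho> * \<mu> \<le> norm (z - a) / \<rho> * ((\<Sum>i\<in>UNIV. g i p) \<bullet> (p - a))"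
      using \<rho>0 by (intro mult_left_mono) auto
    also have "\<dots> = (\<Sum>i\<in>UNIV. g i p) \<bullet> (z - a)" by (subst (2) zp) simp
    finally have "norm (z - a) / \<rho> * \<mu> \<le> (\<Sum>i\<in>UNIV. g i p) \<bullet> (z - a)" .
    moreover have "norm (z - a) / R * \<mu> \<le> norm (z - a) / \<rho> * \<mu>"
      using \<rho> \<rho>0 \<mu>(1) R by (intro mult_right_mono divide_left_mono) auto
    ultimately have "norm (z - a) / R * \<mu> \<le> (\<Sum>i\<in>UNIV. g i p) \<bullet> (z - a)" by linarith
    then have "(norm (z - a) / R * \<mu>) / ?N \<le> ((\<Sum>i\<in>UNIV. g i p) \<bullet> (z - a)) / ?N"
      by (rule divide_right_mono) simp
    then show ?thesis by (simp add: agent_mean_def p_def[symmetric] mult.commute mult.left_commute)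
  qed
  moreover have "\<mu> / (R * ?N) > 0" using \<mu> R by simp
  ultimately show ?thesis by blast
qed

lemma projected_averaged_descent:
  assumes R: "R > 0"
  shows "\<exists>C. averaged_descent E W \<gamma> (\<lambda>i k y. difference_estimate i k (closest_point (cball a R) y))
    (\<lambda>i y. g i (closest_point (cball a R) y)) (\<lambda>i k v. (D i k \<bullet> v) *\<^sub>R D i k) \<nu> a C"
proof -
  let ?p = "closest_point (cball a R)"
  have p_in: "?p y \<in> cball a R" for y by (rule closest_point_in_set) (use R in auto)
  have "\<exists>b. \<forall>y\<in>cball a R. norm (g i y) \<le> b" for i
  proof -
    have "compact (g i ` cball a R)"
      by (rule compact_continuous_image) (auto intro: gradient_continuous_on)
    then have "bounded (g i ` cball a R)" by (rule compact_imp_bounded)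
    then show ?thesis unfolding bounded_iff by auto
  qed
  then obtain b where b: "\<And>i y. y \<in> cball a R \<Longrightarrow> norm (g i y) \<le> b i" by metis
  \<comment> \<open>\<open>real CARD('l)\<close> is the squared norm of a direction and so bounds
    \<open>D D^T\<close>; the other entry bounds the gradients on the ball.\<close>
  define C where "C = max (real CARD('l)) (Max (range b))"
  have "averaged_descent E W \<gamma> (\<lambda>i k y. difference_estimate i k (?p y)) (\<lambda>i y. g i (?p y)) (\<lambda>i k v. (D i k \<bullet> v) *\<^sub>R D i k) \<nu> a C"
  proof (rule averaged_descent.intro)
    show "C > 0" by (simp add: C_def less_max_iff_disj)
    show "norm (g i (?p y)) \<le> C" for i y
    proof -
      have "norm (g i (?p y)) \<le> b i" using b p_in by blast
      also have "\<dots> \<le> C" by (auto simp: C_def le_max_iff_disj)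
      finally show ?thesis .
    qed
    show "uniformly_continuous_on UNIV (\<lambda>y. g i (?p y))" for i
    proof (rule uniformly_continuous_on_compose[of UNIV ?p "g i", unfolded o_def])
      show "uniformly_continuous_on UNIV ?p"
        unfolding uniformly_continuous_on_def
      proof (intro allI impI)
        fix e :: real assume "e > 0"
        moreover have "dist (?p y) (?p z) \<le> dist y z" for y z
          by (rule closest_point_lipschitz) (use R in auto)
        ultimately show "\<exists>d>0. \<forall>y\<in>UNIV. \<forall>z\<in>UNIV. dist z y < d \<longrightarrow> dist (?p z) (?p y) < e"
          by (intro exI[of _ e]) (auto intro: le_less_trans)
      qed
      have "uniformly_continuous_on (cball a R) (g i)"
        by (rule compact_uniformly_continuous) (auto intro: gradient_continuous_on)
      then show "uniformly_continuous_on (range ?p) (g i)"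
        unfolding uniformly_continuous_on_def using p_in by (metis rangeE)
    qed
    show "linear (\<lambda>v. (D i k \<bullet> v) *\<^sub>R D i k)" for i k
      by (rule linearI) (simp_all add: inner_right_distrib scaleR_left_distrib)
    show "norm ((D i k \<bullet> v) *\<^sub>R D i k) \<le> C * norm v" for i k v
    proof -
      have "norm ((D i k \<bullet> v) *\<^sub>R D i k) \<le> norm (D i k) * norm v * norm (D i k)"
        by (simp add: Cauchy_Schwarz_ineq2 mult_right_mono)
      also have "\<dots> = real CARD('l) * norm v" using norm_direction[of i k] by (simp add: power2_eq_square)
      also have "\<dots> \<le> C * norm v" by (rule mult_right_mono) (auto simp: C_def)
      finally show ?thesis .
    qed
    show "\<exists>K. \<forall>k\<ge>K. \<forall>y. norm (difference_estimate i k (?p y) - (D i k \<bullet> g i (?p y)) *\<^sub>R D i k) \<le> \<epsilon>" if "\<epsilon> > 0" for i \<epsilon>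
      using difference_estimate_approx[OF that, of R i] p_in by blast
  qed (use net com step_pos step_lim step_sum direction_average noise projected_drift[OF R] in auto)
  then show ?thesis by blast
qed

end

section \<open>Truncations\<close>

locale dsaawet_path = spsa_path E W \<gamma> \<alpha> c g D \<nu> a
  for E :: "nat \<Rightarrow> ('v::finite \<times> 'v) set" and W :: "nat \<Rightarrow> real^'v^'v"
    and \<gamma> \<alpha> :: "nat \<Rightarrow> real" and c :: "'v \<Rightarrow> real^'l \<Rightarrow> real" and g :: "'v \<Rightarrow> real^'l \<Rightarrow> real^'l"
    and D :: "'v \<Rightarrow> nat \<Rightarrow> real^'l" and \<nu> :: "'v \<Rightarrow> nat \<Rightarrow> real^'l" and a :: "real^'l" +
  fixes M :: "nat \<Rightarrow> real" and xstar :: "real^'l" and Ob x :: "'v \<Rightarrow> nat \<Rightarrow> real^'l" and \<sigma> :: "'v \<Rightarrow> nat \<Rightarrow> nat"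
  assumes M_lim: "filterlim M at_top sequentially"
    and algorithm: "dsaawet E W \<gamma> xstar M Ob x \<sigma>"
    and observation: "\<And>i k. \<gamma> k *\<^sub>R Ob i (Suc k) = \<nu> i k - \<gamma> k *\<^sub>R difference_estimate i k (x i k)"
begin

abbreviation mc :: "nat \<Rightarrow> 'v \<Rightarrow> nat" where
  "mc k i \<equiv> max_counter (E k) (\<lambda>j. \<sigma> j k) i"

abbreviation trial :: "'v \<Rightarrow> nat \<Rightarrow> real^'l" where
  "trial i k \<equiv> trial_point (E k) (W k) (\<gamma> k) xstar (\<lambda>j. x j k) (\<lambda>j. \<sigma> j k) (Ob i (Suc k)) i"

section \<open>Growth and spread of the truncation counters\<close>

lemma initial_counter: "\<sigma> i 0 = 0"
  using algorithm by (simp add: dsaawet_def)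

lemma no_truncation:
  assumes "norm (trial i k) \<le> M (mc k i)"
  shows "x i (Suc k) = trial i k" "\<sigma> i (Suc k) = mc k i"
  using algorithm assms unfolding dsaawet_def Let_def by (auto simp: not_less)

lemma truncation:
  assumes "norm (trial i k) > M (mc k i)"
  shows "x i (Suc k) = xstar" "\<sigma> i (Suc k) = Suc (mc k i)"
  using algorithm assms unfolding dsaawet_def Let_def by auto

lemma counter_le_mc: "(j, i) \<in> E k \<Longrightarrow> \<sigma> j k \<le> mc k i"
  unfolding max_counter_def in_nbrs_def by (rule Max_ge) auto

lemma self_loop: "(i, i) \<in> E k"
  using net unfolding network_def in_nbrs_def by blast

lemma mc_le:
  assumes "\<And>j. \<sigma> j k \<le> m"
  shows "mc k i \<le> m"
  unfolding max_counter_def using self_loop[of i k] assms by (intro Max.boundedI) (auto simp: in_nbrs_def)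

lemma mc_le_counter_Suc: "mc k i \<le> \<sigma> i (Suc k)"
  using no_truncation[of k i] truncation[of k i] by (cases "norm (trial i k) \<le> M (mc k i)") auto

lemma counter_Suc_le: "\<sigma> i (Suc k) \<le> Suc (mc k i)"
  using no_truncation[of k i] truncation[of k i] by (cases "norm (trial i k) \<le> M (mc k i)") auto

lemma counter_propagates: "(j, i) \<in> E k \<Longrightarrow> \<sigma> j k \<le> \<sigma> i (Suc k)"
  using counter_le_mc mc_le_counter_Suc order_trans by blast

lemma counter_mono: "k \<le> l \<Longrightarrow> \<sigma> i k \<le> \<sigma> i l"
  by (induction l rule: dec_induct) (use counter_propagates[OF self_loop] order_trans in blast)+

text \<open>The largest counter grows by at most one per step. A high level is thus reached only
  late, which is what the stability estimate requires.\<close>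

lemma counter_le_time: "\<sigma> i k \<le> k"
proof (induction k arbitrary: i)
  case (Suc k)
  have "mc k i \<le> k" by (rule mc_le) (rule Suc)
  then show ?case using counter_Suc_le[of i k] by simp
qed (simp add: initial_counter)

lemma trial_behind:
  assumes "\<sigma> i k < mc k i"
  shows "trial i k = xstar"
  using assms by (simp add: trial_point_def)

lemma sum_in_nbrs: "(\<Sum>j\<in>in_nbrs (E k) i. W k $ i $ j *\<^sub>R y j) = (\<Sum>j\<in>UNIV. W k $ i $ j *\<^sub>R (y j :: real^'l))"
proof (rule sum.mono_neutral_left)
  have "W k $ i $ j = 0" if "(j, i) \<notin> E k" for j
    using net that unfolding network_def by (metis order_le_less)
  then show "\<forall>j\<in>UNIV - in_nbrs (E k) i. W k $ i $ j *\<^sub>R y j = 0" by (auto simp: in_nbrs_def)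
qed auto

lemma trial_ahead:
  assumes "\<sigma> i k = mc k i"
  shows "trial i k = (\<Sum>j\<in>UNIV. W k $ i $ j *\<^sub>R (if \<sigma> j k = mc k i then x j k else xstar)) + \<gamma> k *\<^sub>R Ob i (Suc k)"
proof -
  have "(\<Sum>j\<in>in_nbrs (E k) i. W k $ i $ j *\<^sub>R (of_bool (\<sigma> j k = mc k i) *\<^sub>R x j k + of_bool (\<sigma> j k < mc k i) *\<^sub>R xstar))
      = (\<Sum>j\<in>in_nbrs (E k) i. W k $ i $ j *\<^sub>R (if \<sigma> j k = mc k i then x j k else xstar))"
    by (rule sum.cong) (use counter_le_mc in \<open>fastforce simp: in_nbrs_def order_le_less\<close>)+
  then show ?thesis using assms by (simp add: trial_point_def sum_in_nbrs)
qed

lemma trial_synchronized: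
  assumes "\<And>j. \<sigma> j k = m"
  shows "mc k i = m" "trial i k = (\<Sum>j\<in>UNIV. W k $ i $ j *\<^sub>R x j k) + \<gamma> k *\<^sub>R Ob i (Suc k)"
proof -
  show mc: "mc k i = m"
    using mc_le[of k m i] counter_le_mc[OF self_loop, of i k] assms by force
  show "trial i k = (\<Sum>j\<in>UNIV. W k $ i $ j *\<^sub>R x j k) + \<gamma> k *\<^sub>R Ob i (Suc k)"
    using trial_ahead[of i k] assms mc by simp
qed

text \<open>A delay after which every level has spread to all agents, fixed by choice so that
  several lemmas can share it.\<close>

definition sync_time :: nat where
  "sync_time = (SOME L. L > 0 \<and> (\<forall>s i k m. m \<le> \<sigma> i s \<longrightarrow> s + L \<le> k \<longrightarrow> (\<forall>j. m \<le> \<sigma> j k)))"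

lemma sync_time: "sync_time > 0" "m \<le> \<sigma> i s \<Longrightarrow> s + sync_time \<le> k \<Longrightarrow> m \<le> \<sigma> j k"
proof -
  obtain L where L: "L > 0" "\<And>S s j k. (\<And>k i j. k \<ge> s \<Longrightarrow> j \<in> S k \<Longrightarrow> (j, i) \<in> E k \<Longrightarrow> i \<in> S (Suc k))
      \<Longrightarrow> j \<in> S s \<Longrightarrow> k \<ge> s + L \<Longrightarrow> S k = UNIV"
    using recurrent_flooding[OF net com] by blast
  have "m \<le> \<sigma> j k" if "m \<le> \<sigma> i s" "s + L \<le> k" for s i k m j
  proof -
    have "(\<lambda>k. {i. m \<le> \<sigma> i k}) k = UNIV"
    proof (rule L(2)[of s _ i])
      show "j \<in> {i. m \<le> \<sigma> i (Suc k)}" if "l \<in> {i. m \<le> \<sigma> i k}" "(l, j) \<in> E k" for k j l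
        using counter_propagates[OF that(2)] that(1) by simp
    qed (use that in auto)
    then show ?thesis by auto
  qed
  then have "\<exists>L. L > 0 \<and> (\<forall>s i k m. m \<le> \<sigma> i s \<longrightarrow> s + L \<le> k \<longrightarrow> (\<forall>j. m \<le> \<sigma> j k))" using L(1) by blast
  then have *: "sync_time > 0 \<and> (\<forall>s i k m. m \<le> \<sigma> i s \<longrightarrow> s + sync_time \<le> k \<longrightarrow> (\<forall>j. m \<le> \<sigma> j k))"
    unfolding sync_time_def by (rule someI_ex)
  then show "sync_time > 0" by blast
  show "m \<le> \<sigma> i s \<Longrightarrow> s + sync_time \<le> k \<Longrightarrow> m \<le> \<sigma> j k" using * by blast
qed

text \<open>An agent that reaches a new level restarts at \<open>xstar\<close>, so at the first time \<open>\<tau>\<close> at which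
  some counter equals \<open>m\<close>, and until all counters agree, the agents at level \<open>m\<close> have not had
  time to move away from \<open>xstar\<close>.\<close>

lemma synchronization_phase:
  assumes first: "\<And>i k. k < \<tau> \<Longrightarrow> \<sigma> i k < m" and m: "m > 0"
    and small: "\<And>i k y. k \<ge> \<tau> \<Longrightarrow> norm (y - xstar) \<le> real L * \<pi> \<Longrightarrow> norm (\<nu> i k - \<gamma> k *\<^sub>R difference_estimate i k y) \<le> \<pi>"
    and M: "norm xstar + real L * \<pi> \<le> M m" and \<pi>: "\<pi> \<ge> 0"
  shows "n \<le> L \<Longrightarrow> \<sigma> i (\<tau> + n) \<le> m \<and> (\<sigma> i (\<tau> + n) = m \<longrightarrow> norm (x i (\<tau> + n) - xstar) \<le> real n * \<pi>)"
proof (induction n arbitrary: i)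
  case 0
  show ?case
  proof (cases \<tau>)
    case 0
    then show ?thesis using m by (simp add: initial_counter)
  next
    case (Suc k)
    \<comment> \<open>All maxima before \<tau> are below \<open>m\<close>, so level \<open>m\<close>
      at time \<tau> can only come from a truncation, which resets the agent to
      \<open>xstar\<close>.\<close>
    have "\<sigma> j k \<le> m - 1" for j using first[of k j] Suc by simp
    then have lt: "mc k i < m" using mc_le[of k "m - 1" i] m by simp
    show ?thesis
      using no_truncation[of k i] truncation[of k i] lt unfolding Suc
      by (cases "norm (trial i k) \<le> M (mc k i)") auto
  qed
next
  case (Suc n)
  define k where "k = \<tau> + n"
  have IH: "\<sigma> j k \<le> m" "\<sigma> j k = m \<Longrightarrow> norm (x j k - xstar) \<le> real n * \<pi>" for j
    using Suc by (auto simp: k_def)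
  have mcm: "mc k i \<le> m" by (rule mc_le) (rule IH)
  have "\<sigma> i (Suc k) \<le> m \<and> (\<sigma> i (Suc k) = m \<longrightarrow> norm (x i (Suc k) - xstar) \<le> real (Suc n) * \<pi>)"
  proof (cases "mc k i = m")
    case False
    then show ?thesis
      using no_truncation[of k i] truncation[of k i] mcm \<pi>
      by (cases "norm (trial i k) \<le> M (mc k i)") auto
  next
    case True
    have ds: "doubly_stochastic (W k)" using com unfolding communication_condition_def by blast
    have tr: "norm (trial i k - xstar) \<le> real (Suc n) * \<pi>"
    proof (cases "\<sigma> i k = mc k i")
      case False
      then have "\<sigma> i k < mc k i" using counter_le_mc[OF self_loop, of i k] by simp
      then show ?thesis using trial_behind[of i k] \<pi> by simp
    next
      case eq: True
      \<comment> \<open>Neighbours below level \<open>m\<close> are replaced by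
        \<open>xstar\<close>, so all averaged points, and hence their average, stay within
        \<open>real n * \<pi>\<close> of \<open>xstar\<close>.\<close>
      let ?y = "\<lambda>j. (if \<sigma> j k = m then x j k else xstar) - xstar"
      have "(\<Sum>j\<in>UNIV. W k $ i $ j *\<^sub>R ?y j) = (\<Sum>j\<in>UNIV. W k $ i $ j *\<^sub>R (if \<sigma> j k = m then x j k else xstar)) - xstar"
        using ds by (simp add: scaleR_right_diff_distrib sum_subtractf scaleR_sum_left[symmetric] doubly_stochastic_def)
      then have "trial i k - xstar = (\<Sum>j\<in>UNIV. W k $ i $ j *\<^sub>R ?y j) + \<gamma> k *\<^sub>R Ob i (Suc k)"
        using trial_ahead[OF eq] True by simp
      moreover have "norm (\<Sum>j\<in>UNIV. W k $ i $ j *\<^sub>R ?y j) \<le> (\<Sum>j\<in>UNIV. W k $ i $ j) * (real n * \<pi>)"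
        by (rule norm_weighted_sum_le) (use ds IH(2) \<pi> in \<open>auto simp: doubly_stochastic_def\<close>)
      moreover have "(\<Sum>j\<in>UNIV. W k $ i $ j) = 1" using ds by (simp add: doubly_stochastic_def)
      moreover have "norm (\<gamma> k *\<^sub>R Ob i (Suc k)) \<le> \<pi>"
        unfolding observation
      proof (rule small)
        have "norm (x i k - xstar) \<le> real n * \<pi>" using IH(2)[of i] eq True by simp
        also have "\<dots> \<le> real L * \<pi>" using Suc.prems \<pi> by (intro mult_right_mono) auto
        finally show "norm (x i k - xstar) \<le> real L * \<pi>" .
      qed (simp add: k_def)
      ultimately show ?thesis
        using norm_triangle_ineq[of "\<Sum>j\<in>UNIV. W k $ i $ j *\<^sub>R ?y j" "\<gamma> k *\<^sub>R Ob i (Suc k)"] by (simp add: algebra_simps)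
    qed
    have "real (Suc n) * \<pi> \<le> real L * \<pi>" using Suc.prems \<pi> by (intro mult_right_mono) auto
    then have "norm (trial i k) \<le> M m" using tr M norm_triangle_sub[of "trial i k" xstar] by linarith
    then show ?thesis using no_truncation[of k i] tr True by simp
  qed
  then show ?case by (simp add: k_def)
qed

text \<open>A level \<open>m\<close> beyond all thresholds of the sample path is either never
  reached, or reached late and with a wide bound \<open>M m\<close>. In the latter case the
  auxiliary process \<open>X\<close> is confined first, and only then identified with the
  iterates.\<close>

lemma counters_bounded: "\<exists>m. \<forall>i k. \<sigma> i k \<le> m"
proof -
  \<comment> \<open>The ball has room for the synchronization phase, which stays within 1 of
    \<open>xstar\<close>, and for the stable motion afterwards, within
    \<open>norm (xstar - a) + 1\<close> of \<open>a\<close>; in both the projection is the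
    identity.\<close>
  define R where "R = norm (xstar - a) + 2"
  have R: "R > 0" by (simp add: R_def add_nonneg_pos)
  let ?F = "\<lambda>i k y. difference_estimate i k (closest_point (cball a R) y)"
  obtain C where "averaged_descent E W \<gamma> ?F (\<lambda>i y. g i (closest_point (cball a R) y)) (\<lambda>i k v. (D i k \<bullet> v) *\<^sub>R D i k) \<nu> a C"
    using projected_averaged_descent[OF R] by blast
  then interpret averaged_descent E W \<gamma> ?F "\<lambda>i y. g i (closest_point (cball a R) y)" "\<lambda>i k v. (D i k \<bullet> v) *\<^sub>R D i k" \<nu> a C .
  have F: "?F i k y = difference_estimate i k y" if "norm (y - a) \<le> R" for i k y
    using that by (simp add: closest_point_self dist_norm norm_minus_commute)
  obtain \<theta>' K1 where \<theta>': "\<theta>' > 0"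
    and K1: "\<And>s x y k i. process s x \<Longrightarrow> s \<ge> K1 \<Longrightarrow> (\<And>i. norm (x i s - y) \<le> \<theta>') \<Longrightarrow> k \<ge> s \<Longrightarrow> norm (x i k - a) \<le> norm (y - a) + 1"
    by (rule process_stable[of 1]) auto
  define L where "L = sync_time"
  have L: "L > 0" by (simp add: L_def sync_time)
  \<comment> \<open>\<open>L\<close> steps of size \<pi> lead at most \<open>min \<theta>' 1\<close>
    away from \<open>xstar\<close>.\<close>
  define \<pi> where "\<pi> = min \<theta>' 1 / real L"
  have \<pi>: "\<pi> > 0" "real L * \<pi> \<le> \<theta>'" "real L * \<pi> \<le> 1" using \<theta>' L by (auto simp: \<pi>_def)
  obtain K2 where K2: "\<And>k i y. k \<ge> K2 \<Longrightarrow> norm (\<nu> i k - \<gamma> k *\<^sub>R ?F i k y) \<le> \<pi>"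
    using perturbation_small[OF \<pi>(1)] by blast
  have "\<forall>\<^sub>F m in sequentially. max (norm a + R) (norm xstar + 1) \<le> M m"
    using M_lim unfolding filterlim_at_top by blast
  then obtain m0 where m0: "\<And>m. m \<ge> m0 \<Longrightarrow> max (norm a + R) (norm xstar + 1) \<le> M m"
    by (auto simp: eventually_sequentially)
  \<comment> \<open>\<open>m0\<close> makes the truncation bound wide, \<open>1\<close> excludes the
    initial level, and \<open>K1\<close>, \<open>K2\<close> make the restart late, since level
    \<open>m\<close> is not reached before time \<open>m\<close>.\<close>
  define m where "m = max (max m0 1) (max K1 K2)"
  have mM: "norm a + R \<le> M m" "norm xstar + 1 \<le> M m" using m0[of m] by (auto simp: m_def)
  show ?thesis
  proof (cases "\<exists>i k. m \<le> \<sigma> i k")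
    case False
    then show ?thesis by (metis nle_le)
  next
    case True
    define \<tau> where "\<tau> = (LEAST k. \<exists>i. m \<le> \<sigma> i k)"
    have "\<exists>k. \<exists>i. m \<le> \<sigma> i k" using True by blast
    then have "\<exists>i. m \<le> \<sigma> i \<tau>" unfolding \<tau>_def by (rule LeastI_ex)
    then obtain i0 where i0: "m \<le> \<sigma> i0 \<tau>" by blast
    have \<tau>m: "m \<le> \<tau>" using i0 counter_le_time[of i0 \<tau>] by simp
    have first: "\<sigma> i k < m" if "k < \<tau>" for i k
      using not_less_Least[of k "\<lambda>k. \<exists>i. m \<le> \<sigma> i k"] that by (auto simp: \<tau>_def not_le)
    define s where "s = \<tau> + L"
    have small: "norm (\<nu> i k - \<gamma> k *\<^sub>R difference_estimate i k y) \<le> \<pi>"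
      if "k \<ge> \<tau>" "norm (y - xstar) \<le> real L * \<pi>" for i k y
    proof -
      have "norm (y - a) \<le> R"
        using that \<pi> norm_triangle_ineq[of "y - xstar" "xstar - a"] by (simp add: R_def)
      then show ?thesis using K2[of k i y] F[of y i k] that \<tau>m by (simp add: m_def)
    qed
    have Ms: "norm xstar + real L * \<pi> \<le> M m" using mM \<pi> by linarith
    have ph: "\<sigma> i s \<le> m \<and> (\<sigma> i s = m \<longrightarrow> norm (x i s - xstar) \<le> real L * \<pi>)" for i
      unfolding s_def
      by (rule synchronization_phase[OF first _ small Ms]) (use \<pi> in \<open>auto simp: m_def\<close>)
    have \<sigma>s: "\<sigma> i s = m" for i
      using ph[of i] sync_time(2)[OF i0, of s i] by (simp add: s_def L_def)
    have xs: "norm (x i s - xstar) \<le> \<theta>'" for i using ph[of i] \<sigma>s[of i] \<pi> by simp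
    define z where "z = rec_nat (\<lambda>i. x i s) (\<lambda>n y i. (\<Sum>j\<in>UNIV. W (s + n) $ i $ j *\<^sub>R y j)
        + (\<nu> i (s + n) - \<gamma> (s + n) *\<^sub>R ?F i (s + n) (y i)))"
    define X where "X i k = z (k - s) i" for i k
    have pr: "process s X"
      unfolding averaging_process_def X_def z_def by (auto simp: Suc_diff_le)
    have Xs: "X i s = x i s" for i by (simp add: X_def z_def)
    have XR: "norm (X i k - a) \<le> R" if "k \<ge> s" for i k
      using K1[OF pr, of xstar k i] xs Xs \<tau>m that by (simp add: R_def s_def m_def)
    \<comment> \<open>While both agree, the projection is invisible because \<open>X\<close> is in
      the ball, and \<open>M m\<close> rules out a truncation; so they agree one step
      longer.\<close>
    have eq: "\<forall>i. x i k = X i k \<and> \<sigma> i k = m" if "k \<ge> s" for k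
      using that
    proof (induction k rule: dec_induct)
      case base
      then show ?case by (simp add: Xs \<sigma>s)
    next
      case (step k)
      show ?case
      proof
        fix i
        have \<sigma>m: "\<sigma> j k = m" for j using step by blast
        have "trial i k = X i (Suc k)"
          using trial_synchronized[OF \<sigma>m, of i] observation[of k i] step F[OF XR[of k i]] pr
          by (simp add: averaging_process_def)
        moreover have "norm (X i (Suc k)) \<le> M m"
          using XR[of "Suc k" i] mM step norm_triangle_sub[of "X i (Suc k)" a] by simp
        ultimately show "x i (Suc k) = X i (Suc k) \<and> \<sigma> i (Suc k) = m"
          using no_truncation[of k i] trial_synchronized(1)[OF \<sigma>m, of i] by simp
      qed
    qed
    have "\<sigma> i k \<le> m" for i k
      using eq[of "max s k"] counter_mono[of k "max s k" i] by auto
    then show ?thesis by blast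
  qed
qed

text \<open>Once the largest counter value is attained and has spread, a truncation would exceed it.
  All later iterates obey the bound \<open>M m\<close>, and projecting to a ball beyond that bound,
  with a radius that depends on the sample path, changes nothing.\<close>

theorem path_converges: "(\<lambda>k. x i k) \<longlonglongrightarrow> a"
proof -
  define m where "m = Max (range (\<lambda>(i, k). \<sigma> i k))"
  obtain m' where m': "\<And>i k. \<sigma> i k \<le> m'" using counters_bounded by blast
  have fin: "finite (range (\<lambda>(i, k). \<sigma> i k))"
    by (rule finite_subset[of _ "{..m'}"]) (use m' in auto)
  have "m \<in> range (\<lambda>(i, k). \<sigma> i k)" unfolding m_def by (rule Max_in[OF fin]) auto
  then obtain i0 k0 where k0: "\<sigma> i0 k0 = m" by auto
  have le: "\<sigma> i k \<le> m" for i k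
    unfolding m_def by (rule Max_ge[OF fin]) (auto intro!: image_eqI[of _ _ "(i, k)"])
  define s where "s = k0 + sync_time"
  have \<sigma>m: "\<sigma> i k = m" if "k \<ge> s" for i k
    using le[of i k] sync_time(2)[of m i0 k0 k i] that k0 by (simp add: s_def)
  have step: "norm (trial i k) \<le> M m \<and> x i (Suc k) = trial i k" if k: "k \<ge> s" for i k
  proof -
    have mc: "mc k i = m" using trial_synchronized(1)[of k m i] \<sigma>m k by simp
    have "norm (trial i k) \<le> M (mc k i)"
      using truncation(2)[of k i] mc \<sigma>m[of "Suc k" i] k by (force simp: not_le[symmetric])
    then show ?thesis using no_truncation[of k i] mc by simp
  qed
  define R where "R = \<bar>M m\<bar> + norm a + 1"
  have R: "R > 0" by (simp add: R_def add_nonneg_pos)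
  let ?F = "\<lambda>i k y. difference_estimate i k (closest_point (cball a R) y)"
  obtain C where "averaged_descent E W \<gamma> ?F (\<lambda>i y. g i (closest_point (cball a R) y)) (\<lambda>i k v. (D i k \<bullet> v) *\<^sub>R D i k) \<nu> a C"
    using projected_averaged_descent[OF R] by blast
  then interpret averaged_descent E W \<gamma> ?F "\<lambda>i y. g i (closest_point (cball a R) y)" "\<lambda>i k v. (D i k \<bullet> v) *\<^sub>R D i k" \<nu> a C .
  have xR: "norm (x i k - a) \<le> R" if k: "k \<ge> Suc s" for i k
  proof -
    obtain l where l: "k = Suc l" "l \<ge> s" using k Suc_le_D[OF k] by auto
    have "norm (x i k) \<le> M m" using step[OF l(2), of i] l by simp
    then show ?thesis using norm_triangle_ineq4[of "x i k" a] by (simp add: R_def)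
  qed
  \<comment> \<open>The bound \<open>M m\<close> is known for values produced at or after time
    \<open>s\<close>, hence the start one step later.\<close>
  have "process (Suc s) x"
    unfolding averaging_process_def
  proof (intro allI impI)
    fix k i assume k: "Suc s \<le> k"
    have "?F i k (x i k) = difference_estimate i k (x i k)"
      using xR[OF k, of i] by (simp add: closest_point_self dist_norm norm_minus_commute)
    then show "x i (Suc k) = (\<Sum>j\<in>UNIV. W k $ i $ j *\<^sub>R x j k) + (\<nu> i k - \<gamma> k *\<^sub>R ?F i k (x i k))"
      using step[of k i] trial_synchronized(2)[of k m i] \<sigma>m observation[of k i] k by simp
  qed
  then show ?thesis by (rule process_converges)
qed

end

section \<open>Almost sure convergence\<close>

text \<open>The powers tend to zero, hence so does \<open>g\<close>; once \<open>g k < 1\<close>,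
  raising the exponent from \<open>p\<close> to 2 only decreases the term.\<close>

lemma summable_power2_of_powr:
  fixes g :: "nat \<Rightarrow> real"
  assumes pos: "\<And>k. g k > 0" and p: "0 < p" "p \<le> 2" and s: "summable (\<lambda>k. g k powr p)"
  shows "summable (\<lambda>k. (g k)\<^sup>2)" "g \<longlonglongrightarrow> 0"
proof -
  have "(\<lambda>k. (g k powr p) powr (1 / p)) \<longlonglongrightarrow> 0"
    by (rule tendsto_zero_powrI[OF summable_LIMSEQ_zero[OF s] tendsto_const]) (use p in auto)
  moreover have "(g k powr p) powr (1 / p) = g k" for k
    using p pos[of k] by (simp add: powr_powr)
  ultimately show lim: "g \<longlonglongrightarrow> 0" by simp
  have "\<forall>\<^sub>F k in sequentially. g k < 1" using lim by (intro order_tendstoD(2)) auto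
  then have "\<forall>\<^sub>F k in sequentially. norm ((g k)\<^sup>2) \<le> g k powr p"
  proof eventually_elim
    case (elim k)
    have "(g k)\<^sup>2 = g k powr 2" using pos[of k] by simp
    also have "\<dots> \<le> g k powr p" using elim pos[of k] p by (intro powr_mono') auto
    finally show ?case by simp
  qed
  then show "summable (\<lambda>k. (g k)\<^sup>2)" by (rule summable_comparison_test_ev[OF _ s])
qed

theorem corollaryV4:
  fixes P :: "'a measure"
    and E :: "nat \<Rightarrow> ('v::finite \<times> 'v) set" and W :: "nat \<Rightarrow> real^'v^'v"
    and c :: "'v \<Rightarrow> real^'l \<Rightarrow> real"
    and \<gamma> \<alpha> M :: "nat \<Rightarrow> real" and p :: real
    and xstar xmin :: "real^'l"
    and \<Delta> :: "'v \<Rightarrow> nat \<Rightarrow> 'a \<Rightarrow> real^'l"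
    and \<xi>p \<xi>m \<xi> :: "'v \<Rightarrow> nat \<Rightarrow> 'a \<Rightarrow> real"
    and Obs x :: "'v \<Rightarrow> nat \<Rightarrow> 'a \<Rightarrow> real^'l" and \<sigma> :: "'v \<Rightarrow> nat \<Rightarrow> 'a \<Rightarrow> nat"
  assumes "prob_space P"
    \<comment> \<open>random directions and noise\<close>
    and "\<And>i. random_directions P (\<Delta> i)"
    and "\<And>i k. \<xi>p i (Suc k) \<in> borel_measurable P"
    and "\<And>i k. \<xi>m i (Suc k) \<in> borel_measurable P"
    \<comment> \<open>communication network\<close>
    and "network E W" and "communication_condition E W"
    \<comment> \<open>algorithm\<close>
    and "\<And>k. M k > 0" and "incseq M" and "filterlim M at_top sequentially" and "norm xstar \<le> M 0"
    and "\<And>i. x i 0 \<in> borel_measurable P"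
    and "\<And>i k \<omega>. \<omega> \<in> space P \<Longrightarrow>
           Obs i (Suc k) \<omega> =
             - (((c i (x i k \<omega> + \<alpha> k *\<^sub>R \<Delta> i k \<omega>) + \<xi>p i (Suc k) \<omega>
                 - c i (x i k \<omega> - \<alpha> k *\<^sub>R \<Delta> i k \<omega>) - \<xi>m i (Suc k) \<omega>) / (2 * \<alpha> k)) *\<^sub>R \<Delta> i k \<omega>)"
    and "\<And>\<omega>. \<omega> \<in> space P \<Longrightarrow>
           dsaawet E W \<gamma> xstar M (\<lambda>i k. Obs i k \<omega>) (\<lambda>i k. x i k \<omega>) (\<lambda>i k. \<sigma> i k \<omega>)"
    \<comment> \<open>step sizes\<close>
    and "\<And>k. \<gamma> k > 0" and "\<not> summable (\<lambda>k. \<gamma> (Suc k))"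
    and "1 < p" and "p \<le> 2" and "summable (\<lambda>k. \<gamma> (Suc k) powr p)"
    and "\<And>k. \<alpha> k > 0" and "\<alpha> \<longlonglongrightarrow> 0"
    and "summable (\<lambda>k. (\<gamma> (Suc k))\<^sup>2 / (\<alpha> (Suc k))\<^sup>2)"
    \<comment> \<open>cost functions\<close>
    and "\<And>i. continuously_differentiable (c i)"
    and "locally_lipschitz_gradient (\<lambda>y. \<Sum>i\<in>UNIV. c i y)"
    and "convex_on UNIV (\<lambda>y. \<Sum>i\<in>UNIV. c i y)"
    and "unique_global_min (\<lambda>y. \<Sum>i\<in>UNIV. c i y) xmin"
    and "\<exists>c0>0. (\<Sum>i\<in>UNIV. c i xstar) < (INF y\<in>sphere 0 c0. \<Sum>i\<in>UNIV. c i y) \<and> norm xstar < c0"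
    \<comment> \<open>observation noise\<close>
    and "\<And>i k \<omega>. \<omega> \<in> space P \<Longrightarrow> \<xi> i (Suc k) \<omega> = \<xi>p i (Suc k) \<omega> - \<xi>m i (Suc k) \<omega>"
    and "\<And>i. noise_indep_directions P (\<xi> i) (\<Delta> i)"
    and "\<And>i. noise_bounded P (\<xi> i) \<or> noise_bounded_second_moment P (\<xi> i)"
  shows "\<forall>i. AE \<omega> in P. (\<lambda>k. x i k \<omega>) \<longlonglongrightarrow> xmin"
proof -
  let ?f = "\<lambda>y. \<Sum>i\<in>UNIV. c i y"
  note P = assms(1) and dir = assms(2) and net = assms(5) and com = assms(6)
  note \<gamma> = assms(14) and \<alpha> = assms(19)
  have \<gamma>2: "summable (\<lambda>k. (\<gamma> (Suc k))\<^sup>2)" and "(\<lambda>k. \<gamma> (Suc k)) \<longlonglongrightarrow> 0"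
    using summable_power2_of_powr[of "\<lambda>k. \<gamma> (Suc k)" p] assms(14,16-18) by auto
  then have \<gamma>2: "summable (\<lambda>k. (\<gamma> k)\<^sup>2)" and \<gamma>0: "\<gamma> \<longlonglongrightarrow> 0"
    by (simp_all only: summable_Suc_iff[of "\<lambda>k. (\<gamma> k)\<^sup>2"] filterlim_sequentially_Suc[of \<gamma>])
  have \<gamma>_sum: "\<not> summable \<gamma>" using assms(15) summable_Suc_iff[of \<gamma>] by simp
  have "\<forall>i. \<exists>g. (\<forall>y. GDERIV (c i) y :> g y) \<and> continuous_on UNIV g"
    using assms(22) unfolding continuously_differentiable_def by blast
  then obtain g where g: "\<And>i y. GDERIV (c i) y :> g i y" "\<And>i. continuous_on UNIV (g i)" by metis
  define w where "w k = \<gamma> (Suc k) / \<alpha> (Suc k)" for k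
  have w: "summable (\<lambda>k. (w k)\<^sup>2)" using assms(21) by (simp add: w_def power_divide)
  have \<xi>m: "\<xi> i (Suc k) \<in> borel_measurable P" for i k
    by (subst measurable_cong[OF assms(27)]) (use assms(3,4) in auto)
  have ae1: "AE \<omega> in P. \<forall>i k r. \<Delta> i k \<omega> $ r = 1 \<or> \<Delta> i k \<omega> $ r = -1"
    by (rule AE_all_countable[THEN iffD2, OF allI], rule AE_directions[OF P dir])
  have ae2: "AE \<omega> in P. \<forall>i r s. summable (\<lambda>k. \<gamma> k * (\<Delta> i k \<omega> $ r * \<Delta> i k \<omega> $ s - of_bool (r = s)))"
    by (rule AE_all_countable[THEN iffD2, OF allI], rule directions_product_series[OF P dir \<gamma>2])
  have ae3: "AE \<omega> in P. \<forall>i r. summable (\<lambda>k. w k * \<xi> i (Suc (Suc k)) \<omega> * \<Delta> i (Suc k) \<omega> $ r)"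
  proof (rule AE_all_countable[THEN iffD2, OF allI])
    fix i
    show "AE \<omega> in P. \<forall>r. summable (\<lambda>k. w k * \<xi> i (Suc (Suc k)) \<omega> * \<Delta> i (Suc k) \<omega> $ r)"
      by (rule noise_series[OF P dir \<xi>m assms(28) AE_summable_weighted_noise[OF P \<xi>m assms(29) w]])
  qed
  have "AE \<omega> in P. \<forall>i. (\<lambda>k. x i k \<omega>) \<longlonglongrightarrow> xmin"
    using ae1 ae2 ae3 AE_space
  proof eventually_elim
    case (elim \<omega>)
    \<comment> \<open>The noise part of \<open>\<gamma> k *\<^sub>R Obs i (Suc k)\<close>; the
      factor 2 stems from the central difference.\<close>
    define \<nu> where "\<nu> i k = - (\<gamma> k / (2 * \<alpha> k) * (\<xi>p i (Suc k) \<omega> - \<xi>m i (Suc k) \<omega>)) *\<^sub>R \<Delta> i k \<omega>" for i k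
    have \<nu>_summable: "summable (\<nu> i)" for i
    proof -
      \<comment> \<open>The term of index 0 involves direction 0, which the independence of noise
        and directions does not cover; a single term does not affect convergence.\<close>
      have "summable (\<lambda>k. \<nu> i (Suc k))"
      proof -
        have "(\<lambda>k. \<nu> i (Suc k) $ r) sums (- (1 / 2) * (\<Sum>k. w k * \<xi> i (Suc (Suc k)) \<omega> * \<Delta> i (Suc k) \<omega> $ r))" for r
        proof -
          have "\<nu> i (Suc k) $ r = - (1 / 2) * (w k * \<xi> i (Suc (Suc k)) \<omega> * \<Delta> i (Suc k) \<omega> $ r)" for k
            using assms(27)[OF elim(4), of i "Suc k"] by (simp add: \<nu>_def w_def)
          then show ?thesis using elim(3) by (simp only:) (intro sums_mult summable_sums, blast)
        qed
        then have "(\<lambda>n. (\<Sum>k<n. \<nu> i (Suc k)) $ r) \<longlonglongrightarrow> (\<chi> r. - (1 / 2) * (\<Sum>k. w k * \<xi> i (Suc (Suc k)) \<omega> * \<Delta> i (Suc k) \<omega> $ r)) $ r" for r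
          by (simp add: sums_def)
        then have "(\<lambda>n. \<Sum>k<n. \<nu> i (Suc k)) \<longlonglongrightarrow> (\<chi> r. - (1 / 2) * (\<Sum>k. w k * \<xi> i (Suc (Suc k)) \<omega> * \<Delta> i (Suc k) \<omega> $ r))"
          by (rule vec_tendstoI)
        then show ?thesis unfolding summable_def sums_def by blast
      qed
      then show ?thesis by (simp add: summable_Suc_iff)
    qed
    interpret spsa_path E W \<gamma> \<alpha> c g "\<lambda>i k. \<Delta> i k \<omega>" \<nu> xmin
      by (rule spsa_path.intro)
         (use net com \<gamma> \<gamma>0 \<gamma>_sum \<alpha> assms(20,24,25) g elim \<nu>_summable in auto)
    interpret dsaawet_path E W \<gamma> \<alpha> c g "\<lambda>i k. \<Delta> i k \<omega>" \<nu> xmin M xstar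
      "\<lambda>i k. Obs i k \<omega>" "\<lambda>i k. x i k \<omega>" "\<lambda>i k. \<sigma> i k \<omega>"
    proof unfold_locales
      fix i k
      show "\<gamma> k *\<^sub>R Obs i (Suc k) \<omega> = \<nu> i k - \<gamma> k *\<^sub>R difference_estimate i k (x i k \<omega>)"
      proof -
        let ?d = "c i (x i k \<omega> + \<alpha> k *\<^sub>R \<Delta> i k \<omega>) - c i (x i k \<omega> - \<alpha> k *\<^sub>R \<Delta> i k \<omega>)"
        let ?x = "\<xi>p i (Suc k) \<omega> - \<xi>m i (Suc k) \<omega>"
        have "\<gamma> k * - ((?d + ?x) / (2 * \<alpha> k)) = - (\<gamma> k / (2 * \<alpha> k) * ?x) - \<gamma> k * (?d / (2 * \<alpha> k))"
          using \<alpha>[of k] by (simp add: field_simps)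
        then have "(\<gamma> k * - ((?d + ?x) / (2 * \<alpha> k))) *\<^sub>R \<Delta> i k \<omega>
            = (- (\<gamma> k / (2 * \<alpha> k) * ?x) - \<gamma> k * (?d / (2 * \<alpha> k))) *\<^sub>R \<Delta> i k \<omega>" by simp
        moreover have "c i (x i k \<omega> + \<alpha> k *\<^sub>R \<Delta> i k \<omega>) + \<xi>p i (Suc k) \<omega>
            - c i (x i k \<omega> - \<alpha> k *\<^sub>R \<Delta> i k \<omega>) - \<xi>m i (Suc k) \<omega> = ?d + ?x" by simp
        ultimately show ?thesis
          unfolding assms(12)[OF elim(4)] \<nu>_def difference_estimate_def
          by (simp only: scaleR_left_diff_distrib scaleR_scaleR scaleR_minus_left scaleR_minus_right mult_minus_right)
      qed
    qed (use assms(9) assms(13)[OF elim(4)] in auto)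
    show ?case using path_converges by blast
  qed
  then show ?thesis by (simp add: AE_all_countable)
qed

end
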